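(* Let $f\in\mathscr{D}'(\mathbb{R}^d)$, $(x_0,\xi_0)\in\mathbb{R}^d\times(\mathbb{R}^d\setminus\{0\})$ and $s\in\mathbb{R}$. The following two conditions are equivalent: (i) There exist an open cone $\Gamma\subset\mathbb{R}^d$ containing $\xi_0$, a number $\eta\in(0,1)$, and a function $\phi\in\mathscr{D}(I_{\eta,x_0})$ with $\phi\equiv 1$ in a neighborhood of $x_0$, such that $$\sum_{n\in\Gamma\cap\mathbb{Z}^d}|a_n|^2\langle n\rangle^{2s}<\infty,\qquad\text{where } (f\phi)_p=\sum_{n\in\mathbb{Z}^d}a_n e_n .$$ (ii) $(x_0,\xi_0)\notin WF_s(f)$.
   Context: For $x\in\mathbb{R}^d$, $|x|$ is the Euclidean norm and $\langle x\rangle=(1+|x|^2)^{1/2}$. For $0<\eta\leq 1$ and $x\in\mathbb{R}^d$, $I_{\eta,x}=\prod_{j=1}^d(x_j-\eta/2,x_j+\eta/2)$. $\mathscr{D}(\Omega)$ is the space of smooth functions with compact support in the open set $\Omega$, and $\mathscr{D}'(\mathbb{R}^d)$ is the space of distributions. A cone is a subset of $\mathbb{R}^d$ invariant under multiplication by positive scalars. For $y\in\mathbb{R}^d$, $e_y(x)=e^{2\pi i y\cdot x}$. The Fourier transform of a compactly supported distribution $g$ is $\widehat{g}(\xi)=\langle g,e_{-\xi}\rangle$, $\xi\in\mathbb{R}^d$. If a distribution $g$ is supported in $I_{\eta,x_0}$ with $0<\eta<1$, its periodic extension (of period 1 in each variable) is $g_p(x)=\sum_{n\in\mathbb{Z}^d}g(x+n)$;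 it has the Fourier series $g_p=\sum_{n\in\mathbb{Z}^d}a_ne_n$ with Fourier coefficients $a_n=\widehat{g}(n)$. Definition of the Sobolev wave front: for $f\in\mathscr{D}'(\mathbb{R}^d)$, $(x_0,\xi_0)\in\mathbb{R}^d\times(\mathbb{R}^d\setminus\{0\})$ and $s\in\mathbb{R}$, one says that $f$ is Sobolev microlocally regular at $(x_0,\xi_0)$ of order $s$, i.e. $(x_0,\xi_0)\notin WF_s(f)$, if there exist an open cone $\Gamma$ containing $\xi_0$ and $\psi\in\mathscr{D}(\mathbb{R}^d)$ with $\psi\equiv1$ in a neighborhood of $x_0$ such that $$\int_\Gamma|\widehat{\psi f}(\xi)|^2\langle\xi\rangle^{2s}\,d\xi<\infty.$$ *)

theory Defs
  imports "HOL-Analysis.Analysis"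
begin

definition partial_deriv :: "'n::finite \<Rightarrow> (real^'n \<Rightarrow> complex) \<Rightarrow> real^'n \<Rightarrow> complex" where
  "partial_deriv j \<phi> x = frechet_derivative \<phi> (at x) (axis j 1)"

primrec iter_partial :: "'n::finite list \<Rightarrow> (real^'n \<Rightarrow> complex) \<Rightarrow> real^'n \<Rightarrow> complex" where
  "iter_partial [] \<phi> = \<phi>"
| "iter_partial (j # js) \<phi> = partial_deriv j (iter_partial js \<phi>)"

definition smooth :: "(real^'n::finite \<Rightarrow> complex) \<Rightarrow> bool" where
  "smooth \<phi> \<longleftrightarrow> (\<forall>js x. iter_partial js \<phi> differentiable (at x))"

definition supp :: "(real^'n::finite \<Rightarrow> complex) \<Rightarrow> (real^'n) set" where
  "supp \<phi> = closure {x. \<phi> x \<noteq> 0}"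

definition test_functions :: "(real^'n::finite) set \<Rightarrow> (real^'n \<Rightarrow> complex) set" where
  "test_functions \<Omega> = {\<phi>. smooth \<phi> \<and> compact (supp \<phi>) \<and> supp \<phi> \<subseteq> \<Omega>}"

(* A distribution on the whole space is a functional on all functions of which only the
   values on test functions are meaningful.  Continuity is the usual seminorm estimate on
   each compact set; lists of coordinate directions of length at most N play the role of
   the multi-indices of order at most N. *)
definition distribution :: "((real^'n::finite \<Rightarrow> complex) \<Rightarrow> complex) \<Rightarrow> bool" where
  "distribution u \<longleftrightarrow>
     (\<forall>\<phi>\<in>test_functions UNIV. \<forall>\<psi>\<in>test_functions UNIV. u (\<lambda>x. \<phi> x + \<psi> x) = u \<phi> + u \<psi>) \<and>
     (\<forall>\<phi>\<in>test_functions UNIV. \<forall>c. u (\<lambda>x. c * \<phi> x) = c * u \<phi>) \<and>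
     (\<forall>K. compact K \<longrightarrow> (\<exists>C N. \<forall>\<phi>\<in>test_functions UNIV. supp \<phi> \<subseteq> K \<longrightarrow>
        norm (u \<phi>) \<le> C * (\<Sum>js | length js \<le> N. SUP x. norm (iter_partial js \<phi> x))))"

(* If \<psi> is a test function, then \<psi> * \<theta> is a test function for every smooth \<theta>, compactly
   supported or not.  Hence dist_mult \<psi> f is meaningful on all smooth functions, and is there
   the canonical extension of the compactly supported distribution \<psi> f. *)
definition dist_mult ::
  "(real^'n::finite \<Rightarrow> complex) \<Rightarrow> ((real^'n \<Rightarrow> complex) \<Rightarrow> complex) \<Rightarrow> (real^'n \<Rightarrow> complex) \<Rightarrow> complex" where
  "dist_mult \<psi> f = (\<lambda>\<theta>. f (\<lambda>x. \<psi> x * \<theta> x))"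

definition plane_wave :: "real^'n::finite \<Rightarrow> real^'n \<Rightarrow> complex" where
  "plane_wave y x = exp (2 * of_real pi * \<i> * of_real (y \<bullet> x))"

(* For compactly supported g, given by its values on all smooth functions. *)
definition fourier :: "((real^'n::finite \<Rightarrow> complex) \<Rightarrow> complex) \<Rightarrow> real^'n \<Rightarrow> complex" where
  "fourier g \<xi> = g (plane_wave (- \<xi>))"

definition japanese :: "real^'n::finite \<Rightarrow> real" where
  "japanese x = sqrt (1 + (norm x)\<^sup>2)"

(* The library's notion conic asks for invariance under c = 0 as well, which would force
   every nonempty open cone to be the whole space. *)
definition open_cone :: "(real^'n::finite) set \<Rightarrow> bool" where
  "open_cone \<Gamma> \<longleftrightarrow> open \<Gamma> \<and> (\<forall>x\<in>\<Gamma>. \<forall>t>0. t *\<^sub>R x \<in> \<Gamma>)"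

definition cube :: "real \<Rightarrow> real^'n::finite \<Rightarrow> (real^'n) set" where
  "cube \<eta> x = {y. \<forall>j. x $ j - \<eta> / 2 < y $ j \<and> y $ j < x $ j + \<eta> / 2}"

definition int_lattice :: "(real^'n::finite) set" where
  "int_lattice = {n. \<forall>j. n $ j \<in> \<int>}"

(* Translation by duality: the translate g(. + n) takes \<theta> to g applied to \<theta>(. - n).  For
   compactly supported g and a test function \<theta> only finitely many summands are nonzero. *)
definition periodic_ext ::
  "((real^'n::finite \<Rightarrow> complex) \<Rightarrow> complex) \<Rightarrow> (real^'n \<Rightarrow> complex) \<Rightarrow> complex" where
  "periodic_ext g \<theta> = (\<Sum>\<^sub>\<infinity>n\<in>int_lattice. g (\<lambda>x. \<theta> (x - n)))"

(* The identity u = (sum over n of a n times e_n) in the space of distributions: the series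
   converges to u when tested against any test function. *)
definition has_fourier_series ::
  "((real^'n::finite \<Rightarrow> complex) \<Rightarrow> complex) \<Rightarrow> (real^'n \<Rightarrow> complex) \<Rightarrow> bool" where
  "has_fourier_series u a \<longleftrightarrow>
     (\<forall>\<theta>\<in>test_functions UNIV.
        ((\<lambda>n. a n * (LINT x|lborel. plane_wave n x * \<theta> x)) has_sum u \<theta>) int_lattice)"

definition sobolev_regular_at ::
  "real \<Rightarrow> ((real^'n::finite \<Rightarrow> complex) \<Rightarrow> complex) \<Rightarrow> real^'n \<Rightarrow> real^'n \<Rightarrow> bool" where
  "sobolev_regular_at s f x\<^sub>0 \<xi>\<^sub>0 \<longleftrightarrow>
     (\<exists>\<Gamma> \<psi>. open_cone \<Gamma> \<and> \<xi>\<^sub>0 \<in> \<Gamma> \<and> \<psi> \<in> test_functions UNIV \<and>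
        (\<forall>\<^sub>F x in nhds x\<^sub>0. \<psi> x = 1) \<and>
        (\<integral>\<^sup>+\<xi>\<in>\<Gamma>. ennreal ((norm (fourier (dist_mult \<psi> f) \<xi>))\<^sup>2 * japanese \<xi> powr (2 * s)) \<partial>lborel) < \<infinity>)"

definition WF :: "real \<Rightarrow> ((real^'n::finite \<Rightarrow> complex) \<Rightarrow> complex) \<Rightarrow> ((real^'n) \<times> (real^'n)) set" where
  "WF s f = {(x\<^sub>0, \<xi>\<^sub>0). \<xi>\<^sub>0 \<noteq> 0 \<and> \<not> sobolev_regular_at s f x\<^sub>0 \<xi>\<^sub>0}"

end

theory Submission
  imports Defs "HOL-Computational_Algebra.Polynomial"
begin

text \<open>
  Let \<open>\<psi> = 1\<close> near \<open>x\<^sub>0\<close>, let \<open>u = \<psi> f\<close>, and shrink the cutoff to a test function \<open>\<phi>\<close> supported where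
  \<open>\<psi> = 1\<close>, so that \<open>\<phi> f = \<phi> u\<close>. The transform of \<open>\<phi> f\<close> at \<open>\<xi>\<close> is then bounded by
  \<open>C \<integral> \<langle>\<xi> - \<zeta>\<rangle>\<^sup>-\<^sup>A |v(\<zeta>)| d\<nu>(\<zeta>)\<close> for every \<open>A\<close>, where \<open>v\<close> is the
  transform of \<open>u\<close> and \<open>\<nu>\<close> is either Lebesgue measure or, if \<open>u\<close> is
  supported in a small cube, the counting measure of the integer lattice (insert the Fourier series of \<open>u\<close>).
  With the roles of the two measures interchanged this serves both implications. In a smaller cone,
  the contribution of \<open>\<zeta> \<notin> \<Gamma>\<close> decays rapidly in \<open>\<zeta>\<close>, because there \<open>|\<xi> - \<zeta>|\<close> dominates \<open>|\<zeta>|\<close> while the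
  transform of \<open>u\<close> grows polynomially; the rest is controlled by Peetre's inequality and Schur's test.
\<close>

section \<open>Smooth functions and test functions\<close>

text \<open>The transform of \<open>\<phi> f\<close> is a value of the functional \<open>f\<close>,
  not an integral, so no convolution theorem is at hand: it can be expressed through the transform
  of \<open>u\<close> only by expanding a smooth function in plane waves, in a sense that
  \<open>f\<close> respects. Periodic expansions suffice. Poisson summation with convergence of all
  derivatives gives the lattice form directly; a cube of side less than 1 keeps the integer
  translates disjoint, so that only the untranslated term remains. For a cutoff of arbitrary support
  several translates may interfere. Averaging over frequency shifts isolates one of them and at the
  same time turns the lattice sum into a Lebesgue integral, so that Fourier inversion on the whole
  space never enters.

  The arbitrary decay exponent is spent on three things: a power beyond the dimension, which makes
  the kernel integrable in either variable for both measures, uniformly in the other variable; a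
  power \<open>\<bar>s\<bar>\<close> for moving the weight from one variable to the other; and a
  power that beats the polynomial growth off the cone.\<close>

lemma partial_deriv_eq:
  "(\<phi> has_derivative \<phi>') (at x) \<Longrightarrow> partial_deriv j \<phi> x = \<phi>' (axis j 1)"
  by (simp add: partial_deriv_def frechet_derivative_at[symmetric])

lemma partial_deriv_add:
  assumes "\<phi> differentiable at x" "\<psi> differentiable at x"
  shows "partial_deriv j (\<lambda>x. \<phi> x + \<psi> x) x = partial_deriv j \<phi> x + partial_deriv j \<psi> x"
proof -
  obtain A B where A: "(\<phi> has_derivative A) (at x)" and B: "(\<psi> has_derivative B) (at x)"
    using assms unfolding differentiable_def by auto
  from partial_deriv_eq[OF has_derivative_add[OF A B], of j]
  show ?thesis by (simp add: partial_deriv_eq[OF A] partial_deriv_eq[OF B])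
qed

lemma partial_deriv_mult:
  assumes "\<phi> differentiable at x" "\<psi> differentiable at x"
  shows "partial_deriv j (\<lambda>x. \<phi> x * \<psi> x) x = partial_deriv j \<phi> x * \<psi> x + \<phi> x * partial_deriv j \<psi> x"
proof -
  obtain A B where A: "(\<phi> has_derivative A) (at x)" and B: "(\<psi> has_derivative B) (at x)"
    using assms unfolding differentiable_def by auto
  from partial_deriv_eq[OF has_derivative_mult[OF A B], of j]
  show ?thesis by (simp add: partial_deriv_eq[OF A] partial_deriv_eq[OF B])
qed

lemma partial_deriv_const: "partial_deriv j (\<lambda>x. c) = (\<lambda>x. 0)"
  by (rule ext) (simp add: partial_deriv_eq[OF has_derivative_const])

lemma iter_partial_append: "iter_partial (js @ ks) \<phi> = iter_partial js (iter_partial ks \<phi>)"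
  by (induction js) auto

lemma smooth_differentiable: "smooth \<phi> \<Longrightarrow> \<phi> differentiable at x"
  unfolding smooth_def using iter_partial.simps(1) by metis

lemma smooth_iter_partial: "smooth \<phi> \<Longrightarrow> smooth (iter_partial js \<phi>)"
  unfolding smooth_def by (metis iter_partial_append)

lemma smooth_partial_deriv: "smooth \<phi> \<Longrightarrow> smooth (partial_deriv j \<phi>)"
  using smooth_iter_partial[of \<phi> "[j]"] by simp

lemma smooth_continuous_on: "smooth \<phi> \<Longrightarrow> continuous_on S \<phi>"
  by (meson continuous_at_imp_continuous_on differentiable_imp_continuous_within smooth_differentiable)

text \<open>Spares explicit formulas for iterated derivatives: for quotients and for the flat
  functions it is enough to exhibit a family of differentiable functions that differentiation does
  not leave.\<close>

lemma smooth_coinduct: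
  assumes "\<phi> \<in> F" "\<And>\<phi> x. \<phi> \<in> F \<Longrightarrow> \<phi> differentiable at x"
    and "\<And>\<phi> j. \<phi> \<in> F \<Longrightarrow> partial_deriv j \<phi> \<in> F"
  shows "smooth \<phi>"
proof -
  have "iter_partial js \<phi> \<in> F" for js
    by (induction js) (use assms in auto)
  then show ?thesis unfolding smooth_def using assms(2) by blast
qed

lemma smooth_const: "smooth (\<lambda>x. c)"
  by (rule smooth_coinduct[of _ "range (\<lambda>c x. c)"]) (auto simp: partial_deriv_const)

lemma iter_partial_add:
  assumes "smooth \<phi>" "smooth \<psi>"
  shows "iter_partial js (\<lambda>x. \<phi> x + \<psi> x) = (\<lambda>x. iter_partial js \<phi> x + iter_partial js \<psi> x)"
proof (induction js)
  case (Cons j js)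
  then show ?case
    using assms smooth_iter_partial smooth_differentiable
    by (auto intro!: ext partial_deriv_add)
qed simp

lemma smooth_add: "smooth \<phi> \<Longrightarrow> smooth \<psi> \<Longrightarrow> smooth (\<lambda>x. \<phi> x + \<psi> x)"
  by (simp add: smooth_def iter_partial_add differentiable_add)

lemma iter_partial_zero: "iter_partial js (\<lambda>x. 0) = (\<lambda>x. 0)"
  by (induction js) (auto simp: partial_deriv_const)

lemma smooth_sum:
  assumes "\<And>i. i \<in> I \<Longrightarrow> smooth (\<phi> i)"
  shows "smooth (\<lambda>x. \<Sum>i\<in>I. \<phi> i x)"
  using assms by (induction I rule: infinite_finite_induct) (auto simp: smooth_const smooth_add)

lemma iter_partial_sum:
  assumes "\<And>i. i \<in> I \<Longrightarrow> smooth (\<phi> i)"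
  shows "iter_partial js (\<lambda>x. \<Sum>i\<in>I. \<phi> i x) = (\<lambda>x. \<Sum>i\<in>I. iter_partial js (\<phi> i) x)"
  using assms
  by (induction I rule: infinite_finite_induct)
    (auto simp: iter_partial_zero iter_partial_add smooth_sum)

text \<open>Index set of the Leibniz rule: every way of sending each direction to one of two
  factors. Keeping repetitions in a list absorbs the binomial coefficients.\<close>

fun list_splits :: "'a list \<Rightarrow> ('a list \<times> 'a list) list" where
  "list_splits [] = [([], [])]"
| "list_splits (x # xs) =
     map (\<lambda>(a, b). (x # a, b)) (list_splits xs) @ map (\<lambda>(a, b). (a, x # b)) (list_splits xs)"

lemma length_list_splits: "length (list_splits xs) = 2 ^ length xs"
  by (induction xs) auto

lemma list_splits_lengths:
  "(a, b) \<in> set (list_splits xs) \<Longrightarrow> length a \<le> length xs \<and> length b \<le> length xs"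
  by (induction xs arbitrary: a b) fastforce+

lemma differentiable_sum_list:
  assumes "\<And>i. i \<in> set xs \<Longrightarrow> F i differentiable at x"
  shows "(\<lambda>x. \<Sum>i\<leftarrow>xs. F i x) differentiable at x"
  using assms by (induction xs) auto

lemma partial_deriv_sum_list:
  assumes "\<And>i. i \<in> set xs \<Longrightarrow> F i differentiable at x"
  shows "partial_deriv j (\<lambda>x. \<Sum>i\<leftarrow>xs. F i x) x = (\<Sum>i\<leftarrow>xs. partial_deriv j (F i) x)"
  using assms
  by (induction xs) (auto simp: partial_deriv_const partial_deriv_add differentiable_sum_list)

lemma iter_partial_mult:
  assumes "smooth \<phi>" "smooth \<psi>"
  shows "iter_partial js (\<lambda>x. \<phi> x * \<psi> x) =
    (\<lambda>x. \<Sum>p\<leftarrow>list_splits js. iter_partial (fst p) \<phi> x * iter_partial (snd p) \<psi> x)"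
proof (induction js)
  case (Cons j js)
  have d: "iter_partial as \<phi> differentiable at x" "iter_partial as \<psi> differentiable at x" for as x
    using assms unfolding smooth_def by auto
  have "iter_partial (j # js) (\<lambda>x. \<phi> x * \<psi> x) x =
     (\<Sum>p\<leftarrow>list_splits js. partial_deriv j (\<lambda>x. iter_partial (fst p) \<phi> x * iter_partial (snd p) \<psi> x) x)" for x
    by (simp add: Cons) (rule partial_deriv_sum_list, auto intro!: differentiable_mult d)
  then show ?case
    by (auto intro!: ext simp: partial_deriv_mult d sum_list_addf[symmetric] comp_def case_prod_unfold)
qed simp

lemma smooth_mult:
  assumes "smooth \<phi>" "smooth \<psi>"
  shows "smooth (\<lambda>x. \<phi> x * \<psi> x)"
  using assms unfolding smooth_def iter_partial_mult[OF assms]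
  by (auto intro!: differentiable_sum_list differentiable_mult)

lemma iter_partial_cmult:
  assumes "smooth \<phi>"
  shows "iter_partial js (\<lambda>x. c * \<phi> x) = (\<lambda>x. c * iter_partial js \<phi> x)"
proof (induction js)
  case (Cons j js)
  have "partial_deriv j (\<lambda>x. c * iter_partial js \<phi> x) x = c * partial_deriv j (iter_partial js \<phi>) x" for x
    using partial_deriv_mult[of "\<lambda>x. c" x "iter_partial js \<phi>" j] assms
    by (simp add: smooth_def partial_deriv_const)
  then show ?case by (auto simp: Cons)
qed simp

lemma smooth_prod:
  assumes "\<And>i. i \<in> I \<Longrightarrow> smooth (\<phi> i)"
  shows "smooth (\<lambda>x. \<Prod>i\<in>I. \<phi> i x)"
  using assms by (induction I rule: infinite_finite_induct) (auto simp: smooth_const smooth_mult)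

text \<open>The family of all \<open>a / \<psi> ^ n\<close> with \<open>a\<close> smooth is stable
  under differentiation: the product rule for \<open>f * \<psi> ^ n = a\<close> is solved for the
  derivative of \<open>f\<close>, which doubles the exponent to \<open>2 * n\<close>.\<close>

lemma smooth_divide:
  assumes "smooth \<phi>" "smooth \<psi>" and nz: "\<And>x. \<psi> x \<noteq> 0"
  shows "smooth (\<lambda>x. \<phi> x / \<psi> x)"
proof (rule smooth_coinduct[of _ "{\<lambda>x. a x / \<psi> x ^ n |a n. smooth a}"])
  show "(\<lambda>x. \<phi> x / \<psi> x) \<in> {\<lambda>x. a x / \<psi> x ^ n |a n. smooth a}"
    using assms(1) by (intro CollectI exI[of _ \<phi>] exI[of _ 1]) auto
next
  fix f x assume "f \<in> {\<lambda>x. a x / \<psi> x ^ n |a n. smooth a}"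
  then obtain a n where f: "f = (\<lambda>x. a x / \<psi> x ^ n)" and a: "smooth a" by auto
  show "f differentiable at x" unfolding f
    using nz by (intro differentiable_divide differentiable_power smooth_differentiable a assms(2)) auto
next
  fix f j assume "f \<in> {\<lambda>x. a x / \<psi> x ^ n |a n. smooth a}"
  then obtain a n where f: "f = (\<lambda>x. a x / \<psi> x ^ n)" and a: "smooth a" by auto
  have pw: "smooth (\<lambda>x. \<psi> x ^ m)" for m
    by (induction m) (auto simp: smooth_const smooth_mult assms(2))
  define b where "b = (\<lambda>x. partial_deriv j a x * \<psi> x ^ n + (-1) * a x * partial_deriv j (\<lambda>x. \<psi> x ^ n) x)"
  have "smooth b"
    unfolding b_def using a pw
    by (intro smooth_add smooth_mult smooth_partial_deriv smooth_const) auto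
  moreover have "partial_deriv j f x = b x / \<psi> x ^ (2 * n)" for x
  proof -
    have fd: "f differentiable at x"
      unfolding f using nz
      by (intro differentiable_divide differentiable_power smooth_differentiable a assms(2)) auto
    have "partial_deriv j (\<lambda>x. f x * \<psi> x ^ n) x = partial_deriv j f x * \<psi> x ^ n + f x * partial_deriv j (\<lambda>x. \<psi> x ^ n) x"
      by (rule partial_deriv_mult[OF fd smooth_differentiable[OF pw]])
    moreover have "(\<lambda>x. f x * \<psi> x ^ n) = a" unfolding f using nz by auto
    ultimately have "partial_deriv j f x * \<psi> x ^ n = partial_deriv j a x - a x / \<psi> x ^ n * partial_deriv j (\<lambda>x. \<psi> x ^ n) x"
      by (simp add: f)
    then show ?thesis using nz[of x]
      by (simp add: b_def field_simps power_add mult_2_right)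
  qed
  ultimately show "partial_deriv j f \<in> {\<lambda>x. a x / \<psi> x ^ n |a n. smooth a}" by blast
qed

lemma iter_partial_translate:
  assumes "smooth \<phi>"
  shows "iter_partial js (\<lambda>x. \<phi> (x - n)) = (\<lambda>x. iter_partial js \<phi> (x - n))"
proof (induction js)
  case (Cons j js)
  have "partial_deriv j (\<lambda>x. iter_partial js \<phi> (x - n)) x = partial_deriv j (iter_partial js \<phi>) (x - n)" for x
  proof -
    obtain A where A: "(iter_partial js \<phi> has_derivative A) (at (x - n))"
      using assms unfolding smooth_def differentiable_def by blast
    have "((\<lambda>x. x - n) has_derivative (\<lambda>h. h)) (at x)" by (auto intro!: derivative_eq_intros)
    from diff_chain_at[OF this A] have "((\<lambda>x. iter_partial js \<phi> (x - n)) has_derivative A) (at x)"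
      by (simp add: o_def)
    with A show ?thesis by (simp add: partial_deriv_eq)
  qed
  then show ?case by (auto simp: Cons)
qed simp

lemma smooth_translate:
  assumes "smooth \<phi>" shows "smooth (\<lambda>x. \<phi> (x - n))"
proof -
  have "(\<lambda>x. iter_partial js \<phi> (x - n)) differentiable at x" for js x
  proof -
    have "(\<lambda>x. x - n) differentiable at x" by (auto intro!: derivative_intros)
    from differentiable_chain_at[OF this, of "iter_partial js \<phi>"] show ?thesis
      using assms by (simp add: smooth_def o_def)
  qed
  then show ?thesis unfolding smooth_def iter_partial_translate[OF assms] by blast
qed

section \<open>Plane waves and their derivatives\<close>

lemma plane_wave_has_derivative:
  "(plane_wave y has_derivative (\<lambda>h. 2 * of_real pi * \<i> * of_real (y \<bullet> h) * plane_wave y x)) (at x)"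
proof -
  have "((\<lambda>x. 2 * of_real pi * \<i> * of_real (y \<bullet> x)) has_derivative (\<lambda>h. 2 * of_real pi * \<i> * of_real (y \<bullet> h))) (at x)"
    by (auto intro!: derivative_eq_intros)
  from has_derivative_compose[OF this DERIV_exp[unfolded has_field_derivative_def]] show ?thesis unfolding plane_wave_def[abs_def]
    by (simp add: mult_ac)
qed

lemma iter_partial_plane_wave:
  "iter_partial js (plane_wave y) = (\<lambda>x. (\<Prod>j\<leftarrow>js. 2 * of_real pi * \<i> * of_real (y $ j)) * plane_wave y x)"
proof (induction js)
  case (Cons j js)
  let ?p = "\<Prod>j\<leftarrow>js. 2 * of_real pi * \<i> * complex_of_real (y $ j)"
  have "partial_deriv j (\<lambda>x. ?p * plane_wave y x) x = ?p * (2 * of_real pi * \<i> * of_real (y \<bullet> axis j 1) * plane_wave y x)" for x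
    by (rule partial_deriv_eq) (intro has_derivative_mult_right plane_wave_has_derivative)
  then show ?case by (auto simp: Cons inner_axis mult_ac)
qed simp

lemma smooth_plane_wave: "smooth (plane_wave y)"
  unfolding smooth_def iter_partial_plane_wave
proof (intro allI differentiable_mult)
  show "plane_wave y differentiable at x" for x
    using plane_wave_has_derivative unfolding differentiable_def by blast
qed simp

lemma plane_wave_add: "plane_wave (y + z) x = plane_wave y x * plane_wave z x"
  by (simp add: plane_wave_def inner_add_left distrib_left exp_add)

lemma plane_wave_add_right: "plane_wave y (x + z) = plane_wave y x * plane_wave y z"
  by (simp add: plane_wave_def inner_add_right distrib_left exp_add)

lemma plane_wave_commute: "plane_wave y x = plane_wave x y"
  by (simp add: plane_wave_def inner_commute)

lemma plane_wave_0 [simp]: "plane_wave 0 x = 1" "plane_wave y 0 = 1"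
  by (simp_all add: plane_wave_def)

lemma norm_plane_wave [simp]: "norm (plane_wave y x) = 1"
  by (simp add: plane_wave_def)

lemma continuous_on_plane_wave [continuous_intros]:
  "continuous_on S g \<Longrightarrow> continuous_on S h \<Longrightarrow> continuous_on S (\<lambda>x. plane_wave (g x) (h x))"
  unfolding plane_wave_def by (intro continuous_intros)

lemma borel_measurable_plane_wave [measurable]: "plane_wave y \<in> borel_measurable borel"
  by (intro borel_measurable_continuous_onI continuous_intros)

section \<open>Supports and closure properties of test functions\<close>

lemma test_functionsD:
  assumes "\<phi> \<in> test_functions \<Omega>"
  shows "smooth \<phi>" "compact (supp \<phi>)" "supp \<phi> \<subseteq> \<Omega>"
  using assms by (auto simp: test_functions_def)

lemma test_functions_UNIV: "\<phi> \<in> test_functions \<Omega> \<Longrightarrow> \<phi> \<in> test_functions UNIV"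
  by (simp add: test_functions_def)

lemma not_in_supp: "x \<notin> supp \<phi> \<Longrightarrow> \<phi> x = 0"
  unfolding supp_def using closure_subset[of "{x. \<phi> x \<noteq> 0}"] by auto

lemma in_supp: "\<phi> x \<noteq> 0 \<Longrightarrow> x \<in> supp \<phi>"
  using not_in_supp[of x \<phi>] by auto

lemma supp_subsetI: "closed K \<Longrightarrow> (\<And>x. \<phi> x \<noteq> 0 \<Longrightarrow> x \<in> K) \<Longrightarrow> supp \<phi> \<subseteq> K"
  unfolding supp_def by (rule closure_minimal) auto

lemma closed_supp: "closed (supp \<phi>)"
  by (simp add: supp_def)

lemma test_functionsI:
  assumes "smooth \<phi>" "compact K" "\<And>x. \<phi> x \<noteq> 0 \<Longrightarrow> x \<in> K" "K \<subseteq> \<Omega>"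
  shows "\<phi> \<in> test_functions \<Omega>"
proof -
  have "supp \<phi> \<subseteq> K" using compact_imp_closed[OF assms(2)] assms(3) by (rule supp_subsetI)
  moreover from this have "compact (supp \<phi>)"
    using compact_Int_closed[OF assms(2) closed_supp, of \<phi>] by (simp add: Int_absorb1)
  ultimately show ?thesis using assms by (auto simp: test_functions_def)
qed

lemma test_functions_mult:
  assumes "\<phi> \<in> test_functions \<Omega>" "smooth \<theta>"
  shows "(\<lambda>x. \<phi> x * \<theta> x) \<in> test_functions \<Omega>"
  using test_functionsD[OF assms(1)] assms(2)
  by (intro test_functionsI[of _ "supp \<phi>"] smooth_mult) (auto dest: in_supp)

lemma test_functions_translate:
  assumes "\<phi> \<in> test_functions UNIV"
  shows "(\<lambda>x. \<phi> (x - n)) \<in> test_functions UNIV"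
proof (rule test_functionsI[of _ "(\<lambda>x. x + n) ` supp \<phi>"])
  show "smooth (\<lambda>x. \<phi> (x - n))" using assms by (intro smooth_translate test_functionsD)
  show "compact ((\<lambda>x. x + n) ` supp \<phi>)" using test_functionsD(2)[OF assms]
    by (intro compact_continuous_image continuous_intros)
  show "x \<in> (\<lambda>x. x + n) ` supp \<phi>" if "\<phi> (x - n) \<noteq> 0" for x
    using that not_in_supp[of "x - n" \<phi>] by (auto intro!: image_eqI[of _ _ "x - n"])
qed simp

lemma partial_deriv_eq_0:
  assumes "x \<notin> supp \<phi>" shows "partial_deriv j \<phi> x = 0"
proof -
  have "(\<phi> has_derivative (\<lambda>h. 0)) (at x)"
  proof (rule has_derivative_transform_within_open[where s="- supp \<phi>"])
    show "((\<lambda>x. 0) has_derivative (\<lambda>h. 0)) (at x)" by simp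
  qed (use assms closed_supp not_in_supp in \<open>auto simp: open_Compl\<close>)
  then show ?thesis by (simp add: partial_deriv_eq)
qed

lemma supp_iter_partial: "supp (iter_partial js \<phi>) \<subseteq> supp \<phi>"
proof (induction js)
  case (Cons j js)
  have "supp (partial_deriv j (iter_partial js \<phi>)) \<subseteq> supp (iter_partial js \<phi>)"
    by (rule supp_subsetI[OF closed_supp]) (use partial_deriv_eq_0 in blast)
  with Cons show ?case by simp
qed simp

lemma test_functions_iter_partial:
  assumes "\<phi> \<in> test_functions \<Omega>" shows "iter_partial js \<phi> \<in> test_functions \<Omega>"
  using test_functionsD[OF assms] supp_iter_partial[of js \<phi>]
  by (intro test_functionsI[of _ "supp \<phi>"] smooth_iter_partial) (auto dest: in_supp)

lemma test_functions_bounded: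
  assumes "\<phi> \<in> test_functions \<Omega>"
  obtains B where "B \<ge> 0" "\<And>x. norm (\<phi> x) \<le> B"
proof -
  have "compact (\<phi> ` supp \<phi>)" using test_functionsD[OF assms]
    by (intro compact_continuous_image smooth_continuous_on)
  then obtain B where B: "\<And>x. x \<in> supp \<phi> \<Longrightarrow> norm (\<phi> x) \<le> B"
    unfolding bounded_iff using compact_imp_bounded bounded_iff by (metis imageI)
  have "norm (\<phi> x) \<le> max B 0" for x
    using B[of x] not_in_supp[of x \<phi>] by (cases "x \<in> supp \<phi>") auto
  then show ?thesis using that[of "max B 0"] by auto
qed

lemma test_functions_integrable:
  assumes "\<phi> \<in> test_functions \<Omega>" "continuous_on UNIV g"
  shows "integrable lborel (\<lambda>x. \<phi> x * g x)"
proof -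
  have "integrable lborel (\<lambda>x. indicator (supp \<phi>) x *\<^sub>R (\<phi> x * g x))"
    using assms
    by (intro borel_integrable_compact continuous_on_mult smooth_continuous_on
        continuous_on_subset[OF assms(2)] test_functionsD[OF assms(1)]) auto
  moreover have "(\<lambda>x. indicator (supp \<phi>) x *\<^sub>R (\<phi> x * g x)) = (\<lambda>x. \<phi> x * g x)"
    by (auto intro!: ext simp: indicator_def not_in_supp)
  ultimately show ?thesis by simp
qed

section \<open>Bump functions\<close>

text \<open>\<open>flat 1\<close> is the classical function exp(-1/t), continued by 0. The
  polynomial in 1/t makes the family closed under differentiation.\<close>

definition flat :: "real poly \<Rightarrow> real \<Rightarrow> real" where
  "flat p t = (if t > 0 then poly p (1 / t) * exp (- (1 / t)) else 0)"

lemma tendsto_poly_times_exp_minus: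
  fixes q :: "real poly"
  shows "((\<lambda>x. poly q x * exp (- x)) \<longlongrightarrow> 0) at_top"
proof -
  have "((\<lambda>x. \<Sum>i\<le>degree q. coeff q i * (x ^ i / exp x)) \<longlongrightarrow> (\<Sum>i\<le>degree q. coeff q i * 0)) at_top"
    by (intro tendsto_sum tendsto_mult tendsto_const tendsto_power_div_exp_0)
  then show ?thesis
    by (simp add: poly_altdef sum_distrib_right sum_divide_distrib exp_minus field_simps)
qed

text \<open>For t > 0 the derivative of p(1/t) exp(-1/t) is (p - p')(1/t) exp(-1/t) divided by the
  square of t, whence the factor \<open>[:0, 0, 1:]\<close>. At 0 both one-sided difference
  quotients tend to 0.\<close>

lemma flat_has_derivative:
  "(flat p has_real_derivative flat ([:0, 0, 1:] * (p - pderiv p)) t) (at t)"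
proof -
  consider "t > 0" | "t < 0" | "t = 0" by linarith
  then show ?thesis
  proof cases
    case 1
    have "((\<lambda>t. poly p (1 / t) * exp (- (1 / t))) has_real_derivative
       flat ([:0, 0, 1:] * (p - pderiv p)) t) (at t)"
      using 1 by (auto intro!: derivative_eq_intros poly_DERIV[THEN DERIV_chain2]
          simp: flat_def field_simps power2_eq_square)
    then show ?thesis
      by (rule has_field_derivative_transform_within_open[where S="{0<..}"]) (use 1 in \<open>auto simp: flat_def\<close>)
  next
    case 2
    have "((\<lambda>t. 0) has_real_derivative 0) (at t)" by simp
    then have "(flat p has_real_derivative 0) (at t)"
      by (rule has_field_derivative_transform_within_open[where S="{..<0}"]) (use 2 in \<open>auto simp: flat_def\<close>)
    then show ?thesis using 2 by (simp add: flat_def)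
  next
    case 3
    have "((\<lambda>h. flat p h / h) \<longlongrightarrow> 0) (at_left 0)"
      by (rule tendsto_eventually) (auto simp: eventually_at flat_def intro!: exI[of _ 1])
    moreover have "((\<lambda>h. flat p h / h) \<longlongrightarrow> 0) (at_right 0)"
    \<comment> \<open>With x = 1/h the quotient becomes a polynomial times exp(-x) at infinity; the
      factor \<open>[:0, 1:]\<close> accounts for the division by h.\<close>
    proof (rule Lim_transform_eventually)
      show "((\<lambda>h. poly ([:0, 1:] * p) (inverse h) * exp (- inverse h)) \<longlongrightarrow> 0) (at_right 0)"
        by (rule filterlim_compose[OF tendsto_poly_times_exp_minus filterlim_inverse_at_top_right])
      show "\<forall>\<^sub>F h in at_right 0. poly ([:0, 1:] * p) (inverse h) * exp (- inverse h) = flat p h / h"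
        by (auto simp: eventually_at flat_def field_simps intro!: exI[of _ 1])
    qed
    ultimately have "((\<lambda>h. flat p h / h) \<longlongrightarrow> 0) (at 0)"
      by (simp add: filterlim_split_at)
    then show ?thesis using 3 by (simp add: DERIV_def flat_def)
  qed
qed

lemma smooth_flat_coordinate: "smooth (\<lambda>x. of_real (flat p (a * x $ j + b)))"
proof (rule smooth_coinduct[of _ "range (\<lambda>p x. of_real (flat p (a * x $ j + b)))"])
  let ?D = "\<lambda>p. [:0, 0, 1:] * (p - pderiv p)"
  have deriv: "((\<lambda>x. complex_of_real (flat p (a * x $ j + b))) has_derivative
      (\<lambda>h. of_real (a * h $ j * flat (?D p) (a * x $ j + b)))) (at x)" for p and x :: "real^'a"
  proof -
    have "((\<lambda>x. a * x $ j + b) has_derivative (\<lambda>h. a * h $ j)) (at x)"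
      using has_derivative_add[OF has_derivative_mult_right[OF
            bounded_linear_imp_has_derivative[OF bounded_linear_vec_nth]] has_derivative_const]
      by simp
    from has_derivative_compose[OF this flat_has_derivative[unfolded has_field_derivative_def]]
    have "((\<lambda>x. flat p (a * x $ j + b)) has_derivative (\<lambda>h. a * h $ j * flat (?D p) (a * x $ j + b))) (at x)"
      by (simp add: mult_ac)
    then show ?thesis by (rule has_derivative_of_real)
  qed
  fix \<phi> :: "real^'a \<Rightarrow> complex" assume "\<phi> \<in> range (\<lambda>p x. of_real (flat p (a * x $ j + b)))"
  then obtain p where p: "\<phi> = (\<lambda>x. of_real (flat p (a * x $ j + b)))" by auto
  show "\<phi> differentiable at x" for x
    unfolding p differentiable_def using deriv by blast
  fix i
  \<comment> \<open>Directions other than \<open>j\<close> give the zero function, which belongs to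
    the family as \<open>flat 0\<close>.\<close>
  have "partial_deriv i \<phi> = (\<lambda>x. of_real (flat (if i = j then smult a (?D p) else 0) (a * x $ j + b)))"
    unfolding p by (rule ext, subst partial_deriv_eq[OF deriv]) (auto simp: axis_def flat_def)
  then show "partial_deriv i \<phi> \<in> range (\<lambda>p x. of_real (flat p (a * x $ j + b)))" by blast
qed auto

lemma flat_1: "flat 1 t \<ge> 0" "flat 1 t > 0 \<longleftrightarrow> t > 0" "flat 1 t = 0 \<longleftrightarrow> t \<le> 0"
  by (auto simp: flat_def)

text \<open>The quotient u / (u + v), where u is positive exactly at distance less than 2r from c
  and v exactly at distance greater than r. One of them is always positive, and the quotient is 1
  where v vanishes.\<close>

lemma plateau_coordinate:
  fixes c r :: real
  assumes "r > 0"
  obtains b :: "real^'n::finite \<Rightarrow> complex"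
  where "smooth b" "\<And>x. \<bar>x $ j - c\<bar> \<le> r \<Longrightarrow> b x = 1" "\<And>x. b x \<noteq> 0 \<Longrightarrow> \<bar>x $ j - c\<bar> \<le> 2 * r"
proof -
  define u v where "u = (\<lambda>x. complex_of_real (flat 1 ((-1) * x $ j + (c + 2 * r))) * of_real (flat 1 (1 * x $ j + (2 * r - c))))"
    and "v = (\<lambda>x. complex_of_real (flat 1 (1 * x $ j + (- c - r))) + of_real (flat 1 ((-1) * x $ j + (c - r))))"
  have sm: "smooth u" "smooth v" unfolding u_def v_def
    by (intro smooth_mult smooth_add smooth_flat_coordinate)+
  have nz: "u x + v x \<noteq> 0" for x
  proof -
    have eq: "u x + v x = of_real (flat 1 ((-1) * x $ j + (c + 2 * r)) * flat 1 (1 * x $ j + (2 * r - c))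
        + (flat 1 (1 * x $ j + (- c - r)) + flat 1 ((-1) * x $ j + (c - r))))"
      by (simp add: u_def v_def)
    have "\<bar>x $ j - c\<bar> < 2 * r \<or> x $ j - c > r \<or> c - x $ j > r" using assms by linarith
    then have "flat 1 ((-1) * x $ j + (c + 2 * r)) * flat 1 (1 * x $ j + (2 * r - c))
        + (flat 1 (1 * x $ j + (- c - r)) + flat 1 ((-1) * x $ j + (c - r))) > 0"
    proof (elim disjE)
      assume "\<bar>x $ j - c\<bar> < 2 * r"
      then show ?thesis by (intro add_pos_nonneg mult_pos_pos) (auto simp: flat_1)
    next
      assume "x $ j - c > r"
      then show ?thesis by (intro add_nonneg_pos add_pos_nonneg mult_nonneg_nonneg) (auto simp: flat_1)
    next
      assume "c - x $ j > r"
      then show ?thesis by (intro add_nonneg_pos mult_nonneg_nonneg) (auto simp: flat_1)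
    qed
    then show ?thesis unfolding eq by (simp del: of_real_add of_real_mult)
  qed
  show thesis
  proof (rule that[of "\<lambda>x. u x / (u x + v x)"])
    show "smooth (\<lambda>x. u x / (u x + v x))" by (intro smooth_divide smooth_add sm nz)
    show "u x / (u x + v x) = 1" if "\<bar>x $ j - c\<bar> \<le> r" for x
    proof -
      have "v x = 0" using that by (auto simp: v_def flat_def)
      with nz[of x] show ?thesis by simp
    qed
    show "\<bar>x $ j - c\<bar> \<le> 2 * r" if "u x / (u x + v x) \<noteq> 0" for x
      using that by (auto simp: u_def flat_1)
  qed
qed

lemma bump_function_exists:
  fixes x0 :: "real^'n::finite"
  assumes "open U" "x0 \<in> U"
  obtains \<rho> where "\<rho> \<in> test_functions U" "\<forall>\<^sub>F x in nhds x0. \<rho> x = 1"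
proof -
  obtain e where e: "e > 0" "ball x0 e \<subseteq> U" using assms openE by blast
  \<comment> \<open>The product is supported in a box of half-width 2r; the l1 bound on the norm
    then gives the radius \<open>CARD('n) * 2 * r = e / 2\<close>.\<close>
  define r where "r = e / (4 * CARD('n))"
  have r: "r > 0" using e by (simp add: r_def)
  have "\<exists>b. smooth b \<and> (\<forall>x. \<bar>x $ j - x0 $ j\<bar> \<le> r \<longrightarrow> b x = 1) \<and>
      (\<forall>x. b x \<noteq> 0 \<longrightarrow> \<bar>x $ j - x0 $ j\<bar> \<le> 2 * r)" for j :: 'n
    by (rule plateau_coordinate[OF r, of j "x0 $ j"]) blast
  then obtain b where b: "\<And>j. smooth (b j)" "\<And>j x. \<bar>x $ j - x0 $ j\<bar> \<le> r \<Longrightarrow> b j x = 1"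
      "\<And>j x. b j x \<noteq> 0 \<Longrightarrow> \<bar>x $ j - x0 $ j\<bar> \<le> 2 * r" for j :: 'n
    by metis
  define \<rho> where "\<rho> x = (\<Prod>j\<in>UNIV. b j x)" for x
  show thesis
  proof (rule that[of \<rho>])
    show "\<rho> \<in> test_functions U"
    proof (rule test_functionsI[of _ "cball x0 (e / 2)"])
      show "smooth \<rho>" unfolding \<rho>_def by (intro smooth_prod b)
      show "x \<in> cball x0 (e / 2)" if "\<rho> x \<noteq> 0" for x
      proof -
        have "\<bar>(x - x0) $ j\<bar> \<le> 2 * r" for j using that b(3)[of j x] by (simp add: \<rho>_def)
        then have "norm (x - x0) \<le> (\<Sum>j\<in>(UNIV::'n set). 2 * r)"
          by (intro order_trans[OF norm_le_l1_cart] sum_mono)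
        also have "\<dots> = e / 2" by (simp add: r_def)
        finally show ?thesis by (simp add: dist_norm norm_minus_commute)
      qed
      show "cball x0 (e / 2) \<subseteq> U" using e by (auto intro: subsetD[OF e(2)])
    qed auto
    have "\<rho> x = 1" if "dist x x0 < r" for x
    proof -
      have "\<bar>x $ j - x0 $ j\<bar> \<le> r" for j
        using component_le_norm_cart[of "x - x0" j] that by (simp add: dist_norm)
      then show ?thesis by (simp add: \<rho>_def b(2))
    qed
    then show "\<forall>\<^sub>F x in nhds x0. \<rho> x = 1" unfolding eventually_nhds_metric using r by blast
  qed
qed

section \<open>Distributions\<close>

lemma distribution_add:
  assumes "distribution f" "\<phi> \<in> test_functions UNIV" "\<psi> \<in> test_functions UNIV"
  shows "f (\<lambda>x. \<phi> x + \<psi> x) = f \<phi> + f \<psi>"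
  using assms unfolding distribution_def by blast

lemma distribution_cmult:
  assumes "distribution f" "\<phi> \<in> test_functions UNIV"
  shows "f (\<lambda>x. c * \<phi> x) = c * f \<phi>"
  using assms unfolding distribution_def by blast

lemma test_functions_0: "(\<lambda>x. 0) \<in> test_functions \<Omega>"
  by (rule test_functionsI[of _ "{}"]) (auto simp: smooth_const)

lemma smooth_diff:
  assumes "smooth \<phi>" "smooth \<psi>" shows "smooth (\<lambda>x. \<phi> x - \<psi> x)"
  using smooth_add[OF assms(1) smooth_mult[OF smooth_const assms(2)], of "-1"] by simp

lemma iter_partial_diff:
  assumes "smooth \<phi>" "smooth \<psi>"
  shows "iter_partial js (\<lambda>x. \<phi> x - \<psi> x) = (\<lambda>x. iter_partial js \<phi> x - iter_partial js \<psi> x)"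
  using iter_partial_add[OF assms(1) smooth_mult[OF smooth_const assms(2)], of js "-1"]
    iter_partial_cmult[OF assms(2), of js "-1"] by simp

lemma distribution_diff:
  assumes f: "distribution f" and "\<phi> \<in> test_functions UNIV" "\<psi> \<in> test_functions UNIV"
  shows "f (\<lambda>x. \<phi> x - \<psi> x) = f \<phi> - f \<psi>"
  using distribution_add[OF f assms(2) test_functions_mult[OF assms(3) smooth_const], of "-1"]
    distribution_cmult[OF f assms(3), of "-1"] by simp

lemma distribution_0: "distribution f \<Longrightarrow> f (\<lambda>x. 0) = 0"
  using distribution_cmult[of f "\<lambda>x. 0" 0] test_functions_0[of UNIV] by simp

lemma test_functions_add:
  assumes "\<phi> \<in> test_functions \<Omega>" "\<psi> \<in> test_functions \<Omega>"
  shows "(\<lambda>x. \<phi> x + \<psi> x) \<in> test_functions \<Omega>"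
proof (rule test_functionsI[of _ "supp \<phi> \<union> supp \<psi>"])
  show "x \<in> supp \<phi> \<union> supp \<psi>" if "\<phi> x + \<psi> x \<noteq> 0" for x
    using that in_supp[of \<phi> x] in_supp[of \<psi> x] by fastforce
  show "smooth (\<lambda>x. \<phi> x + \<psi> x)"
    by (intro smooth_add test_functionsD(1)[OF assms(1)] test_functionsD(1)[OF assms(2)])
qed (use test_functionsD[OF assms(1)] test_functionsD[OF assms(2)] in auto)

lemma test_functions_sum:
  assumes "\<And>i. i \<in> I \<Longrightarrow> \<phi> i \<in> test_functions \<Omega>"
  shows "(\<lambda>x. \<Sum>i\<in>I. \<phi> i x) \<in> test_functions \<Omega>"
  using assms
proof (induction I rule: infinite_finite_induct)
  case (insert i I)
  then show ?case using test_functions_add[of "\<phi> i" \<Omega> "\<lambda>x. \<Sum>i\<in>I. \<phi> i x"] by simp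
qed (simp_all add: test_functions_0)

lemma distribution_sum:
  assumes "distribution f" "\<And>i. i \<in> I \<Longrightarrow> \<phi> i \<in> test_functions UNIV"
  shows "f (\<lambda>x. \<Sum>i\<in>I. \<phi> i x) = (\<Sum>i\<in>I. f (\<phi> i))"
  using assms(2)
proof (induction I rule: infinite_finite_induct)
  case (insert i I)
  then show ?case
    using distribution_add[OF assms(1), of "\<phi> i" "\<lambda>x. \<Sum>i\<in>I. \<phi> i x"]
      test_functions_sum[of I \<phi> UNIV] by simp
qed (simp_all add: distribution_0[OF assms(1)])

section \<open>Quantitative continuity; growth and continuity of the transform\<close>

lemma norm_sum_list_le: "norm (\<Sum>p\<leftarrow>ps. F p) \<le> (\<Sum>p\<leftarrow>ps. norm (F p))"
  by (induction ps) (auto intro: norm_triangle_le)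

text \<open>The Leibniz rule moves the seminorm estimate on the compact set
  \<open>supp \<psi>\<close> from the product to \<open>\<theta>\<close>, which may then be any
  smooth function and is measured on \<open>supp \<psi>\<close> alone. Continuity is used below in
  this form, for plane waves and for partial sums of Fourier series.\<close>

lemma distribution_bound:
  fixes f :: "(real^'n::finite \<Rightarrow> complex) \<Rightarrow> complex"
  assumes f: "distribution f" and \<psi>: "\<psi> \<in> test_functions UNIV"
  obtains C N where "C \<ge> 0"
    "\<And>\<theta> B. smooth \<theta> \<Longrightarrow> B \<ge> 0 \<Longrightarrow>
       (\<And>js x. length js \<le> N \<Longrightarrow> x \<in> supp \<psi> \<Longrightarrow> norm (iter_partial js \<theta> x) \<le> B) \<Longrightarrow>
       norm (f (\<lambda>x. \<psi> x * \<theta> x)) \<le> C * B"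
proof -
  obtain C N where CN: "\<And>\<phi>. \<phi> \<in> test_functions UNIV \<Longrightarrow> supp \<phi> \<subseteq> supp \<psi> \<Longrightarrow>
        norm (f \<phi>) \<le> C * (\<Sum>js | length js \<le> N. SUP x. norm (iter_partial js \<phi> x))"
    using f test_functionsD(2)[OF \<psi>] unfolding distribution_def by meson
  define J where "J = {js :: 'n list. length js \<le> N}"
  have "finite J" unfolding J_def using finite_lists_length_le[of "UNIV :: 'n set" N] by simp
  have "\<exists>M\<ge>0. \<forall>x. norm (iter_partial js \<psi> x) \<le> M" for js
    by (rule test_functions_bounded[OF test_functions_iter_partial[OF \<psi>]]) blast
  then obtain M where M: "\<And>js. M js \<ge> 0" "\<And>js x. norm (iter_partial js \<psi> x) \<le> M js" by metis
  define m where "m = (\<Sum>js\<in>J. M js)"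
  have m: "norm (iter_partial js \<psi> x) \<le> m" if "length js \<le> N" for js x
  proof -
    have "M js \<le> m" unfolding m_def
      using that M(1) \<open>finite J\<close> by (intro member_le_sum) (auto simp: J_def)
    with M(2)[of js x] show ?thesis by simp
  qed
  have "m \<ge> 0" unfolding m_def using M(1) by (intro sum_nonneg)
  show thesis
  \<comment> \<open>\<open>card J\<close> counts the derivatives, \<open>2 ^ N\<close> bounds the
    number of Leibniz terms of each, and \<open>m\<close> bounds the derivatives of
    \<open>\<psi>\<close>. The absolute value is there because the sign of \<open>C\<close> is
    unknown.\<close>
  proof (rule that[of "\<bar>C\<bar> * (card J * (2 ^ N * m))" N])
    show "\<bar>C\<bar> * (card J * (2 ^ N * m)) \<ge> 0" using \<open>m \<ge> 0\<close> by simp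
  next
    fix \<theta> B
    assume \<theta>: "smooth \<theta>" and "B \<ge> 0"
      and B: "\<And>js x. length js \<le> N \<Longrightarrow> x \<in> supp \<psi> \<Longrightarrow> norm (iter_partial js \<theta> x) \<le> B"
    have \<psi>\<theta>: "(\<lambda>x. \<psi> x * \<theta> x) \<in> test_functions UNIV" by (rule test_functions_mult[OF \<psi> \<theta>])
    have le: "norm (iter_partial js (\<lambda>x. \<psi> x * \<theta> x) x) \<le> 2 ^ N * m * B" if js: "length js \<le> N" for js x
    proof -
      have "norm (iter_partial (fst p) \<psi> x * iter_partial (snd p) \<theta> x) \<le> m * B"
        if "p \<in> set (list_splits js)" for p
      proof -
        have len: "length (fst p) \<le> N" "length (snd p) \<le> N"
          using list_splits_lengths[of "fst p" "snd p" js] that js by auto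
        show ?thesis
        proof (cases "x \<in> supp \<psi>")
          case True
          then show ?thesis unfolding norm_mult
            using m[OF len(1)] B[OF len(2)] \<open>m \<ge> 0\<close> by (intro mult_mono) auto
        next
          case False
          then have "x \<notin> supp (iter_partial (fst p) \<psi>)" using supp_iter_partial by blast
          then show ?thesis using not_in_supp[of x "iter_partial (fst p) \<psi>"] \<open>m \<ge> 0\<close> \<open>B \<ge> 0\<close> by simp
        qed
      qed
      then have "(\<Sum>p\<leftarrow>list_splits js. norm (iter_partial (fst p) \<psi> x * iter_partial (snd p) \<theta> x)) \<le>
          (\<Sum>p\<leftarrow>list_splits js. m * B)"
        by (intro sum_list_mono)
      also have "\<dots> = 2 ^ length js * (m * B)"
        by (simp add: sum_list_triv length_list_splits)
      also have "\<dots> \<le> 2 ^ N * (m * B)"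
        using js \<open>m \<ge> 0\<close> \<open>B \<ge> 0\<close> by (intro mult_right_mono power_increasing) auto
      finally have "(\<Sum>p\<leftarrow>list_splits js. norm (iter_partial (fst p) \<psi> x * iter_partial (snd p) \<theta> x)) \<le> 2 ^ N * m * B"
        by simp
      moreover have "norm (iter_partial js (\<lambda>x. \<psi> x * \<theta> x) x) \<le>
          (\<Sum>p\<leftarrow>list_splits js. norm (iter_partial (fst p) \<psi> x * iter_partial (snd p) \<theta> x))"
        unfolding iter_partial_mult[OF test_functionsD(1)[OF \<psi>] \<theta>]
        by (rule norm_sum_list_le)
      ultimately show ?thesis by linarith
    qed
    have "norm (f (\<lambda>x. \<psi> x * \<theta> x)) \<le> C * (\<Sum>js\<in>J. SUP x. norm (iter_partial js (\<lambda>x. \<psi> x * \<theta> x) x))"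
      unfolding J_def using in_supp[of \<psi>] by (intro CN \<psi>\<theta> supp_subsetI closed_supp) auto
    also have "\<dots> \<le> \<bar>C\<bar> * (\<Sum>js\<in>J. SUP x. norm (iter_partial js (\<lambda>x. \<psi> x * \<theta> x) x))"
    proof (rule mult_right_mono)
      show "0 \<le> (\<Sum>js\<in>J. SUP x. norm (iter_partial js (\<lambda>x. \<psi> x * \<theta> x) x))"
      proof (intro sum_nonneg)
        fix js assume "js \<in> J"
        \<comment> \<open>A real supremum dominates the values only over a bounded range; the
          Leibniz bound supplies the boundedness.\<close>
        then have "bdd_above (range (\<lambda>x. norm (iter_partial js (\<lambda>x. \<psi> x * \<theta> x) x)))"
          using le by (auto simp: J_def intro!: bdd_aboveI2)
        then show "0 \<le> (SUP x. norm (iter_partial js (\<lambda>x. \<psi> x * \<theta> x) x))"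
          by (rule cSUP_upper2[where x=0]) auto
      qed
    qed auto
    also have "\<dots> \<le> \<bar>C\<bar> * (\<Sum>js\<in>J. 2 ^ N * m * B)"
      by (intro mult_left_mono sum_mono cSUP_least le) (auto simp: J_def)
    finally show "norm (f (\<lambda>x. \<psi> x * \<theta> x)) \<le> \<bar>C\<bar> * (card J * (2 ^ N * m)) * B"
      by (simp add: mult_ac)
  qed
qed

lemma norm_prod_list_coordinates:
  "norm (\<Prod>j\<leftarrow>js. 2 * complex_of_real pi * \<i> * of_real (y $ j)) \<le> (2 * pi * norm y) ^ length js"
proof (induction js)
  case (Cons j js)
  have "norm (2 * complex_of_real pi * \<i> * of_real (y $ j)) \<le> 2 * pi * norm y"
    using component_le_norm_cart[of y j] by (simp add: norm_mult)
  with Cons show ?case by (auto simp: norm_mult intro!: mult_mono)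
qed simp

lemma japanese_ge_1: "japanese x \<ge> 1"
  by (simp add: japanese_def)

lemma japanese_ge_norm: "japanese x \<ge> norm x"
  by (simp add: japanese_def real_le_rsqrt)

lemma fourier_dist_mult:
  "fourier (dist_mult \<psi> f) \<xi> = f (\<lambda>x. \<psi> x * plane_wave (- \<xi>) x)"
  by (simp add: fourier_def dist_mult_def)

lemma fourier_polynomial_bound:
  fixes f :: "(real^'n::finite \<Rightarrow> complex) \<Rightarrow> complex"
  assumes f: "distribution f" and \<psi>: "\<psi> \<in> test_functions UNIV"
  obtains C N where "C \<ge> 0" "\<And>\<xi>. norm (fourier (dist_mult \<psi> f) \<xi>) \<le> C * japanese \<xi> ^ N"
proof -
  obtain C N where "C \<ge> 0" and CN: "\<And>\<theta> B. smooth \<theta> \<Longrightarrow> B \<ge> 0 \<Longrightarrow>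
       (\<And>js x. length js \<le> N \<Longrightarrow> x \<in> supp \<psi> \<Longrightarrow> norm (iter_partial js \<theta> x) \<le> B) \<Longrightarrow>
       norm (f (\<lambda>x. \<psi> x * \<theta> x)) \<le> C * B"
    by (rule distribution_bound[OF f \<psi>]) blast
  have "norm (f (\<lambda>x. \<psi> x * plane_wave (- \<xi>) x)) \<le> C * (2 * pi * japanese \<xi>) ^ N" for \<xi>
  proof (rule CN[OF smooth_plane_wave])
    \<comment> \<open>A base of at least 1 allows the exponent to be raised from the length of the
      list to \<open>N\<close>.\<close>
    have ge: "1 \<le> 2 * pi * japanese \<xi>"
      using mult_mono[of 1 "2 * pi" 1 "japanese \<xi>"] japanese_ge_1[of \<xi>] pi_gt3 by simp
    then show "0 \<le> (2 * pi * japanese \<xi>) ^ N" by simp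
    fix js :: "'n list" and x assume "length js \<le> N"
    have "norm (iter_partial js (plane_wave (- \<xi>)) x) \<le> (2 * pi * norm (- \<xi>)) ^ length js"
      unfolding iter_partial_plane_wave norm_mult norm_plane_wave mult_1_right
      by (rule norm_prod_list_coordinates)
    also have "\<dots> \<le> (2 * pi * japanese \<xi>) ^ length js"
      using japanese_ge_norm[of \<xi>] by (intro power_mono) auto
    also have "\<dots> \<le> (2 * pi * japanese \<xi>) ^ N"
      using ge \<open>length js \<le> N\<close> by (rule power_increasing[rotated])
    finally show "norm (iter_partial js (plane_wave (- \<xi>)) x) \<le> (2 * pi * japanese \<xi>) ^ N" .
  qed
  then show thesis using that[of "C * (2 * pi) ^ N" N] \<open>C \<ge> 0\<close>
    by (simp add: fourier_dist_mult power_mult_distrib mult_ac)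
qed

lemma continuous_on_prod_list:
  fixes g :: "'a \<Rightarrow> 'b::topological_space \<Rightarrow> complex"
  assumes "\<And>j. j \<in> set js \<Longrightarrow> continuous_on S (g j)"
  shows "continuous_on S (\<lambda>x. \<Prod>j\<leftarrow>js. g j x)"
  using assms by (induction js) (auto intro!: continuous_intros)

text \<open>As y tends to \<xi>, the finitely many relevant derivatives of the plane waves converge
  uniformly on the compact support of \<open>\<psi>\<close>. The result serves to make the transform
  Borel measurable.\<close>

lemma continuous_on_fourier:
  fixes f :: "(real^'n::finite \<Rightarrow> complex) \<Rightarrow> complex"
  assumes f: "distribution f" and \<psi>: "\<psi> \<in> test_functions UNIV"
  shows "continuous_on UNIV (fourier (dist_mult \<psi> f))"
proof (intro continuous_at_imp_continuous_on ballI)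
  fix \<xi>
  obtain C N where "C \<ge> 0" and CN: "\<And>\<theta> B. smooth \<theta> \<Longrightarrow> B \<ge> 0 \<Longrightarrow>
       (\<And>js x. length js \<le> N \<Longrightarrow> x \<in> supp \<psi> \<Longrightarrow> norm (iter_partial js \<theta> x) \<le> B) \<Longrightarrow>
       norm (f (\<lambda>x. \<psi> x * \<theta> x)) \<le> C * B"
    by (rule distribution_bound[OF f \<psi>]) blast
  define g where "g js y x = iter_partial js (plane_wave (- y)) x" for js and y x :: "real^'n"
  have ev: "\<forall>\<^sub>F y in nhds \<xi>. \<forall>x\<in>supp \<psi>. dist (g js y x) (g js \<xi> x) \<le> e" if "e > 0" for js e
  proof -
    have "continuous_on (UNIV \<times> supp \<psi>) (\<lambda>(y, x). g js y x)"
      unfolding g_def iter_partial_plane_wave case_prod_unfold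
      by (intro continuous_intros continuous_on_prod_list)
    \<comment> \<open>Compactness of the support yields one neighbourhood of \<xi> that works for
      all x at once.\<close>
    from continuous_on_prod_compactE[OF this test_functionsD(2)[OF \<psi>] UNIV_I that]
    obtain X where "\<xi> \<in> X" "open X" "\<forall>y\<in>X \<inter> UNIV. \<forall>x\<in>supp \<psi>. dist (g js y x) (g js \<xi> x) \<le> e" by auto
    then show ?thesis unfolding eventually_nhds by auto
  qed
  show "isCont (fourier (dist_mult \<psi> f)) \<xi>"
    unfolding isCont_def tendsto_iff
  proof (intro allI impI)
    fix e :: real assume "e > 0"
    \<comment> \<open>The added 1 covers \<open>C = 0\<close> and makes \<open>C * e' < e\<close>
      strict.\<close>
    define e' where "e' = e / (C + 1)"
    have "e' > 0" using \<open>e > 0\<close> \<open>C \<ge> 0\<close> by (simp add: e'_def)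
    have fin: "finite {js :: 'n list. length js \<le> N}"
      using finite_lists_length_le[of "UNIV :: 'n set" N] by simp
    have "\<forall>\<^sub>F y in nhds \<xi>. \<forall>js\<in>{js. length js \<le> N}. \<forall>x\<in>supp \<psi>. dist (g js y x) (g js \<xi> x) \<le> e'"
      using ev[OF \<open>e' > 0\<close>] by (intro eventually_ball_finite[OF fin]) auto
    then have "\<forall>\<^sub>F y in nhds \<xi>. dist (fourier (dist_mult \<psi> f) y) (fourier (dist_mult \<psi> f) \<xi>) < e"
    proof eventually_elim
      case (elim y)
      have w: "(\<lambda>x. \<psi> x * plane_wave z x) \<in> test_functions UNIV" for z
        by (rule test_functions_mult[OF \<psi> smooth_plane_wave])
      have "norm (f (\<lambda>x. \<psi> x * (plane_wave (- y) x - plane_wave (- \<xi>) x))) \<le> C * e'"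
      proof (rule CN)
        show "smooth (\<lambda>x. plane_wave (- y) x - plane_wave (- \<xi>) x)"
          by (intro smooth_diff smooth_plane_wave)
        fix js :: "'n list" and x assume "length js \<le> N" "x \<in> supp \<psi>"
        with elim show "norm (iter_partial js (\<lambda>x. plane_wave (- y) x - plane_wave (- \<xi>) x) x) \<le> e'"
          by (auto simp: iter_partial_diff[OF smooth_plane_wave smooth_plane_wave] g_def dist_norm)
      qed (use \<open>e' > 0\<close> in auto)
      also have "f (\<lambda>x. \<psi> x * (plane_wave (- y) x - plane_wave (- \<xi>) x)) =
          f (\<lambda>x. \<psi> x * plane_wave (- y) x) - f (\<lambda>x. \<psi> x * plane_wave (- \<xi>) x)"
        using distribution_diff[OF f w w] by (simp add: right_diff_distrib)
      finally have "dist (fourier (dist_mult \<psi> f) y) (fourier (dist_mult \<psi> f) \<xi>) \<le> C * e'"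
        by (simp add: fourier_dist_mult dist_norm)
      also have "C * e' < e" using \<open>e > 0\<close> \<open>C \<ge> 0\<close> by (simp add: e'_def field_simps)
      finally show ?case .
    qed
    then show "\<forall>\<^sub>F y in at \<xi>. dist (fourier (dist_mult \<psi> f) y) (fourier (dist_mult \<psi> f) \<xi>) < e"
      by (simp add: eventually_nhds_conv_at)
  qed
qed

section \<open>Rapid decay of the Fourier transform\<close>

lemma lborel_integral_shift:
  fixes g :: "'a::euclidean_space \<Rightarrow> 'b::{banach, second_countable_topology}"
  assumes "g \<in> borel_measurable borel"
  shows "(LINT x|lborel. g (x + c)) = (LINT x|lborel. g x)"
proof -
  have "(LINT x|lborel. g x) = (LINT x|distr lborel borel ((+) c). g x)"
    by (simp add: lborel_distr_plus)
  also have "\<dots> = (LINT x|lborel. g (c + x))"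
    using assms by (intro integral_distr) auto
  finally show ?thesis by (simp add: add.commute)
qed

lemma nn_integral_shift:
  fixes g :: "'a::euclidean_space \<Rightarrow> ennreal"
  assumes "g \<in> borel_measurable borel"
  shows "(\<integral>\<^sup>+x. g (x + c) \<partial>lborel) = (\<integral>\<^sup>+x. g x \<partial>lborel)"
proof -
  have "(\<integral>\<^sup>+x. g x \<partial>lborel) = (\<integral>\<^sup>+x. g x \<partial>distr lborel borel ((+) c))"
    by (simp add: lborel_distr_plus)
  also have "\<dots> = (\<integral>\<^sup>+x. g (c + x) \<partial>lborel)"
    using assms by (intro nn_integral_distr) auto
  finally show ?thesis by (simp add: add.commute)
qed

lemma smooth_borel_measurable: "smooth \<phi> \<Longrightarrow> \<phi> \<in> borel_measurable borel"
  by (intro borel_measurable_continuous_onI smooth_continuous_on)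

lemma test_functions_integrable': "\<phi> \<in> test_functions \<Omega> \<Longrightarrow> integrable lborel \<phi>"
  using test_functions_integrable[of \<phi> \<Omega> "\<lambda>x. 1"] by simp

text \<open>Difference quotients in direction j have integral zero by translation invariance and
  converge to the derivative under a common integrable bound. No iterated integration is
  involved.\<close>

lemma integral_partial_deriv_eq_0:
  assumes g: "g \<in> test_functions \<Omega>"
  shows "(LINT x|lborel. partial_deriv j g x) = 0"
proof -
  note sm = test_functionsD(1)[OF g]
  define h where "h n = inverse (real (Suc n))" for n
  have h: "h n > 0" "h n \<le> 1" "h n \<noteq> 0" for n by (auto simp: h_def inverse_le_1_iff)
  have h0: "h \<longlonglongrightarrow> 0" unfolding h_def by (rule LIMSEQ_inverse_real_of_nat)
  obtain B where "B \<ge> 0" and B: "\<And>x. norm (partial_deriv j g x) \<le> B"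
    using test_functions_bounded[OF test_functions_iter_partial[OF g, of "[j]"]] by auto
  obtain R where R: "\<And>x. x \<in> supp g \<Longrightarrow> norm x \<le> R"
    using compact_imp_bounded[OF test_functionsD(2)[OF g]] unfolding bounded_iff by auto
  have line: "((\<lambda>t. g (x + t *\<^sub>R axis j 1)) has_derivative (\<lambda>s. s *\<^sub>R partial_deriv j g (x + t *\<^sub>R axis j 1))) (at t within S)" for x t S
  proof -
    obtain A where A: "(g has_derivative A) (at (x + t *\<^sub>R axis j 1))"
      using smooth_differentiable[OF sm] unfolding differentiable_def by blast
    have "((\<lambda>t. x + t *\<^sub>R axis j 1) has_derivative (\<lambda>s. s *\<^sub>R axis j 1)) (at t within S)"
      by (auto intro!: derivative_eq_intros)
    from has_derivative_compose[OF this A]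
    show ?thesis using linear_scale[OF has_derivative_linear[OF A]]
      by (simp add: partial_deriv_eq[OF A])
  qed
  define s where "s n x = inverse (h n) *\<^sub>R (g (x + h n *\<^sub>R axis j 1) - g x)" for n x
  have s_bound: "norm (s n x) \<le> B" for n x
  proof -
    have "norm (g (x + h n *\<^sub>R axis j 1) - g (x + 0 *\<^sub>R axis j 1)) \<le> B * norm (h n - 0)"
    proof (rule differentiable_bound[where S="{0..h n}"])
      show "((\<lambda>t. g (x + t *\<^sub>R axis j 1)) has_derivative (\<lambda>s. s *\<^sub>R partial_deriv j g (x + t *\<^sub>R axis j 1)))
          (at t within {0..h n})" for t by (rule line)
      show "onorm (\<lambda>s. s *\<^sub>R partial_deriv j g (x + t *\<^sub>R axis j 1)) \<le> B" for t
        using mult_right_mono[OF B[of "x + t *\<^sub>R axis j 1"] abs_ge_zero]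
        by (intro onorm_bound[OF \<open>B \<ge> 0\<close>]) (simp add: mult.commute)
    qed (use h in \<open>auto intro: less_imp_le\<close>)
    then show ?thesis using h(1)[of n] unfolding s_def norm_scaleR by (simp add: field_simps)
  qed
  \<comment> \<open>The increments \<open>h n\<close> are at most 1, so enlarging the radius of the
    support by 1 serves all n.\<close>
  have s_0: "s n x = 0" if "x \<notin> cball 0 (R + 1)" for n x
  proof -
    have "norm x \<le> norm (x + h n *\<^sub>R axis j 1) + norm (h n *\<^sub>R (axis j 1 :: real^'a))"
      using norm_triangle_ineq4[of "x + h n *\<^sub>R axis j 1" "h n *\<^sub>R axis j 1"] by simp
    then have "x \<notin> supp g" "x + h n *\<^sub>R axis j 1 \<notin> supp g"
      using R[of x] R[of "x + h n *\<^sub>R axis j 1"] that h[of n] by auto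
    then show ?thesis by (simp add: s_def not_in_supp)
  qed
  have g_shift: "integrable lborel (\<lambda>x. g (x + c))" for c
    using test_functions_integrable'[OF test_functions_translate[OF test_functions_UNIV[OF g], of "-c"]] by simp
  have "(\<lambda>n. LINT x|lborel. s n x) \<longlonglongrightarrow> (LINT x|lborel. partial_deriv j g x)"
  proof (rule integral_dominated_convergence[where w="\<lambda>x. B * indicator (cball 0 (R + 1)) x"])
    show "partial_deriv j g \<in> borel_measurable lborel"
      using smooth_borel_measurable[OF smooth_partial_deriv[OF sm]] by simp
    show "s n \<in> borel_measurable lborel" for n
      unfolding s_def using g_shift[of "h n *\<^sub>R axis j 1"] g_shift[of 0]
      by (intro borel_measurable_scaleR borel_measurable_diff) auto
    show "integrable lborel (\<lambda>x. B * indicator (cball 0 (R + 1)) x)"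
      by (intro integrable_mult_right integrable_real_indicator) (use emeasure_bounded_finite[OF bounded_cball] in auto)
    show "AE x in lborel. (\<lambda>n. s n x) \<longlonglongrightarrow> partial_deriv j g x"
    proof (rule AE_I2)
      fix x
      have "((\<lambda>t. g (x + t *\<^sub>R axis j 1)) has_vector_derivative partial_deriv j g x) (at 0)"
        using line[of x 0 UNIV] by (simp add: has_vector_derivative_def)
      then have lim: "((\<lambda>t. norm (g (x + t *\<^sub>R axis j 1) - g x - t *\<^sub>R partial_deriv j g x) / \<bar>t\<bar>) \<longlongrightarrow> 0) (at 0)"
        by (simp add: has_vector_derivative_def has_derivative_iff_norm)
      have "((\<lambda>t. inverse t *\<^sub>R (g (x + t *\<^sub>R axis j 1) - g x) - partial_deriv j g x) \<longlongrightarrow> 0) (at 0)"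
      proof (rule tendsto_norm_zero_cancel, rule Lim_transform_eventually[OF lim])
        have "norm (D - t *\<^sub>R p) / \<bar>t\<bar> = norm (inverse t *\<^sub>R D - p)" if "t \<noteq> 0" for t and D p :: complex
        proof -
          have "inverse t *\<^sub>R D - p = inverse t *\<^sub>R (D - t *\<^sub>R p)"
            using that by (simp add: scaleR_diff_right)
          then show ?thesis by (simp only: norm_scaleR) (simp add: divide_inverse)
        qed
        then show "\<forall>\<^sub>F t in at 0. norm (g (x + t *\<^sub>R axis j 1) - g x - t *\<^sub>R partial_deriv j g x) / \<bar>t\<bar> =
            norm (inverse t *\<^sub>R (g (x + t *\<^sub>R axis j 1) - g x) - partial_deriv j g x)"
          by (simp add: eventually_at_filter)
      qed
      then have "((\<lambda>t. inverse t *\<^sub>R (g (x + t *\<^sub>R axis j 1) - g x)) \<longlongrightarrow> partial_deriv j g x) (at 0)"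
        by (simp only: LIM_zero_iff)
      then show "(\<lambda>n. s n x) \<longlonglongrightarrow> partial_deriv j g x"
        unfolding s_def by (rule filterlim_compose) (use h0 h(3) in \<open>auto simp: filterlim_at\<close>)
    qed
    show "AE x in lborel. norm (s n x) \<le> B * indicator (cball 0 (R + 1)) x" for n
      using s_bound s_0 by (auto simp: indicator_def)
  qed
  moreover have "(LINT x|lborel. s n x) = 0" for n
    unfolding s_def using g_shift[of "h n *\<^sub>R axis j 1"] g_shift[of 0]
      lborel_integral_shift[OF smooth_borel_measurable[OF sm], of "h n *\<^sub>R axis j 1"]
    by simp
  ultimately show ?thesis by (simp add: LIMSEQ_const_iff)
qed

text \<open>The integral by which \<open>has_fourier_series\<close> tests a plane wave. With the
  positive sign in the exponent it is the Fourier transform of \<open>\<theta>\<close> at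
  \<open>- y\<close>.\<close>

definition inv_fourier :: "(real^'n::finite \<Rightarrow> complex) \<Rightarrow> real^'n \<Rightarrow> complex" where
  "inv_fourier \<theta> y = (LINT x|lborel. plane_wave y x * \<theta> x)"

lemma integrable_plane_wave_mult:
  "\<theta> \<in> test_functions \<Omega> \<Longrightarrow> integrable lborel (\<lambda>x. plane_wave y x * \<theta> x)"
  using test_functions_integrable[of \<theta> \<Omega> "plane_wave y"]
  by (simp add: mult.commute continuous_intros)

lemma inv_fourier_partial_deriv:
  assumes "\<theta> \<in> test_functions \<Omega>"
  shows "inv_fourier (partial_deriv j \<theta>) y = - (2 * of_real pi * \<i> * of_real (y $ j)) * inv_fourier \<theta> y"
proof -
  note sm = test_functionsD(1)[OF assms]
  let ?c = "2 * complex_of_real pi * \<i> * of_real (y $ j)"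
  have "partial_deriv j (\<lambda>x. \<theta> x * plane_wave y x) x = plane_wave y x * partial_deriv j \<theta> x + ?c * (plane_wave y x * \<theta> x)" for x
    using partial_deriv_mult[OF smooth_differentiable[OF sm] smooth_differentiable[OF smooth_plane_wave], where j=j]
      fun_cong[OF iter_partial_plane_wave[of "[j]" y]] by (simp add: mult_ac)
  moreover have "integrable lborel (\<lambda>x. plane_wave y x * partial_deriv j \<theta> x)"
    using integrable_plane_wave_mult[OF test_functions_iter_partial[OF assms, of "[j]"]] by simp
  ultimately have "0 = inv_fourier (partial_deriv j \<theta>) y + ?c * inv_fourier \<theta> y"
    using integral_partial_deriv_eq_0[OF test_functions_mult[OF assms smooth_plane_wave], of j y]
      integrable_plane_wave_mult[OF assms]
    by (simp add: inv_fourier_def)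
  then show ?thesis by (simp add: add_eq_0_iff)
qed

lemma inv_fourier_iter_partial:
  assumes "\<theta> \<in> test_functions \<Omega>"
  shows "inv_fourier (iter_partial js \<theta>) y = (\<Prod>j\<leftarrow>js. - (2 * of_real pi * \<i> * of_real (y $ j))) * inv_fourier \<theta> y"
proof (induction js)
  case (Cons j js)
  then show ?case
    using inv_fourier_partial_deriv[OF test_functions_iter_partial[OF assms]] by (simp add: mult_ac)
qed simp

lemma inv_fourier_bounded:
  assumes "\<theta> \<in> test_functions \<Omega>"
  obtains C where "C \<ge> 0" "\<And>y. norm (inv_fourier \<theta> y) \<le> C"
proof (rule that)
  show "(LINT x|lborel. norm (\<theta> x)) \<ge> 0" by simp
  fix y
  have "norm (inv_fourier \<theta> y) \<le> (LINT x|lborel. norm (plane_wave y x * \<theta> x))"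
    unfolding inv_fourier_def by (rule integral_norm_bound)
  then show "norm (inv_fourier \<theta> y) \<le> (LINT x|lborel. norm (\<theta> x))" by (simp add: norm_mult)
qed

text \<open>For large y some coordinate is comparable to \<open>japanese y\<close>; differentiating
  N times in that direction multiplies the transform by a power of this coordinate, while the
  transform of the derivative stays bounded.\<close>

lemma inv_fourier_rapid_decay:
  fixes \<theta> :: "real^'n::finite \<Rightarrow> complex"
  assumes \<theta>: "\<theta> \<in> test_functions \<Omega>"
  obtains C where "C \<ge> 0" "\<And>y. norm (inv_fourier \<theta> y) \<le> C * japanese y powr (- A)"
proof -
  \<comment> \<open>For negative \<open>A\<close> this is 0, and \<open>A \<le> real N\<close> holds
    in every case.\<close>
  define N where "N = nat \<lceil>A\<rceil>"
  \<comment> \<open>One more than the dimension d: if every coordinate were below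
    \<open>japanese y / ?d\<close>, then \<open>japanese y \<le> 1 + norm y\<close> would give
    \<open>japanese y \<le> 1 + d * japanese y / (d + 1)\<close>, that is
    \<open>japanese y \<le> ?d\<close>.\<close>
  let ?d = "real CARD('n) + 1"
  have "\<exists>C\<ge>0. \<forall>y. norm (inv_fourier (iter_partial (replicate N j) \<theta>) y) \<le> C" for j
    by (rule inv_fourier_bounded[OF test_functions_iter_partial[OF \<theta>]]) blast
  then obtain C where C: "\<And>j. C j \<ge> 0" "\<And>j y. norm (inv_fourier (iter_partial (replicate N j) \<theta>) y) \<le> C j"
    by metis
  obtain C0 where C0: "C0 \<ge> 0" "\<And>y. norm (inv_fourier \<theta> y) \<le> C0"
    by (rule inv_fourier_bounded[OF \<theta>]) blast
  define D where "D = ?d ^ N * (C0 + (\<Sum>j\<in>UNIV. C j))"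
  have "D \<ge> 0" unfolding D_def using C C0 by (intro mult_nonneg_nonneg add_nonneg_nonneg sum_nonneg) auto
  have "norm (inv_fourier \<theta> y) \<le> D * japanese y powr (- A)" for y
  proof -
    have j1: "japanese y \<ge> 1" by (rule japanese_ge_1)
    have "\<exists>C'. C' \<le> C0 + (\<Sum>j\<in>UNIV. C j) \<and> japanese y ^ N * norm (inv_fourier \<theta> y) \<le> ?d ^ N * C'"
    proof (cases "japanese y \<le> ?d")
      case True
      then show ?thesis using C C0 j1
        by (intro exI[of _ C0] conjI mult_mono power_mono) (auto intro: sum_nonneg)
    next
      case False
      have "\<exists>j. japanese y \<le> ?d * \<bar>y $ j\<bar>"
      proof (rule ccontr)
        assume "\<nexists>j. japanese y \<le> ?d * \<bar>y $ j\<bar>"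
        then have "\<bar>y $ j\<bar> \<le> japanese y / ?d" for j
          by (simp add: field_simps not_le less_imp_le)
        then have "(\<Sum>j\<in>UNIV. \<bar>y $ j\<bar>) \<le> (\<Sum>j\<in>(UNIV::'n set). japanese y / ?d)"
          by (intro sum_mono)
        then have "norm y \<le> CARD('n) * (japanese y / ?d)"
          using norm_le_l1_cart[of y] by simp
        moreover have "japanese y \<le> 1 + norm y"
          unfolding japanese_def by (rule real_le_lsqrt) (auto simp: power2_eq_square algebra_simps)
        ultimately have "japanese y \<le> 1 + CARD('n) * (japanese y / ?d)" by linarith
        then have "japanese y \<le> ?d" by (simp add: field_simps)
        with False show False by simp
      qed
      then obtain j where j: "japanese y \<le> ?d * \<bar>y $ j\<bar>" ..
      have "\<bar>y $ j\<bar> ^ N * norm (inv_fourier \<theta> y) \<le> (2 * pi * \<bar>y $ j\<bar>) ^ N * norm (inv_fourier \<theta> y)"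
        using pi_gt3 by (intro mult_right_mono power_mono) (auto simp: mult_le_cancel_right1)
      also have "\<dots> = norm (inv_fourier (iter_partial (replicate N j) \<theta>) y)"
        by (simp add: inv_fourier_iter_partial[OF \<theta>] norm_mult norm_power)
      also have "\<dots> \<le> C j" by (rule C)
      finally have le: "\<bar>y $ j\<bar> ^ N * norm (inv_fourier \<theta> y) \<le> C j" .
      have "japanese y ^ N * norm (inv_fourier \<theta> y) \<le> (?d * \<bar>y $ j\<bar>) ^ N * norm (inv_fourier \<theta> y)"
        using j j1 by (intro mult_right_mono power_mono) auto
      also have "\<dots> = ?d ^ N * (\<bar>y $ j\<bar> ^ N * norm (inv_fourier \<theta> y))"
        by (simp add: power_mult_distrib)
      also have "\<dots> \<le> ?d ^ N * C j" using le by (intro mult_left_mono) auto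
      finally show ?thesis using C C0
        by (intro exI[of _ "C j"] conjI add_increasing member_le_sum) auto
    qed
    then obtain C' where C': "C' \<le> C0 + (\<Sum>j\<in>UNIV. C j)"
      and le: "japanese y ^ N * norm (inv_fourier \<theta> y) \<le> ?d ^ N * C'" by blast
    have "japanese y ^ N * norm (inv_fourier \<theta> y) \<le> D"
      unfolding D_def by (rule order_trans[OF le], rule mult_left_mono[OF C']) simp
    moreover have "japanese y powr A \<le> japanese y ^ N"
    proof -
      have "japanese y powr A \<le> japanese y powr real N"
        using j1 by (intro powr_mono) (auto simp: N_def of_nat_ceiling)
      then show ?thesis using j1 by (simp add: powr_realpow)
    qed
    ultimately have "japanese y powr A * norm (inv_fourier \<theta> y) \<le> D"
      using mult_right_mono[of "japanese y powr A" "japanese y ^ N" "norm (inv_fourier \<theta> y)"] by simp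
    then show ?thesis using j1 by (simp add: powr_minus field_simps)
  qed
  with \<open>D \<ge> 0\<close> show thesis by (rule that)
qed

section \<open>Lattice cells\<close>

text \<open>Half-open, so that the integer translates partition the space exactly and not merely up
  to null sets.\<close>

definition unit_cell :: "real^'n::finite \<Rightarrow> (real^'n) set" where
  "unit_cell a = {x. \<forall>j. a $ j \<le> x $ j \<and> x $ j < a $ j + 1}"

lemma int_lattice_eq: "int_lattice = range (\<lambda>z. \<chi> j. of_int (z j))"
proof (intro set_eqI iffI)
  fix n :: "real^'n" assume "n \<in> int_lattice"
  then have "n = (\<chi> j. of_int \<lfloor>n $ j\<rfloor>)"
    by (auto simp: vec_eq_iff int_lattice_def)
  then show "n \<in> range (\<lambda>z. \<chi> j. of_int (z j))"
    by (rule image_eqI[of _ _ "\<lambda>j. \<lfloor>n $ j\<rfloor>"]) simp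
qed (auto simp: int_lattice_def)

lemma countable_int_lattice: "countable (int_lattice :: (real^'n::finite) set)"
proof -
  have "countable (UNIV :: ('n \<Rightarrow> int) set)" by simp
  then show ?thesis unfolding int_lattice_eq by (rule countable_image)
qed

lemma finite_int_lattice_bounded: "finite {n \<in> int_lattice. norm (n :: real^'n::finite) \<le> R}"
proof (rule finite_subset)
  let ?A = "{- \<lceil>R\<rceil>..\<lceil>R\<rceil>}"
  show "{n \<in> int_lattice. norm n \<le> R} \<subseteq> (\<lambda>z. \<chi> j. of_int (z j)) ` ((UNIV :: 'n set) \<rightarrow>\<^sub>E ?A)"
  proof (rule subsetI)
    fix n :: "real^'n" assume "n \<in> {n \<in> int_lattice. norm n \<le> R}"
    then have n: "n \<in> int_lattice" "norm n \<le> R" by auto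
    then obtain z where z: "n = (\<chi> j. of_int (z j))" unfolding int_lattice_eq by auto
    have "z j \<in> ?A" for j
    proof -
      have "\<bar>of_int (z j)\<bar> \<le> R" using component_le_norm_cart[of n j] n z by simp
      then have "\<bar>of_int (z j)\<bar> \<le> real_of_int \<lceil>R\<rceil>" by linarith
      then show ?thesis by (simp add: abs_le_iff flip: of_int_abs)
    qed
    then show "n \<in> (\<lambda>z. \<chi> j. of_int (z j)) ` (UNIV \<rightarrow>\<^sub>E ?A)"
      unfolding z by (intro imageI) auto
  qed
  show "finite ((\<lambda>z. \<chi> j. real_of_int (z j)) ` ((UNIV :: 'n set) \<rightarrow>\<^sub>E ?A))"
    by (intro finite_imageI finite_PiE) auto
qed

lemma int_lattice_closed:
  "m \<in> int_lattice \<Longrightarrow> n \<in> int_lattice \<Longrightarrow> m + n \<in> int_lattice"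
  "n \<in> int_lattice \<Longrightarrow> - n \<in> int_lattice"
  "0 \<in> int_lattice" "axis j 1 \<in> int_lattice"
  by (auto simp: int_lattice_def axis_def)

lemma plane_wave_int_lattice:
  assumes "k \<in> int_lattice" "n \<in> int_lattice"
  shows "plane_wave k n = 1"
proof -
  have "k \<bullet> n \<in> \<int>" using assms by (auto simp: int_lattice_def inner_vec_def)
  then show ?thesis unfolding plane_wave_def
    using exp_integer_2pi[of "of_real (k \<bullet> n)"] by (auto simp: mult_ac elim: Ints_cases)
qed

lemma unit_cell_unique:
  "\<exists>!n. n \<in> int_lattice \<and> x + n \<in> unit_cell a"
proof (rule ex1I[of _ "\<chi> j. - of_int \<lfloor>x $ j - a $ j\<rfloor>"])
  show "(\<chi> j. - of_int \<lfloor>x $ j - a $ j\<rfloor>) \<in> int_lattice \<and> x + (\<chi> j. - of_int \<lfloor>x $ j - a $ j\<rfloor>) \<in> unit_cell a"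
    by (auto simp: int_lattice_def unit_cell_def algebra_simps) linarith+
  fix n assume n: "n \<in> int_lattice \<and> x + n \<in> unit_cell a"
  then obtain z where z: "n = (\<chi> j. of_int (z j))" unfolding int_lattice_eq by auto
  have "z j = - \<lfloor>x $ j - a $ j\<rfloor>" for j
  proof -
    have "a $ j \<le> x $ j + z j" "x $ j + z j < a $ j + 1" using n z by (auto simp: unit_cell_def)
    then have "\<lfloor>x $ j - a $ j\<rfloor> = - z j" by (intro floor_unique) auto
    then show ?thesis by simp
  qed
  then show "n = (\<chi> j. - of_int \<lfloor>x $ j - a $ j\<rfloor>)" by (simp add: z vec_eq_iff)
qed

lemma unit_cell_borel [measurable]: "unit_cell (a :: real^'n::finite) \<in> sets borel"
proof -
  have "unit_cell a = (\<Inter>j. {x. a $ j \<le> x $ j \<and> x $ j < a $ j + 1})"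
    by (auto simp: unit_cell_def)
  also have "\<dots> \<in> sets borel"
    by (intro sets.finite_INT) auto
  finally show ?thesis .
qed

lemma unit_cell_subset_cbox: "unit_cell a \<subseteq> cbox a (a + 1)"
  by (auto simp: unit_cell_def mem_box_cart less_imp_le)

lemma box_subset_unit_cell: "box a (a + 1) \<subseteq> unit_cell a"
  by (auto simp: unit_cell_def mem_box_cart less_imp_le)

lemma emeasure_unit_cell: "emeasure lborel (unit_cell (a :: real^'n::finite)) = 1"
proof (rule antisym)
  have one: "(1 :: real^'n) \<bullet> b = 1" if "b \<in> Basis" for b
    using that by (auto simp: Basis_vec_def inner_axis)
  have "emeasure lborel (unit_cell a) \<le> emeasure lborel (cbox a (a + 1))"
    by (rule emeasure_mono[OF unit_cell_subset_cbox]) simp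
  also have "\<dots> = 1" by (subst emeasure_lborel_cbox) (auto simp: one inner_add_left)
  finally show "emeasure lborel (unit_cell a) \<le> 1" .
  have "1 = emeasure lborel (box a (a + 1))" by (subst emeasure_lborel_box) (auto simp: one inner_add_left)
  also have "\<dots> \<le> emeasure lborel (unit_cell a)"
    by (rule emeasure_mono[OF box_subset_unit_cell]) simp
  finally show "1 \<le> emeasure lborel (unit_cell a)" .
qed

lemma set_integrable_unit_cell:
  fixes g :: "real^'n::finite \<Rightarrow> 'b::{banach, second_countable_topology}"
  assumes "continuous_on UNIV g"
  shows "set_integrable lborel (unit_cell a) g"
proof (rule set_integrable_subset)
  show "set_integrable lborel (cbox a (a + 1)) g"
    unfolding set_integrable_def
    by (intro borel_integrable_compact continuous_on_subset[OF assms]) auto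
qed (auto simp: unit_cell_subset_cbox)

lemma unit_cell_indicator_sum:
  assumes "finite F" "F \<subseteq> int_lattice" "n \<in> F" "x + n \<in> unit_cell a"
  shows "(\<Sum>m\<in>F. indicator (unit_cell a) (x + m)) = (1 :: 'b::semiring_1)"
proof -
  have "(\<Sum>m\<in>F. indicator (unit_cell a) (x + m)) = (\<Sum>m\<in>F. if m = n then 1 else (0::'b))"
    using assms unit_cell_unique[of x a]
    by (intro sum.cong) (auto simp: indicator_def)
  then show ?thesis using assms by simp
qed

text \<open>Interchange sum and integral, translate each integral back by n, and use that the
  indicators of the translated cells add up to 1.\<close>

lemma nn_integral_tiling:
  fixes g :: "real^'n::finite \<Rightarrow> ennreal"
  assumes [measurable]: "g \<in> borel_measurable borel"
  shows "(\<integral>\<^sup>+x. g x \<partial>lborel) =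
    (\<integral>\<^sup>+x. indicator (unit_cell a) x * (\<integral>\<^sup>+n. g (x - n) \<partial>count_space int_lattice) \<partial>lborel)"
proof -
  have "(\<integral>\<^sup>+x. indicator (unit_cell a) x * (\<integral>\<^sup>+n. g (x - n) \<partial>count_space int_lattice) \<partial>lborel) =
     (\<integral>\<^sup>+x. (\<integral>\<^sup>+n. indicator (unit_cell a) x * g (x - n) \<partial>count_space int_lattice) \<partial>lborel)"
    by (simp add: nn_integral_cmult)
  also have "\<dots> = (\<integral>\<^sup>+n. (\<integral>\<^sup>+x. indicator (unit_cell a) x * g (x - n) \<partial>lborel) \<partial>count_space int_lattice)"
    by (rule nn_integral_count_space_nn_integral[OF countable_int_lattice]) measurable
  also have "\<dots> = (\<integral>\<^sup>+n. (\<integral>\<^sup>+x. indicator (unit_cell a) (x + n) * g x \<partial>lborel) \<partial>count_space int_lattice)"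
  proof (rule nn_integral_cong)
    fix n :: "real^'n"
    show "(\<integral>\<^sup>+x. indicator (unit_cell a) x * g (x - n) \<partial>lborel) = (\<integral>\<^sup>+x. indicator (unit_cell a) (x + n) * g x \<partial>lborel)"
      using nn_integral_shift[of "\<lambda>x. indicator (unit_cell a) x * g (x - n)" n] by simp
  qed
  also have "\<dots> = (\<integral>\<^sup>+x. (\<integral>\<^sup>+n. indicator (unit_cell a) (x + n) * g x \<partial>count_space int_lattice) \<partial>lborel)"
    by (rule nn_integral_count_space_nn_integral[OF countable_int_lattice, symmetric]) measurable
  also have "\<dots> = (\<integral>\<^sup>+x. g x \<partial>lborel)"
  proof (rule nn_integral_cong)
    fix x
    obtain n where n: "n \<in> int_lattice" "x + n \<in> unit_cell a" using unit_cell_unique by blast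
    have "(\<integral>\<^sup>+n. indicator (unit_cell a) (x + n) * g x \<partial>count_space int_lattice) =
        (\<Sum>n\<in>{n}. indicator (unit_cell a) (x + n) * g x)"
      using n unit_cell_unique[of x a]
      by (intro nn_integral_count_space') (auto simp: indicator_def)
    then show "(\<integral>\<^sup>+n. indicator (unit_cell a) (x + n) * g x \<partial>count_space int_lattice) = g x"
      using n by simp
  qed
  finally show ?thesis by simp
qed

text \<open>An integer frequency makes the plane wave periodic, so the integral of the periodization
  over one cell unfolds to an integral over the whole space. Mere integrability of
  \<open>\<theta>\<close> is assumed so that indicators of cells are covered along with test
  functions.\<close>

lemma integral_unfold:
  fixes \<theta> :: "real^'n::finite \<Rightarrow> complex"
  assumes \<theta>: "integrable lborel \<theta>" and F: "finite F" "F \<subseteq> int_lattice"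
    and cover: "\<And>n x. n \<in> int_lattice \<Longrightarrow> x \<in> unit_cell a \<Longrightarrow> \<theta> (x - n) \<noteq> 0 \<Longrightarrow> n \<in> F"
    and k: "k \<in> int_lattice"
  shows "(LINT x:unit_cell a|lborel. plane_wave k x * (\<Sum>n\<in>F. \<theta> (x - n))) = inv_fourier \<theta> k"
proof -
  have [measurable]: "\<theta> \<in> borel_measurable borel"
    using borel_measurable_integrable[OF \<theta>] by simp
  define h where "h n x = indicator (unit_cell a) (x + n) *\<^sub>R (plane_wave k x * \<theta> x)" for n x
  have [measurable]: "h n \<in> borel_measurable borel" for n
    unfolding h_def by measurable
  have int: "integrable lborel (h n)" for n
    by (rule Bochner_Integration.integrable_bound[OF \<theta>]) (auto simp: h_def indicator_def norm_mult)
  have h_eq: "indicator (unit_cell a) x *\<^sub>R (plane_wave k x * \<theta> (x - n)) = h n (x - n)" if "n \<in> F" for n x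
  proof -
    have "plane_wave k x = plane_wave k (x + - n) * plane_wave k n"
      using plane_wave_add_right[of k "x + - n" n] by simp
    also have "plane_wave k n = 1" using that F k by (intro plane_wave_int_lattice) auto
    finally show ?thesis by (simp add: h_def)
  qed
  have int': "integrable lborel (\<lambda>x. h n (x - n))" for n
  proof -
    have "integrable (distr lborel borel ((+) (- n))) (h n)" using int by (simp add: lborel_distr_plus)
    then show ?thesis by (subst (asm) integrable_distr_eq) simp_all
  qed
  have "(LINT x:unit_cell a|lborel. plane_wave k x * (\<Sum>n\<in>F. \<theta> (x - n))) =
      (LINT x|lborel. (\<Sum>n\<in>F. h n (x - n)))"
    unfolding set_lebesgue_integral_def
    by (intro Bochner_Integration.integral_cong) (auto simp: sum_distrib_left scaleR_sum_right h_eq intro!: sum.cong)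
  also have "\<dots> = (\<Sum>n\<in>F. LINT x|lborel. h n (x - n))"
    by (rule Bochner_Integration.integral_sum) (rule int')
  also have "\<dots> = (\<Sum>n\<in>F. LINT x|lborel. h n x)"
    using lborel_integral_shift[of "h _" "- _"] by (intro sum.cong refl) simp
  also have "\<dots> = (LINT x|lborel. (\<Sum>n\<in>F. h n x))"
    by (rule Bochner_Integration.integral_sum[symmetric]) (rule int)
  also have "\<dots> = inv_fourier \<theta> k"
    unfolding inv_fourier_def
  proof (rule Bochner_Integration.integral_cong[OF refl])
    fix x
    show "(\<Sum>n\<in>F. h n x) = plane_wave k x * \<theta> x"
    proof (cases "\<theta> x = 0")
      case False
      obtain n where n: "n \<in> int_lattice" "x + n \<in> unit_cell a" using unit_cell_unique by blast
      with False have "n \<in> F" using cover[of n "x + n"] by simp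
      from unit_cell_indicator_sum[OF F this n(2), where 'b=real]
      show ?thesis by (simp add: h_def flip: scaleR_sum_left)
    qed (simp add: h_def)
  qed
  finally show ?thesis .
qed

section \<open>Orthogonality of the integer plane waves on a cell\<close>

lemma unit_cell_subset_cball: "unit_cell a \<subseteq> cball a (CARD('n))" for a :: "real^'n::finite"
proof
  fix y assume y: "y \<in> unit_cell a"
  have "norm (y - a) \<le> (\<Sum>j\<in>(UNIV::'n set). \<bar>(y - a) $ j\<bar>)" by (rule norm_le_l1_cart)
  also have "\<dots> \<le> (\<Sum>j\<in>(UNIV::'n set). 1)"
    using y by (intro sum_mono) (auto simp: unit_cell_def abs_le_iff less_imp_le algebra_simps)
  finally show "y \<in> cball a (CARD('n))" by (simp add: dist_norm norm_minus_commute)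
qed

lemma unit_cell_diff_bounded:
  fixes a :: "real^'n::finite"
  assumes "x \<in> unit_cell a" "x - n \<in> cball b R"
  shows "norm n \<le> norm a + norm b + R + CARD('n)"
proof -
  have "norm (x - a) \<le> CARD('n)"
    using assms(1) unit_cell_subset_cball[of a] by (auto simp: dist_norm norm_minus_commute)
  moreover have "norm (x - n - b) \<le> R" using assms(2) by (simp add: dist_norm norm_minus_commute)
  moreover have "norm n \<le> norm (x - a) + norm a + norm b + norm (x - n - b)"
  proof -
    have "n = (x - a) + a - b - (x - n - b)" by simp
    then have "norm n \<le> norm ((x - a) + a - b) + norm (x - n - b)" by (metis norm_triangle_ineq4)
    moreover have "norm ((x - a) + a - b) \<le> norm ((x - a) + a) + norm b" by (rule norm_triangle_ineq4)
    moreover have "norm ((x - a) + a) \<le> norm (x - a) + norm a" by (rule norm_triangle_ineq)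
    ultimately show ?thesis by linarith
  qed
  ultimately show ?thesis by linarith
qed

text \<open>Unfold the indicator of the cell at b over the cell at a: its periodization is the
  constant 1.\<close>

lemma integral_plane_wave_unit_cell_indep:
  fixes a b :: "real^'n::finite"
  assumes k: "k \<in> int_lattice"
  shows "(LINT x:unit_cell a|lborel. plane_wave k x) = (LINT x:unit_cell b|lborel. plane_wave k x)"
proof -
  define \<theta> :: "real^'n \<Rightarrow> complex" where "\<theta> = indicator (unit_cell b)"
  define F where "F = {n \<in> int_lattice. norm (n :: real^'n) \<le> norm a + norm b + real CARD('n) + CARD('n)}"
  have "finite F" unfolding F_def by (rule finite_int_lattice_bounded)
  have cover: "n \<in> F" if "n \<in> int_lattice" "x \<in> unit_cell a" "\<theta> (x - n) \<noteq> 0" for n x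
    using that unit_cell_subset_cball[of b] unit_cell_diff_bounded[of x a n b "CARD('n)"]
    by (auto simp: F_def \<theta>_def indicator_def split: if_splits)
  have "integrable lborel \<theta>"
  proof -
    have "integrable lborel (\<lambda>x. indicator (unit_cell b) x *\<^sub>R (1 :: complex))"
      by (intro integrable_scaleR_left integrable_real_indicator) (auto simp: emeasure_unit_cell)
    moreover have "(\<lambda>x. indicator (unit_cell b) x *\<^sub>R (1 :: complex)) = \<theta>"
      by (auto simp: \<theta>_def indicator_def)
    ultimately show ?thesis by simp
  qed
  from integral_unfold[OF this \<open>finite F\<close> _ cover k]
  have int: "(LINT x:unit_cell a|lborel. plane_wave k x * (\<Sum>n\<in>F. \<theta> (x - n))) = inv_fourier \<theta> k"
    by (auto simp: F_def)
  have "(\<Sum>n\<in>F. \<theta> (x - n)) = 1" if "x \<in> unit_cell a" for x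
  proof -
    obtain m where m: "m \<in> int_lattice" "x + m \<in> unit_cell b" using unit_cell_unique by blast
    \<comment> \<open>The count of cells translates by \<open>x + n\<close>, the periodization by
      \<open>x - n\<close>; hence the reflected index set.\<close>
    have "m \<in> uminus ` F"
      using cover[of "- m" x] m that by (intro image_eqI[of _ _ "- m"]) (auto simp: \<theta>_def int_lattice_closed)
    then have "(\<Sum>n\<in>uminus ` F. indicator (unit_cell b) (x + n)) = (1::complex)"
      using \<open>finite F\<close> m by (intro unit_cell_indicator_sum) (auto simp: F_def int_lattice_closed)
    then show ?thesis by (simp add: sum.reindex \<theta>_def)
  qed
  then have "(LINT x:unit_cell a|lborel. plane_wave k x) =
      (LINT x:unit_cell a|lborel. plane_wave k x * (\<Sum>n\<in>F. \<theta> (x - n)))"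
    by (intro set_lebesgue_integral_cong) auto
  also have "\<dots> = inv_fourier \<theta> k" by (rule int)
  also have "\<dots> = (LINT x:unit_cell b|lborel. plane_wave k x)"
    unfolding inv_fourier_def set_lebesgue_integral_def
    by (intro Bochner_Integration.integral_cong) (auto simp: \<theta>_def indicator_def)
  finally show ?thesis .
qed

text \<open>For \<open>k \<noteq> 0\<close> a translation by y with
  \<open>k \<bullet> y = 1 / 2\<close> changes the sign of the wave. Since the integral is the same
  over every cell, it equals its own negative.\<close>

lemma integral_plane_wave_unit_cell:
  fixes a :: "real^'n::finite"
  assumes k: "k \<in> int_lattice"
  shows "(LINT x:unit_cell a|lborel. plane_wave k x) = (if k = 0 then 1 else 0)"
proof (cases "k = 0")
  case True
  have "(LINT x:unit_cell a|lborel. plane_wave k x) = of_real (measure lborel (unit_cell a))"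
    using True by (simp add: set_lebesgue_integral_def scaleR_conv_of_real)
  then show ?thesis using True by (simp add: measure_def emeasure_unit_cell)
next
  case False
  then obtain j where j: "k $ j \<noteq> 0" by (auto simp: vec_eq_iff)
  define y where "y = axis j (1 / (2 * k $ j))"
  have ky: "k \<bullet> y = 1 / 2" using j by (simp add: y_def inner_axis)
  then have "plane_wave k y = exp (\<i> * of_real pi)" unfolding plane_wave_def ky by simp
  then have y: "plane_wave k y = -1" by simp
  have "(LINT x:unit_cell a|lborel. plane_wave k x) =
      (LINT x|lborel. indicator (unit_cell a) (x + y) *\<^sub>R plane_wave k (x + y))"
    unfolding set_lebesgue_integral_def
    by (rule lborel_integral_shift[symmetric]) measurable
  also have "\<dots> = (LINT x|lborel. - (indicator (unit_cell (a - y)) x *\<^sub>R plane_wave k x))"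
    by (intro Bochner_Integration.integral_cong)
      (auto simp: plane_wave_add_right y indicator_def unit_cell_def algebra_simps)
  also have "\<dots> = - (LINT x:unit_cell (a - y)|lborel. plane_wave k x)"
    by (simp add: set_lebesgue_integral_def)
  also have "\<dots> = - (LINT x:unit_cell a|lborel. plane_wave k x)"
    using integral_plane_wave_unit_cell_indep[OF k] by metis
  finally show ?thesis using False by simp
qed

text \<open>The powers of \<open>\<Prod>\<^sub>j (1 + cos (2\<pi>(x\<^sub>j - c\<^sub>j))) / 2\<close> are trigonometric polynomials that concentrate
  at the centre \<open>c\<close> of the cell, so integrating \<open>D\<close> against them would detect a nonzero value of \<open>D\<close> at \<open>c\<close>.\<close>

lemma fourier_uniqueness_cell:
  fixes a :: "real^'n::finite"
  assumes D: "continuous_on UNIV D"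
    and zero: "\<And>k. k \<in> int_lattice \<Longrightarrow> (LINT x:unit_cell a|lborel. plane_wave k x * D x) = 0"
  shows "D (\<chi> j. a $ j + 1 / 2) = 0"
proof (rule ccontr)
  define c :: "real^'n" where "c = (\<chi> j. a $ j + 1 / 2)"
  assume "D (\<chi> j. a $ j + 1 / 2) \<noteq> 0"
  then have Dc: "D c \<noteq> 0" by (simp add: c_def)
  \<comment> \<open>After this normalization the real part is 1 at \<open>c\<close>, so a signed
    real estimate is enough.\<close>
  define E where "E x = D x / D c" for x
  have E: "continuous_on UNIV E" unfolding E_def using Dc by (intro continuous_intros D) auto
  have Ec: "E c = 1" using Dc by (simp add: E_def)
  \<comment> \<open>Multiplication by a trigonometric polynomial with integer frequencies only
    shifts and combines coefficients, so this property passes from \<open>E\<close> to all its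
    products with powers of the kernel.\<close>
  define P where "P g \<longleftrightarrow> continuous_on UNIV g \<and>
      (\<forall>k\<in>int_lattice. (LINT x:unit_cell a|lborel. plane_wave k x * g x) = 0)" for g :: "real^'n \<Rightarrow> complex"
  have "P E"
    unfolding P_def using E zero by (auto simp: E_def)
  define q where "q j x = (1 + cos (2 * pi * (x $ j - c $ j))) / 2" for j :: 'n and x :: "real^'n"
  have q_eq: "complex_of_real (q j x) = 1 / 2 + 1 / 4 * plane_wave (axis j 1) (- c) * plane_wave (axis j 1) x
      + 1 / 4 * plane_wave (- axis j 1) (- c) * plane_wave (- axis j 1) x" for j x
  proof -
    define t where "t = 2 * pi * (x $ j - c $ j)"
    have "complex_of_real (cos t) = (exp (\<i> * of_real t) + exp (- (\<i> * of_real t))) / 2"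
      by (simp add: cos_of_real[symmetric] cos_exp_eq)
    moreover have "exp (\<i> * complex_of_real t) = plane_wave (axis j 1) (- c) * plane_wave (axis j 1) x"
      "exp (- (\<i> * complex_of_real t)) = plane_wave (- axis j 1) (- c) * plane_wave (- axis j 1) x"
      by (simp_all add: t_def plane_wave_def exp_add[symmetric] inner_axis' algebra_simps)
    ultimately have "complex_of_real (cos t) = (plane_wave (axis j 1) (- c) * plane_wave (axis j 1) x
        + plane_wave (- axis j 1) (- c) * plane_wave (- axis j 1) x) / 2" by (simp only:)
    then have "complex_of_real ((1 + cos t) / 2) = (1 + (plane_wave (axis j 1) (- c) * plane_wave (axis j 1) x
        + plane_wave (- axis j 1) (- c) * plane_wave (- axis j 1) x) / 2) / 2"
      by (simp only: of_real_divide of_real_add of_real_1 of_real_numeral)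
    then show ?thesis unfolding q_def t_def[symmetric] by (simp add: add_divide_distrib mult.commute)
  qed
  have P_step: "P (\<lambda>x. of_real (q j x) * g x)" if "P g" for j g
    unfolding P_def
  proof (intro conjI ballI)
    have g: "continuous_on UNIV g" using that by (simp add: P_def)
    show "continuous_on UNIV (\<lambda>x. of_real (q j x) * g x)"
      unfolding q_def by (intro continuous_intros g) auto
    fix k :: "real^'n" assume k: "k \<in> int_lattice"
    define u v where "u = axis j 1 + k" and "v = - axis j 1 + k"
    have uv: "u \<in> int_lattice" "v \<in> int_lattice"
      unfolding u_def v_def by (intro int_lattice_closed k)+
    define \<alpha> \<beta> \<gamma> where "\<alpha> = 1 / 4 * plane_wave (axis j 1) (- c)"
      and "\<beta> = 1 / 4 * plane_wave (- axis j 1) (- c)" and "\<gamma> = (1 / 2 :: complex)"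
    have "plane_wave k x * (of_real (q j x) * g x) =
        \<gamma> * (plane_wave k x * g x) + \<alpha> * (plane_wave u x * g x) + \<beta> * (plane_wave v x * g x)" for x
      unfolding q_eq u_def v_def plane_wave_add \<alpha>_def \<beta>_def \<gamma>_def by (simp add: algebra_simps)
    moreover have "set_integrable lborel (unit_cell a) (\<lambda>x. b * (plane_wave m x * g x))" for b m
      by (intro set_integrable_unit_cell continuous_intros g)
    ultimately show "(LINT x:unit_cell a|lborel. plane_wave k x * (of_real (q j x) * g x)) = 0"
      using that k uv by (simp add: set_integral_add P_def)
  qed
  define Q where "Q x = (\<Prod>j\<in>UNIV. q j x)" for x
  have P_Q: "P (\<lambda>x. of_real (Q x) * g x)" if "P g" for g
  proof -
    have "finite J \<Longrightarrow> P (\<lambda>x. of_real (\<Prod>j\<in>J. q j x) * g x)" for J :: "'n set"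
    proof (induction J rule: finite_induct)
      case (insert j J)
      then show ?case using P_step[of "\<lambda>x. of_real (\<Prod>j\<in>J. q j x) * g x" j] by (simp add: mult_ac)
    qed (use that in simp)
    from this[OF finite] show ?thesis by (simp add: Q_def)
  qed
  have P_QN: "P (\<lambda>x. of_real (Q x ^ N) * E x)" for N
  proof (induction N)
    case (Suc N)
    from P_Q[OF this] show ?case by (simp add: mult_ac)
  qed (use \<open>P E\<close> in simp)
  have Q_cont: "continuous_on UNIV Q" unfolding Q_def q_def by (intro continuous_intros) auto
  have q_bounds: "0 \<le> q j x" "q j x \<le> 1" for j x
    unfolding q_def using cos_ge_minus_one[of "2 * pi * (x $ j - c $ j)"] cos_le_one[of "2 * pi * (x $ j - c $ j)"]
    by (simp_all only: field_simps)
  have Q_bounds: "0 \<le> Q x" "Q x \<le> 1" for x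
    unfolding Q_def using q_bounds by (auto intro: prod_nonneg prod_le_1)
  have Qc: "Q c = 1" by (simp add: Q_def q_def)
  define R where "R x = Re (E x)" for x
  have R: "continuous_on UNIV R" unfolding R_def by (intro continuous_intros E)
  have int0: "(LINT x:unit_cell a|lborel. Q x ^ N * R x) = 0" for N
  proof -
    have "(LINT x:unit_cell a|lborel. of_real (Q x ^ N) * E x) = 0"
      using P_QN[of N] int_lattice_closed(3) unfolding P_def by fastforce
    moreover have "set_integrable lborel (unit_cell a) (\<lambda>x. of_real (Q x ^ N) * E x)"
      by (intro set_integrable_unit_cell continuous_intros Q_cont E)
    ultimately have "Re (LINT x:unit_cell a|lborel. of_real (Q x ^ N) * E x) = 0 \<and>
        (LINT x:unit_cell a|lborel. Re (of_real (Q x ^ N) * E x)) = Re (LINT x:unit_cell a|lborel. of_real (Q x ^ N) * E x)"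
      unfolding set_lebesgue_integral_def set_integrable_def
      by (subst integral_Re[symmetric]) auto
    then show ?thesis by (simp add: R_def)
  qed
  obtain M where "M \<ge> 0" and M: "\<And>x. x \<in> unit_cell a \<Longrightarrow> \<bar>R x\<bar> \<le> M"
  proof -
    have "compact (R ` cbox a (a + 1))"
      by (intro compact_continuous_image compact_cbox continuous_on_subset[OF R]) auto
    then obtain B where B: "\<And>x. x \<in> cbox a (a + 1) \<Longrightarrow> norm (R x) \<le> B"
      using compact_imp_bounded bounded_iff by (metis imageI)
    have "\<bar>R x\<bar> \<le> max B 0" if "x \<in> unit_cell a" for x
      using B[of x] that unit_cell_subset_cbox[of a] by fastforce
    then show thesis using that[of "max B 0"] by simp
  qed
  have "R c = 1" using Ec by (simp add: R_def)
  obtain d where "d > 0" and d: "\<And>x. dist x c < d \<Longrightarrow> dist (R x) (R c) < 1 / 2"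
    using R unfolding continuous_on_iff by (meson UNIV_I half_gt_zero zero_less_one)
  \<comment> \<open>Small enough for the box of half-width \<delta> about \<open>c\<close> to lie
    both within distance \<open>d\<close> of \<open>c\<close>, by the l1 bound, and within the
    cell.\<close>
  define \<delta> where "\<delta> = min (1 / 2) (d / (2 * CARD('n)))"
  have \<delta>: "\<delta> > 0" "\<delta> \<le> 1 / 2" "CARD('n) * \<delta> < d"
  proof -
    have "CARD('n) * \<delta> \<le> CARD('n) * (d / (2 * CARD('n)))"
      unfolding \<delta>_def by (intro mult_left_mono) auto
    also have "\<dots> < d" using \<open>d > 0\<close> by simp
    finally show "CARD('n) * \<delta> < d" .
  qed (use \<open>d > 0\<close> in \<open>auto simp: \<delta>_def\<close>)
  have near: "R x \<ge> 1 / 2" if "\<And>j. \<bar>x $ j - c $ j\<bar> < \<delta>" for x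
  proof -
    have "norm (x - c) \<le> (\<Sum>j\<in>(UNIV::'n set). \<delta>)"
      using that by (intro order_trans[OF norm_le_l1_cart] sum_mono) (auto intro: less_imp_le)
    then have "dist x c < d" using \<delta> by (simp add: dist_norm)
    from d[OF this] show ?thesis using \<open>R c = 1\<close> unfolding dist_real_def by linarith
  qed
  \<comment> \<open>The bound for one factor of \<open>Q\<close> at distance at least \<delta> in
    its coordinate. Inside the cell that distance is at most 1/2, so the angle stays in the interval
    from 0 to \<pi>, where the cosine decreases.\<close>
  define r where "r = (1 + cos (2 * pi * \<delta>)) / 2"
  have "r \<ge> 0" unfolding r_def using cos_ge_minus_one[of "2 * pi * \<delta>"] by (simp only: field_simps)
  have "2 * pi * \<delta> \<le> pi" using \<delta> mult_left_mono[of "2 * \<delta>" 1 pi] by simp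
  then have "cos (2 * pi * \<delta>) < cos 0"
    using \<delta> by (intro cos_monotone_0_pi) auto
  then have "r < 1" by (simp add: r_def)
  have far: "Q x \<le> r" if x: "x \<in> unit_cell a" and j: "\<not> \<bar>x $ j - c $ j\<bar> < \<delta>" for x j
  proof -
    have "\<bar>x $ j - c $ j\<bar> \<le> 1 / 2"
    proof -
      have "a $ j \<le> x $ j" "x $ j < a $ j + 1" "c $ j = a $ j + 1 / 2"
        using x by (simp_all add: unit_cell_def c_def)
      then show ?thesis by linarith
    qed
    then have le: "2 * pi * \<bar>x $ j - c $ j\<bar> \<le> pi" using mult_left_mono[of "2 * \<bar>x $ j - c $ j\<bar>" 1 pi] by simp
    have "cos (2 * pi * (x $ j - c $ j)) = cos (2 * pi * \<bar>x $ j - c $ j\<bar>)"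
      by (cases "x $ j - c $ j \<ge> 0") (auto simp: algebra_simps cos_diff)
    also have "\<dots> \<le> cos (2 * pi * \<delta>)"
      using le j \<delta> by (intro cos_monotone_0_pi_le) auto
    finally have "q j x \<le> r" by (simp add: q_def r_def)
    moreover have "Q x \<le> q j x"
    proof -
      have "Q x = q j x * (\<Prod>i\<in>UNIV - {j}. q i x)"
        unfolding Q_def by (rule prod.remove) auto
      also have "\<dots> \<le> q j x * 1"
        using q_bounds by (intro mult_left_mono prod_le_1) auto
      finally show ?thesis by simp
    qed
    ultimately show ?thesis by simp
  qed
  \<comment> \<open>Strictly between \<open>r\<close> and \<open>Q c = 1\<close>: on a neighbourhood
    of \<open>c\<close> the powers of \<open>Q\<close> exceed \<open>\<rho> ^ N\<close>, which
    decays more slowly than the bound \<open>r ^ N\<close> outside the box.\<close>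
  define \<rho> where "\<rho> = (1 + r) / 2"
  have \<rho>: "r < \<rho>" "\<rho> < 1" "\<rho> > 0" using \<open>r < 1\<close> \<open>r \<ge> 0\<close> by (auto simp: \<rho>_def)
  define U where "U = {x. \<rho> < Q x} \<inter> {x. \<forall>j. \<bar>x $ j - c $ j\<bar> < \<delta>}"
  have Uo: "open U"
  proof -
    have "{x. \<forall>j. \<bar>x $ j - c $ j\<bar> < \<delta>} = (\<Inter>j. {x. \<bar>x $ j - c $ j\<bar> < \<delta>})" by auto
    moreover have "open {x::real^'n. \<bar>x $ j - c $ j\<bar> < \<delta>}" for j
      by (intro open_Collect_less continuous_intros)
    ultimately have "open {x. \<forall>j. \<bar>x $ j - c $ j\<bar> < \<delta>}" by (simp add: open_INT)
    then show ?thesis unfolding U_def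
      by (intro open_Int open_Collect_less continuous_intros Q_cont)
  qed
  have "c \<in> U" using \<rho> \<delta> Qc by (simp add: U_def)
  have Uc: "U \<subseteq> unit_cell a"
  proof
    fix x assume "x \<in> U"
    have "a $ j \<le> x $ j \<and> x $ j < a $ j + 1" for j
    proof -
      have "\<bar>x $ j - c $ j\<bar> < \<delta>" "c $ j = a $ j + 1 / 2"
        using \<open>x \<in> U\<close> by (simp_all add: U_def c_def)
      then show ?thesis using \<delta>(2) by linarith
    qed
    then show "x \<in> unit_cell a" by (simp add: unit_cell_def)
  qed
  define v where "v = measure lborel U"
  have "emeasure lborel U \<le> 1"
    using emeasure_mono[OF Uc, of lborel] by (simp add: emeasure_unit_cell)
  then have Ufin: "emeasure lborel U < \<infinity>" by (simp add: le_less_trans)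
  have "v > 0"
  proof -
    have "emeasure lborel U \<noteq> 0"
    proof
      assume "emeasure lborel U = 0"
      then have "U \<in> null_sets lborel" using Uo by (intro null_setsI) auto
      then have "negligible U" by (simp add: negligible_iff_null_sets null_sets_completionI)
      then show False using open_not_negligible[OF Uo] \<open>c \<in> U\<close> by blast
    qed
    then show ?thesis unfolding v_def using Ufin
      by (simp add: measure_def enn2real_positive_iff zero_less_iff_neq_zero)
  qed
  \<comment> \<open>The integral of \<open>Q ^ N * R\<close> is 0, but its integrand is at least
    half of \<open>\<rho> ^ N\<close> on \<open>U\<close>, nonnegative on the rest of the box, and
    at least \<open>- M * r ^ N\<close> elsewhere in a cell of volume 1.\<close>
  have main: "\<rho> ^ N * v \<le> 2 * M * r ^ N" for N
  proof -
    have pt: "1 / 2 * \<rho> ^ N * indicator U x - M * r ^ N \<le> Q x ^ N * R x" if x: "x \<in> unit_cell a" for x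
    proof (cases "\<forall>j. \<bar>x $ j - c $ j\<bar> < \<delta>")
      case True
      have "1 / 2 * \<rho> ^ N * indicator U x \<le> 1 / 2 * Q x ^ N"
        using \<rho> Q_bounds by (auto simp: U_def indicator_def intro!: power_mono)
      also have "\<dots> \<le> Q x ^ N * R x"
        using near[of x] True Q_bounds[of x] mult_left_mono[of "1/2" "R x" "Q x ^ N"] by simp
      finally have "1 / 2 * \<rho> ^ N * indicator U x \<le> Q x ^ N * R x" .
      moreover have "0 \<le> M * r ^ N" using \<open>M \<ge> 0\<close> \<open>r \<ge> 0\<close> by simp
      ultimately show ?thesis by linarith
    next
      case False
      then obtain j where "\<not> \<bar>x $ j - c $ j\<bar> < \<delta>" by blast
      from far[OF x this] have "Q x ^ N \<le> r ^ N" using Q_bounds by (intro power_mono) auto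
      then have "M * Q x ^ N \<le> M * r ^ N" using \<open>M \<ge> 0\<close> by (rule mult_left_mono)
      moreover have "- (M * Q x ^ N) \<le> Q x ^ N * R x"
        using M[OF x] Q_bounds[of x] mult_left_mono[of "- M" "R x" "Q x ^ N"] by (simp add: abs_le_iff mult.commute)
      ultimately show ?thesis using False by (simp add: U_def)
    qed
    have i1: "integrable lborel (\<lambda>x. 1 / 2 * \<rho> ^ N * indicator U x - M * r ^ N * indicator (unit_cell a) x)"
      using Ufin Uo by (intro Bochner_Integration.integrable_diff integrable_mult_right integrable_real_indicator)
        (auto simp: emeasure_unit_cell)
    have "(LINT x|lborel. 1 / 2 * \<rho> ^ N * indicator U x - M * r ^ N * indicator (unit_cell a) x) \<le>
        (LINT x:unit_cell a|lborel. Q x ^ N * R x)"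
      unfolding set_lebesgue_integral_def
    proof (rule integral_mono[OF i1])
      show "integrable lborel (\<lambda>x. indicator (unit_cell a) x *\<^sub>R (Q x ^ N * R x))"
        using set_integrable_unit_cell[of "\<lambda>x. Q x ^ N * R x" a] unfolding set_integrable_def
        by (simp add: continuous_intros Q_cont R)
      show "1 / 2 * \<rho> ^ N * indicator U x - M * r ^ N * indicator (unit_cell a) x \<le>
          indicator (unit_cell a) x *\<^sub>R (Q x ^ N * R x)" for x
        using pt[of x] Uc by (cases "x \<in> unit_cell a") (auto simp: indicator_def)
    qed
    also have "(LINT x|lborel. 1 / 2 * \<rho> ^ N * indicator U x - M * r ^ N * indicator (unit_cell a) x) =
        1 / 2 * \<rho> ^ N * v - M * r ^ N"
      using Ufin Uo
      by (subst Bochner_Integration.integral_diff)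
        (auto simp: emeasure_unit_cell v_def measure_def)
    finally show ?thesis using int0[of N] by simp
  qed
  have "(\<lambda>N. 2 * M * (r / \<rho>) ^ N) \<longlonglongrightarrow> 2 * M * 0"
    using \<rho> \<open>r \<ge> 0\<close> by (intro tendsto_mult_left LIMSEQ_realpow_zero) auto
  moreover have "v \<le> 2 * M * (r / \<rho>) ^ N" for N
    using main[of N] \<rho> by (simp add: power_divide field_simps)
  ultimately have "v \<le> 0"
    by (intro LIMSEQ_le_const[of _ "2 * M * 0" v, simplified]) auto
  with \<open>v > 0\<close> show False by simp
qed

section \<open>Japanese bracket estimates\<close>

lemma japanese_pos: "japanese x > 0"
  using japanese_ge_1[of x] by simp

lemma japanese_minus_commute: "japanese (x - y) = japanese (y - x)"
  by (simp add: japanese_def norm_minus_commute)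

lemma continuous_on_japanese [continuous_intros]:
  "continuous_on S g \<Longrightarrow> continuous_on S (\<lambda>x. japanese (g x))"
  unfolding japanese_def by (intro continuous_intros)

lemma japanese_borel [measurable]: "japanese \<in> borel_measurable borel"
  by (intro borel_measurable_continuous_onI continuous_intros)

lemma japanese_add_le: "japanese (x + y) \<le> 2 * japanese x * japanese y"
proof -
  have "(norm (x + y))\<^sup>2 \<le> (norm x + norm y)\<^sup>2"
    by (intro power_mono norm_triangle_ineq) auto
  also have "\<dots> \<le> 2 * (norm x)\<^sup>2 + 2 * (norm y)\<^sup>2"
    using sum_squares_bound[of "norm x" "norm y"] by (simp add: power2_sum)
  finally have "1 + (norm (x + y))\<^sup>2 \<le> 4 * ((1 + (norm x)\<^sup>2) * (1 + (norm y)\<^sup>2))"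
    by (simp add: algebra_simps) (smt (verit) mult_nonneg_nonneg zero_le_power2)
  then have "japanese (x + y) \<le> sqrt (4 * ((1 + (norm x)\<^sup>2) * (1 + (norm y)\<^sup>2)))"
    unfolding japanese_def by (rule real_sqrt_le_mono)
  then show ?thesis by (simp add: japanese_def real_sqrt_mult)
qed

lemma peetre_inequality:
  "japanese \<xi> powr s \<le> 2 powr \<bar>s\<bar> * japanese \<zeta> powr s * japanese (\<xi> - \<zeta>) powr \<bar>s\<bar>"
proof (cases "s \<ge> 0")
  case True
  have "japanese \<xi> powr s \<le> (2 * japanese \<zeta> * japanese (\<xi> - \<zeta>)) powr s"
    using japanese_add_le[of \<zeta> "\<xi> - \<zeta>"] japanese_pos[of \<xi>] True by (intro powr_mono2) auto
  then show ?thesis using True japanese_pos[of \<zeta>] japanese_pos[of "\<xi> - \<zeta>"]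
    by (simp add: powr_mult)
next
  \<comment> \<open>For a negative exponent \<xi> and \<zeta> exchange roles and the resulting
    inequality is inverted.\<close>
  case False
  have "japanese \<zeta> powr \<bar>s\<bar> \<le> (2 * japanese \<xi> * japanese (\<zeta> - \<xi>)) powr \<bar>s\<bar>"
    using japanese_add_le[of \<xi> "\<zeta> - \<xi>"] japanese_pos[of \<zeta>] by (intro powr_mono2) auto
  also have "\<dots> = 2 powr \<bar>s\<bar> * japanese \<xi> powr \<bar>s\<bar> * japanese (\<xi> - \<zeta>) powr \<bar>s\<bar>"
    using japanese_pos[of \<xi>] japanese_pos[of "\<zeta> - \<xi>"]
    by (simp add: powr_mult japanese_minus_commute[of \<zeta> \<xi>])
  finally have *: "japanese \<zeta> powr \<bar>s\<bar> \<le> 2 powr \<bar>s\<bar> * japanese \<xi> powr \<bar>s\<bar> * japanese (\<xi> - \<zeta>) powr \<bar>s\<bar>" .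
  have "japanese x powr s = inverse (japanese x powr \<bar>s\<bar>)" "japanese x powr \<bar>s\<bar> > 0" for x :: "real^'a"
    using False japanese_pos[of x] by (auto simp: powr_minus[symmetric])
  with * show ?thesis by (simp only:) (simp add: field_simps)
qed

text \<open>Any exponent larger than the dimension would do.\<close>

lemma nn_integral_japanese_finite:
  "(\<integral>\<^sup>+x. ennreal (japanese (x :: real^'n::finite) powr (- real (CARD('n) + 2))) \<partial>lborel) < \<infinity>"
proof -
  let ?d = "CARD('n)"
  \<comment> \<open>Full cubes with explicit volume take the place of shells. This costs one power
    of m, which the exponent \<open>CARD('n) + 2\<close> affords: the terms still decay like the
    inverse square of m + 1.\<close>
  define B where "B m = cbox (- (real (Suc m) *\<^sub>R 1)) (real (Suc m) *\<^sub>R (1 :: real^'n))" for m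
  \<comment> \<open>If the integer part of \<open>norm x\<close> is m, then
    \<open>(m + 1) / 2 \<le> japanese x\<close>; hence the power of 2.\<close>
  define c where "c m = 2 ^ (?d + 2) * inverse (real (Suc m)) ^ (?d + 2)" for m
  have one: "(1 :: real^'n) \<bullet> b = 1" if "b \<in> Basis" for b
    using that by (auto simp: Basis_vec_def inner_axis)
  have B: "emeasure lborel (B m) = ennreal ((2 * real (Suc m)) ^ ?d)" for m
  proof -
    have "(real (Suc m) *\<^sub>R 1 - - (real (Suc m) *\<^sub>R 1)) \<bullet> b = 2 * real (Suc m)" if "b \<in> Basis" for b :: "real^'n"
      by (simp only: inner_diff_left inner_minus_left inner_scaleR_left one[OF that])
    then show ?thesis unfolding B_def
      by (subst emeasure_lborel_cbox) (auto simp: one simp del: of_nat_Suc)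
  qed
  have "ennreal (japanese x powr (- real (?d + 2))) \<le> (\<Sum>m. ennreal (c m) * indicator (B m) x)" for x :: "real^'n"
  proof -
    define m where "m = nat \<lfloor>norm x\<rfloor>"
    have "real m = of_int \<lfloor>norm x\<rfloor>" by (simp add: m_def)
    then have "real m \<le> norm x \<and> norm x < real (Suc m)" unfolding of_nat_Suc by linarith
    then have m: "real m \<le> norm x" "norm x < real (Suc m)" by auto
    have "x \<in> B m"
    proof -
      have "- real (Suc m) \<le> x $ i \<and> x $ i \<le> real (Suc m)" for i
        using component_le_norm_cart[of x i] m by linarith
      then show ?thesis by (simp add: B_def mem_box_cart del: of_nat_Suc)
    qed
    have "real (Suc m) \<le> 2 * japanese x"
      using m japanese_ge_1[of x] japanese_ge_norm[of x] by simp
    then have "(real (Suc m) / 2) ^ (?d + 2) \<le> japanese x ^ (?d + 2)"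
      by (intro power_mono) auto
    then have "inverse (japanese x ^ (?d + 2)) \<le> inverse ((real (Suc m) / 2) ^ (?d + 2))"
      by (intro le_imp_inverse_le) auto
    also have "\<dots> = c m" 
    proof -
      have "inverse (real (Suc m) / 2) = 2 * inverse (real (Suc m))"
        by (simp add: inverse_eq_divide)
      then show ?thesis by (simp only: c_def power_inverse[symmetric] power_mult_distrib[symmetric])
    qed
    finally have "japanese x powr (- real (?d + 2)) \<le> c m"
      by (simp only: powr_minus powr_realpow[OF japanese_pos])
    then have "ennreal (japanese x powr (- real (?d + 2))) \<le> ennreal (c m) * indicator (B m) x"
      using \<open>x \<in> B m\<close> by (simp add: ennreal_leI)
    also have "\<dots> \<le> (\<Sum>m. ennreal (c m) * indicator (B m) x)"
    proof -
      have "g m \<le> suminf g" for g :: "nat \<Rightarrow> ennreal"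
        using sum_le_suminf[of g "{m}"] by simp
      then show ?thesis .
    qed
    finally show ?thesis .
  qed
  then have "(\<integral>\<^sup>+x. ennreal (japanese (x :: real^'n) powr (- real (?d + 2))) \<partial>lborel) \<le>
      (\<integral>\<^sup>+x. (\<Sum>m. ennreal (c m) * indicator (B m) x) \<partial>lborel)"
    by (intro nn_integral_mono)
  also have "\<dots> = (\<Sum>m. \<integral>\<^sup>+x. ennreal (c m) * indicator (B m) x \<partial>lborel)"
    by (rule nn_integral_suminf) (simp add: B_def)
  also have "\<dots> = (\<Sum>m. ennreal (c m * (2 * real (Suc m)) ^ ?d))"
  proof (rule suminf_cong)
    fix m
    have "B m \<in> sets lborel" "c m \<ge> 0" by (simp_all add: B_def c_def)
    then show "(\<integral>\<^sup>+x. ennreal (c m) * indicator (B m) x \<partial>lborel) = ennreal (c m * (2 * real (Suc m)) ^ ?d)"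
      by (simp only: nn_integral_cmult_indicator B) (rule ennreal_mult[symmetric], auto)
  qed
  also have "(\<lambda>m. c m * (2 * real (Suc m)) ^ ?d) = (\<lambda>m. 2 ^ ?d * 2 ^ (?d + 2) * inverse (real (Suc m) ^ 2))"
  proof
    fix m
    define S where "S = real (Suc m)"
    have "c m * (2 * S) ^ ?d = 2 ^ ?d * 2 ^ (?d + 2) * inverse S ^ 2 * (inverse S * S) ^ ?d"
      unfolding c_def S_def[symmetric] power_mult_distrib power_add[of "inverse S"] by (simp only: mult_ac)
    moreover have "inverse S * S = 1" by (simp add: S_def)
    ultimately show "c m * (2 * S) ^ ?d = 2 ^ ?d * 2 ^ (?d + 2) * inverse (S ^ 2)"
      by (simp only: power_one mult_1_right power_inverse)
  qed
  also have "(\<Sum>m. ennreal (2 ^ ?d * 2 ^ (?d + 2) * inverse (real (Suc m) ^ 2))) < \<infinity>"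
  proof -
    have "summable (\<lambda>m. inverse (real (Suc m) ^ 2))"
      using inverse_power_summable[of 2] by (subst summable_Suc_iff) simp
    then have "summable (\<lambda>m. 2 ^ ?d * 2 ^ (?d + 2) * inverse (real (Suc m) ^ 2))" by (rule summable_mult)
    then show ?thesis by (subst suminf_ennreal2) auto
  qed
  finally show ?thesis .
qed

text \<open>Pushed forward to the Borel sets of the whole space, so that counting on the lattice and
  Lebesgue measure live on the same sigma-algebra and can be interchanged in one lemma.\<close>

definition lattice_measure :: "(real^'n::finite) measure" where
  "lattice_measure = distr (count_space int_lattice) borel (\<lambda>x. x)"

lemma sets_lattice_measure [simp, measurable_cong]: "sets lattice_measure = sets borel"
  by (simp add: lattice_measure_def)

lemma space_lattice_measure [simp]: "space lattice_measure = UNIV"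
  by (simp add: lattice_measure_def)

lemma nn_integral_lattice_measure:
  "g \<in> borel_measurable borel \<Longrightarrow>
    (\<integral>\<^sup>+x. g x \<partial>lattice_measure) = (\<integral>\<^sup>+x. g x \<partial>count_space int_lattice)"
  unfolding lattice_measure_def by (rule nn_integral_distr) auto

lemma sigma_finite_lattice_measure: "sigma_finite_measure (lattice_measure :: (real^'n::finite) measure)"
proof (rule sigma_finite_measure.intro, rule exI, intro conjI ballI)
  \<comment> \<open>The complement of the lattice has measure 0 and each lattice point has measure
    1.\<close>
  let ?A = "insert (- int_lattice) ((\<lambda>x. {x}) ` (int_lattice :: (real^'n) set))"
  have L: "int_lattice \<in> sets (borel :: (real^'n) measure)"
    by (rule sets.countable[OF _ countable_int_lattice]) auto
  show "countable ?A" using countable_int_lattice by auto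
  show "?A \<subseteq> sets lattice_measure" using L by auto
  show "\<Union> ?A = space lattice_measure" by auto
  fix a assume "a \<in> ?A"
  then show "emeasure lattice_measure a \<noteq> \<infinity>"
    using L by (auto simp: lattice_measure_def emeasure_distr)
qed

lemma nn_integral_japanese_shift:
  fixes \<zeta> :: "real^'n::finite"
  shows "(\<integral>\<^sup>+x. ennreal (japanese (x - \<zeta>) powr t) \<partial>lborel) = (\<integral>\<^sup>+x. ennreal (japanese (x :: real^'n) powr t) \<partial>lborel)"
  using nn_integral_shift[of "\<lambda>x :: real^'n. ennreal (japanese x powr t)" "- \<zeta>"] by simp

text \<open>Moving the argument by a point of the unit cell changes the bracket by a bounded factor.
  Averaging the sum over the cell and applying the tiling formula therefore bounds it by the
  integral, uniformly in \<zeta>.\<close>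

lemma lattice_sum_japanese_bound:
  fixes \<zeta> :: "real^'n::finite"
  defines "p \<equiv> real (CARD('n) + 2)"
  shows "(\<integral>\<^sup>+n. ennreal (japanese (n - \<zeta>) powr (- p)) \<partial>lattice_measure) \<le>
     ennreal ((2 * sqrt (1 + (real CARD('n))\<^sup>2)) powr p) *
       (\<integral>\<^sup>+x. ennreal (japanese (x :: real^'n) powr (- p)) \<partial>lborel)"
proof -
  define M where "M = (2 * sqrt (1 + (real CARD('n))\<^sup>2)) powr p"
  have pt: "japanese (n - \<zeta>) powr (- p) \<le> M * japanese (x + \<zeta> - n) powr (- p)"
    if "x \<in> unit_cell 0" for n x :: "real^'n"
  proof -
    have "norm x \<le> real CARD('n)" using that unit_cell_subset_cball[of 0] by auto
    then have x: "japanese x \<le> sqrt (1 + (real CARD('n))\<^sup>2)"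
      by (auto simp: japanese_def intro: power_mono)
    have "japanese (x + \<zeta> - n) \<le> 2 * japanese x * japanese (\<zeta> - n)"
      using japanese_add_le[of x "\<zeta> - n"] by (simp add: algebra_simps)
    also have "\<dots> \<le> 2 * sqrt (1 + (real CARD('n))\<^sup>2) * japanese (n - \<zeta>)"
      using x japanese_pos[of "n - \<zeta>"]
      by (auto simp: japanese_minus_commute[of \<zeta> n] intro!: mult_right_mono)
    finally have "japanese (x + \<zeta> - n) powr p \<le> (2 * sqrt (1 + (real CARD('n))\<^sup>2) * japanese (n - \<zeta>)) powr p"
      using japanese_pos[of "x + \<zeta> - n"] by (intro powr_mono2) (auto simp: p_def)
    also have "\<dots> = M * japanese (n - \<zeta>) powr p"
      using japanese_pos[of "n - \<zeta>"] by (simp add: M_def powr_mult)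
    finally show ?thesis
      using japanese_pos[of "n - \<zeta>"] japanese_pos[of "x + \<zeta> - n"]
      by (simp add: powr_minus field_simps)
  qed
  define S where "S = (\<integral>\<^sup>+n. ennreal (japanese (n - \<zeta>) powr (- p)) \<partial>count_space int_lattice)"
  \<comment> \<open>The sum is constant in x and the cell has volume 1, so averaging leaves it
    unchanged.\<close>
  have "S = (\<integral>\<^sup>+x. indicator (unit_cell (0 :: real^'n)) x * S \<partial>lborel)"
    by (simp add: nn_integral_multc emeasure_unit_cell)
  also have "\<dots> \<le> (\<integral>\<^sup>+x. ennreal M * (indicator (unit_cell (0 :: real^'n)) x *
      (\<integral>\<^sup>+n. ennreal (japanese (x - n + \<zeta>) powr (- p)) \<partial>count_space int_lattice)) \<partial>lborel)"
  proof (rule nn_integral_mono)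
    fix x :: "real^'n"
    show "indicator (unit_cell 0) x * S \<le> ennreal M * (indicator (unit_cell 0) x *
        (\<integral>\<^sup>+n. ennreal (japanese (x - n + \<zeta>) powr (- p)) \<partial>count_space int_lattice))"
    proof (cases "x \<in> unit_cell 0")
      case True
      have "S \<le> (\<integral>\<^sup>+n. ennreal M * ennreal (japanese (x - n + \<zeta>) powr (- p)) \<partial>count_space int_lattice)"
        unfolding S_def using pt[OF True]
        by (intro nn_integral_mono) (simp add: ennreal_mult[symmetric] M_def ennreal_leI algebra_simps)
      then show ?thesis using True by (simp add: nn_integral_cmult)
    qed simp
  qed
  also have "\<dots> = ennreal M * (\<integral>\<^sup>+x. (indicator (unit_cell (0 :: real^'n)) x *
      (\<integral>\<^sup>+n. ennreal (japanese (x - n + \<zeta>) powr (- p)) \<partial>count_space int_lattice)) \<partial>lborel)"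
  proof (rule nn_integral_cmult)
    \<comment> \<open>Measurability of the inner sum in x comes from reading it as an integral
      against a sigma-finite measure.\<close>
    have "(\<lambda>x. \<integral>\<^sup>+n. ennreal (japanese (x - n + \<zeta>) powr (- p)) \<partial>lattice_measure) \<in> borel_measurable lborel"
      by (rule sigma_finite_measure.borel_measurable_nn_integral[OF sigma_finite_lattice_measure]) measurable
    then show "(\<lambda>x. indicator (unit_cell 0) x *
      (\<integral>\<^sup>+n. ennreal (japanese (x - n + \<zeta>) powr (- p)) \<partial>count_space int_lattice)) \<in> borel_measurable lborel"
      by (simp add: nn_integral_lattice_measure)
  qed
  also have "(\<integral>\<^sup>+x. (indicator (unit_cell (0 :: real^'n)) x *
      (\<integral>\<^sup>+n. ennreal (japanese (x - n + \<zeta>) powr (- p)) \<partial>count_space int_lattice)) \<partial>lborel) =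
      (\<integral>\<^sup>+x. ennreal (japanese (x + \<zeta> :: real^'n) powr (- p)) \<partial>lborel)"
    using nn_integral_tiling[of "\<lambda>x :: real^'n. ennreal (japanese (x + \<zeta>) powr (- p))" 0] by simp
  also have "\<dots> = (\<integral>\<^sup>+x. ennreal (japanese (x :: real^'n) powr (- p)) \<partial>lborel)"
    using nn_integral_japanese_shift[of "- \<zeta>"] by simp
  finally show ?thesis by (simp add: S_def M_def nn_integral_lattice_measure)
qed

section \<open>Poisson summation\<close>

lemma nonneg_summable_on_iff:
  fixes g :: "'a \<Rightarrow> real"
  assumes "\<And>x. x \<in> A \<Longrightarrow> g x \<ge> 0"
  shows "g summable_on A \<longleftrightarrow> (\<integral>\<^sup>+x. ennreal (g x) \<partial>count_space A) < \<infinity>"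
proof -
  have "g summable_on A \<longleftrightarrow> (\<lambda>x. norm (g x)) summable_on A"
    using assms by (intro summable_on_cong) auto
  also have "\<dots> \<longleftrightarrow> integrable (count_space A) g"
    using abs_summable_equivalent[of g A] by (simp add: Infinite_Set_Sum.abs_summable_on_def)
  also have "\<dots> \<longleftrightarrow> (\<integral>\<^sup>+x. ennreal (norm (g x)) \<partial>count_space A) < \<infinity>"
    by (simp add: integrable_iff_bounded)
  also have "(\<integral>\<^sup>+x. ennreal (norm (g x)) \<partial>count_space A) = (\<integral>\<^sup>+x. ennreal (g x) \<partial>count_space A)"
    using assms by (intro nn_integral_cong) auto
  finally show ?thesis .
qed

lemma norm_has_sum_le:
  fixes g :: "'a \<Rightarrow> 'b::real_normed_vector"
  assumes "(g has_sum S) A"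
  shows "ennreal (norm S) \<le> (\<integral>\<^sup>+x. ennreal (norm (g x)) \<partial>count_space A)"
proof (rule tendsto_upperbound)
  show "((\<lambda>X. ennreal (norm (sum g X))) \<longlongrightarrow> ennreal (norm S)) (finite_subsets_at_top A)"
    using assms unfolding has_sum_def by (intro tendsto_ennrealI tendsto_norm)
  show "\<forall>\<^sub>F X in finite_subsets_at_top A. ennreal (norm (sum g X)) \<le> (\<integral>\<^sup>+x. ennreal (norm (g x)) \<partial>count_space A)"
  proof (rule eventually_finite_subsets_at_top_weakI)
    fix X assume X: "finite X" "X \<subseteq> A"
    have "ennreal (norm (sum g X)) \<le> ennreal (\<Sum>x\<in>X. norm (g x))"
      by (intro ennreal_leI norm_sum)
    also have "\<dots> = (\<integral>\<^sup>+x. ennreal (norm (g x)) \<partial>count_space X)"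
      using X by (simp add: nn_integral_count_space_finite)
    also have "\<dots> \<le> (\<integral>\<^sup>+x. ennreal (norm (g x)) \<partial>count_space A)"
      using X by (simp add: nn_integral_count_space_indicator)
        (intro nn_integral_mono, auto simp: indicator_def)
    finally show "ennreal (norm (sum g X)) \<le> (\<integral>\<^sup>+x. ennreal (norm (g x)) \<partial>count_space A)" .
  qed
qed simp

lemma japanese_summable_on_int_lattice:
  "(\<lambda>k :: real^'n::finite. c * japanese k powr (- real (CARD('n) + 2))) summable_on int_lattice"
proof -
  have "(\<integral>\<^sup>+k. ennreal (japanese (k :: real^'n) powr (- real (CARD('n) + 2))) \<partial>lattice_measure) < \<infinity>"
    using le_less_trans[OF lattice_sum_japanese_bound[of "0 :: real^'n"]] nn_integral_japanese_finite[where 'n='n]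
    by (simp add: ennreal_mult_less_top)
  then have "(\<lambda>k :: real^'n. japanese k powr (- real (CARD('n) + 2))) summable_on int_lattice"
    by (subst nonneg_summable_on_iff) (auto simp: nn_integral_lattice_measure)
  then show ?thesis by (rule summable_on_cmult_right)
qed

text \<open>Rapid decay makes the series converge uniformly to a continuous function. By
  orthogonality and unfolding, it and the periodization have the same coefficients on a cell, and
  uniqueness identifies them at x.\<close>

lemma poisson_summation:
  fixes \<theta> :: "real^'n::finite \<Rightarrow> complex"
  assumes \<theta>: "\<theta> \<in> test_functions UNIV" and F: "finite F" "F \<subseteq> int_lattice"
    and cover: "\<And>n. n \<in> int_lattice \<Longrightarrow> \<theta> (x - n) \<noteq> 0 \<Longrightarrow> n \<in> F"
  shows "((\<lambda>k. inv_fourier \<theta> k * plane_wave (- k) x) has_sum (\<Sum>n\<in>F. \<theta> (x - n))) int_lattice"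
proof -
  define p where "p = real (CARD('n) + 2)"
  obtain C where C: "C \<ge> 0" "\<And>y. norm (inv_fourier \<theta> y) \<le> C * japanese y powr (- p)"
    by (rule inv_fourier_rapid_decay[OF \<theta>, of p]) blast
  define S where "S y = (\<Sum>\<^sub>\<infinity>k\<in>int_lattice. inv_fourier \<theta> k * plane_wave (- k) y)" for y
  have M: "norm (inv_fourier \<theta> k * plane_wave (- k) y) \<le> C * japanese k powr (- p)" for k y
    using C(2)[of k] by (simp add: norm_mult)
  have summ: "(\<lambda>k :: real^'n. C * japanese k powr (- p)) summable_on int_lattice"
    unfolding p_def by (rule japanese_summable_on_int_lattice)
  have unif: "uniform_limit UNIV (\<lambda>X y. \<Sum>k\<in>X. inv_fourier \<theta> k * plane_wave (- k) y) S (finite_subsets_at_top int_lattice)"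
    unfolding S_def by (rule Weierstrass_m_test_general[OF M summ])
  have part_cont: "continuous_on UNIV (\<lambda>y. \<Sum>k\<in>X. inv_fourier \<theta> k * plane_wave (- k) y)" for X
    by (intro continuous_intros)
  have S_cont: "continuous_on UNIV S"
    by (rule uniform_limit_theorem[OF _ unif]) (auto intro: part_cont)
  \<comment> \<open>The uniqueness lemma evaluates at the centre of the cell, so the cell is centred
    at x.\<close>
  define a where "a = (\<chi> j. x $ j - 1 / 2)"
  have S_coeff: "(LINT y:unit_cell a|lborel. plane_wave m y * S y) = inv_fourier \<theta> m" if m: "m \<in> int_lattice" for m
  proof -
    let ?I = "LINT y:unit_cell a|lborel. plane_wave m y * S y"
    \<comment> \<open>A partial sum that contains m and lies within e of \<open>S\<close> has
      exactly the right coefficient; the cell has volume 1, so the error stays within e.\<close>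
    have "norm (?I - inv_fourier \<theta> m) \<le> e" if "e > 0" for e
    proof -
      have "\<forall>\<^sub>F X in finite_subsets_at_top int_lattice. finite X \<and> X \<subseteq> int_lattice \<and> m \<in> X"
        unfolding eventually_finite_subsets_at_top using m by (intro exI[of _ "{m}"]) auto
      from eventually_happens'[OF finite_subsets_at_top_neq_bot
          eventually_conj[OF this uniform_limitD[OF unif \<open>e > 0\<close>]]]
      obtain X where X: "finite X" "X \<subseteq> int_lattice" "m \<in> X"
          and Xe: "\<And>y. dist (\<Sum>k\<in>X. inv_fourier \<theta> k * plane_wave (- k) y) (S y) < e"
        by (elim exE conjE) (use UNIV_I in simp)
      let ?SX = "\<lambda>y. \<Sum>k\<in>X. inv_fourier \<theta> k * plane_wave (- k) y"
      have "(LINT y:unit_cell a|lborel. plane_wave m y * ?SX y) =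
          (LINT y|lborel. (\<Sum>k\<in>X. inv_fourier \<theta> k * (indicator (unit_cell a) y *\<^sub>R plane_wave (m - k) y)))"
        unfolding set_lebesgue_integral_def
      proof (rule Bochner_Integration.integral_cong[OF refl])
        fix y
        have "plane_wave (m - k) y = plane_wave m y * plane_wave (- k) y" for k
          using plane_wave_add[of m "- k" y] by simp
        then show "indicator (unit_cell a) y *\<^sub>R (plane_wave m y * ?SX y) =
            (\<Sum>k\<in>X. inv_fourier \<theta> k * (indicator (unit_cell a) y *\<^sub>R plane_wave (m - k) y))"
          unfolding sum_distrib_left scaleR_sum_right by (intro sum.cong refl) simp
      qed
      also have "\<dots> = (\<Sum>k\<in>X. inv_fourier \<theta> k * (LINT y:unit_cell a|lborel. plane_wave (m - k) y))"
      proof -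
        have "integrable lborel (\<lambda>y. indicator (unit_cell a) y *\<^sub>R plane_wave (m - k) y)" for k
          using set_integrable_unit_cell[of "plane_wave (m - k)" a]
          by (simp add: set_integrable_def continuous_intros)
        then show ?thesis unfolding set_lebesgue_integral_def
          by (subst Bochner_Integration.integral_sum) (simp_all del: mult_scaleR_right)
      qed
      also have "\<dots> = (\<Sum>k\<in>X. if k = m then inv_fourier \<theta> k else 0)"
      proof (rule sum.cong[OF refl])
        fix k assume "k \<in> X"
        then have "m - k \<in> int_lattice" using X m int_lattice_closed(1)[OF m int_lattice_closed(2)] by auto
        from integral_plane_wave_unit_cell[OF this, of a]
        show "inv_fourier \<theta> k * (LINT y:unit_cell a|lborel. plane_wave (m - k) y) = (if k = m then inv_fourier \<theta> k else 0)"
          by auto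
      qed
      also have "\<dots> = inv_fourier \<theta> m" using X by simp
      finally have SX: "(LINT y:unit_cell a|lborel. plane_wave m y * ?SX y) = inv_fourier \<theta> m" .
      have int: "set_integrable lborel (unit_cell a) (\<lambda>y. plane_wave m y * S y)"
        "set_integrable lborel (unit_cell a) (\<lambda>y. plane_wave m y * ?SX y)"
        by (intro set_integrable_unit_cell continuous_intros S_cont)+
      have "norm (?I - inv_fourier \<theta> m) = norm (LINT y:unit_cell a|lborel. plane_wave m y * S y - plane_wave m y * ?SX y)"
        using int by (simp add: set_integral_diff SX)
      also have "\<dots> \<le> (LINT y|lborel. norm (indicator (unit_cell a) y *\<^sub>R (plane_wave m y * S y - plane_wave m y * ?SX y)))"
        unfolding set_lebesgue_integral_def by (rule integral_norm_bound)
      also have "\<dots> \<le> (LINT y|lborel. e * indicator (unit_cell a) y)"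
      proof (rule integral_mono)
        show "integrable lborel (\<lambda>y. norm (indicator (unit_cell a) y *\<^sub>R (plane_wave m y * S y - plane_wave m y * ?SX y)))"
          using set_integral_diff(1)[OF int] unfolding set_integrable_def by (rule integrable_norm)
        show "integrable lborel (\<lambda>y. e * indicator (unit_cell a) y)"
          by (intro integrable_mult_right integrable_real_indicator) (auto simp: emeasure_unit_cell)
        show "norm (indicator (unit_cell a) y *\<^sub>R (plane_wave m y * S y - plane_wave m y * ?SX y)) \<le> e * indicator (unit_cell a) y" for y
          using Xe[of y] by (auto simp: indicator_def norm_mult dist_norm norm_minus_commute simp flip: right_diff_distrib)
      qed
      also have "\<dots> = e" by (simp add: measure_def emeasure_unit_cell)
      finally show ?thesis .
    qed
    then have "norm (?I - inv_fourier \<theta> m) \<le> 0" by (rule field_le_epsilon) simp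
    then show ?thesis by simp
  qed
  obtain R where R: "\<And>y. y \<in> supp \<theta> \<Longrightarrow> norm y \<le> R"
    using compact_imp_bounded[OF test_functionsD(2)[OF \<theta>]] unfolding bounded_iff by auto
  \<comment> \<open>\<open>F\<close> covers the translates that reach the single point x, whereas
    unfolding needs those that reach any point of the cell. At x the two sums agree.\<close>
  define G where "G = {n \<in> int_lattice. norm (n :: real^'n) \<le> norm a + norm (0 :: real^'n) + R + CARD('n)}"
  have G: "finite G" "G \<subseteq> int_lattice" unfolding G_def using finite_int_lattice_bounded by auto
  have G_cover: "n \<in> G" if "n \<in> int_lattice" "y \<in> unit_cell a" "\<theta> (y - n) \<noteq> 0" for n y
    using unit_cell_diff_bounded[of y a n 0 R] R[of "y - n"] in_supp[of \<theta> "y - n"] that by (simp add: G_def)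
  have "(\<Sum>n\<in>G. \<theta> (x - n)) - S x = 0"
  proof -
    have "x = (\<chi> j. a $ j + 1 / 2)" by (simp add: a_def vec_eq_iff)
    moreover have "(\<lambda>y. (\<Sum>n\<in>G. \<theta> (y - n)) - S y) (\<chi> j. a $ j + 1 / 2) = 0"
    proof (rule fourier_uniqueness_cell)
      have g: "continuous_on UNIV (\<lambda>y. \<Sum>n\<in>G. \<theta> (y - n))"
        by (intro continuous_on_sum smooth_continuous_on smooth_translate test_functionsD(1)[OF \<theta>])
      then show "continuous_on UNIV (\<lambda>y. (\<Sum>n\<in>G. \<theta> (y - n)) - S y)"
        using S_cont by (rule continuous_on_diff)
      fix k :: "real^'n" assume k: "k \<in> int_lattice"
      have "set_integrable lborel (unit_cell a) (\<lambda>y. plane_wave k y * (\<Sum>n\<in>G. \<theta> (y - n)))"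
        "set_integrable lborel (unit_cell a) (\<lambda>y. plane_wave k y * S y)"
        by (intro set_integrable_unit_cell continuous_on_mult g S_cont continuous_intros)+
      moreover have "(LINT y:unit_cell a|lborel. plane_wave k y * (\<Sum>n\<in>G. \<theta> (y - n))) = inv_fourier \<theta> k"
        by (rule integral_unfold[OF test_functions_integrable'[OF \<theta>] G G_cover k])
      ultimately show "(LINT y:unit_cell a|lborel. plane_wave k y * ((\<Sum>n\<in>G. \<theta> (y - n)) - S y)) = 0"
        by (simp add: right_diff_distrib set_integral_diff S_coeff[OF k])
    qed
    ultimately show ?thesis by simp
  qed
  moreover have "(\<Sum>n\<in>G. \<theta> (x - n)) = (\<Sum>n\<in>F. \<theta> (x - n))"
  proof -
    have "x \<in> unit_cell a" by (simp add: unit_cell_def a_def)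
    show ?thesis
    proof (rule sum.mono_neutral_cong)
      show "\<theta> (x - n) = 0" if "n \<in> F - G" for n
        using G_cover[of n x] that F \<open>x \<in> unit_cell a\<close> by auto
      show "\<theta> (x - n) = 0" if "n \<in> G - F" for n
        using cover[of n] that G by auto
    qed (use F G in auto)
  qed
  moreover have "((\<lambda>k. inv_fourier \<theta> k * plane_wave (- k) x) has_sum S x) int_lattice"
    unfolding S_def
    by (rule has_sum_infsum, rule abs_summable_summable, rule summable_on_comparison_test[OF summ]) (use M in auto)
  ultimately show ?thesis by simp
qed

section \<open>Poisson summation tested against a distribution\<close>

lemma finite_translate_cover:
  fixes K L :: "(real^'n::finite) set"
  assumes "bounded K" "bounded L"
  shows "finite {n \<in> int_lattice. \<exists>y\<in>K. y - n \<in> L}"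
proof -
  obtain a b where a: "\<And>y. y \<in> K \<Longrightarrow> norm y \<le> a" and b: "\<And>y. y \<in> L \<Longrightarrow> norm y \<le> b"
    using assms unfolding bounded_iff by metis
  have "{n \<in> int_lattice. \<exists>y\<in>K. y - n \<in> L} \<subseteq> {n \<in> int_lattice. norm n \<le> a + b}"
  proof clarify
    fix n y assume "y \<in> K" "y - n \<in> L"
    then show "norm n \<le> a + b"
      using a[of y] b[of "y - n"] norm_triangle_ineq4[of y "y - n"] by simp
  qed
  then show ?thesis by (rule finite_subset) (rule finite_int_lattice_bounded)
qed

text \<open>Differentiating the Poisson formula yields the Poisson formula of the derivative of
  \<open>\<theta>\<close>. So every derivative of the series converges uniformly on
  \<open>supp \<psi>\<close>, and continuity of \<open>f\<close> permits applying it term by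
  term.\<close>

lemma poisson_summation_distribution:
  fixes f :: "(real^'n::finite \<Rightarrow> complex) \<Rightarrow> complex"
  assumes f: "distribution f" and \<psi>: "\<psi> \<in> test_functions UNIV" and \<theta>: "\<theta> \<in> test_functions UNIV"
    and F: "finite F" "F \<subseteq> int_lattice"
    and cover: "\<And>n y. n \<in> int_lattice \<Longrightarrow> y \<in> supp \<psi> \<Longrightarrow> y - n \<in> supp \<theta> \<Longrightarrow> n \<in> F"
  shows "((\<lambda>k. inv_fourier \<theta> k * fourier (dist_mult \<psi> f) k) has_sum
      (\<Sum>n\<in>F. f (\<lambda>x. \<psi> x * \<theta> (x - n)))) int_lattice"
proof -
  note \<theta>s = test_functionsD(1)[OF \<theta>]
  obtain C N where "C \<ge> 0" and CN: "\<And>\<theta> B. smooth \<theta> \<Longrightarrow> B \<ge> 0 \<Longrightarrow>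
       (\<And>js x. length js \<le> N \<Longrightarrow> x \<in> supp \<psi> \<Longrightarrow> norm (iter_partial js \<theta> x) \<le> B) \<Longrightarrow>
       norm (f (\<lambda>x. \<psi> x * \<theta> x)) \<le> C * B"
    by (rule distribution_bound[OF f \<psi>]) blast
  define P where "P x = (\<Sum>n\<in>F. \<theta> (x - n))" for x
  define S where "S X x = (\<Sum>k\<in>X. inv_fourier \<theta> k * plane_wave (- k) x)" for X x
  have P_smooth: "smooth P" unfolding P_def by (intro smooth_sum smooth_translate \<theta>s)
  have w_smooth: "smooth (\<lambda>x. inv_fourier \<theta> k * plane_wave (- k) x)" for k
    by (intro smooth_mult smooth_const smooth_plane_wave)
  have S_smooth: "smooth (S X)" for X unfolding S_def by (intro smooth_sum w_smooth)
  \<comment> \<open>The factors produced by differentiating \<open>plane_wave (- k)\<close> are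
    those that integration by parts produces in the transform of the derivative of
    \<open>\<theta>\<close>.\<close>
  have S_iter: "iter_partial js (S X) x = (\<Sum>k\<in>X. inv_fourier (iter_partial js \<theta>) k * plane_wave (- k) x)" for js X x
    unfolding S_def
    by (subst iter_partial_sum[OF w_smooth])
      (simp add: iter_partial_cmult[OF smooth_plane_wave] iter_partial_plane_wave inv_fourier_iter_partial[OF \<theta>] mult_ac)
  have P_iter: "iter_partial js P x = (\<Sum>n\<in>F. iter_partial js \<theta> (x - n))" for js x
    unfolding P_def by (subst iter_partial_sum[OF smooth_translate[OF \<theta>s]]) (simp add: iter_partial_translate[OF \<theta>s])
  have unif: "uniform_limit (supp \<psi>) (\<lambda>X. iter_partial js (S X)) (iter_partial js P) (finite_subsets_at_top int_lattice)" for js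
  proof -
    have \<theta>': "iter_partial js \<theta> \<in> test_functions UNIV" by (rule test_functions_iter_partial[OF \<theta>])
    obtain D where D: "D \<ge> 0" "\<And>y. norm (inv_fourier (iter_partial js \<theta>) y) \<le> D * japanese y powr (- real (CARD('n) + 2))"
      by (rule inv_fourier_rapid_decay[OF \<theta>', of "real (CARD('n) + 2)"]) blast
    have "uniform_limit (supp \<psi>) (\<lambda>X x. \<Sum>k\<in>X. inv_fourier (iter_partial js \<theta>) k * plane_wave (- k) x)
        (\<lambda>x. \<Sum>n\<in>F. iter_partial js \<theta> (x - n)) (finite_subsets_at_top int_lattice)"
    proof (rule Weierstrass_m_test_general')
      show "norm (inv_fourier (iter_partial js \<theta>) k * plane_wave (- k) x) \<le> D * japanese k powr (- real (CARD('n) + 2))" for k x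
        using D by (simp add: norm_mult)
      show "(\<lambda>k :: real^'n. D * japanese k powr (- real (CARD('n) + 2))) summable_on int_lattice"
        by (rule japanese_summable_on_int_lattice)
      fix x assume x: "x \<in> supp \<psi>"
      show "((\<lambda>k. inv_fourier (iter_partial js \<theta>) k * plane_wave (- k) x) has_sum
          (\<Sum>n\<in>F. iter_partial js \<theta> (x - n))) int_lattice"
      proof (rule poisson_summation[OF \<theta>' F])
        fix n assume "n \<in> int_lattice" "iter_partial js \<theta> (x - n) \<noteq> 0"
        then show "n \<in> F"
          using cover[OF _ x, of n] supp_iter_partial[of js \<theta>] in_supp[of "iter_partial js \<theta>" "x - n"] by blast
      qed
    qed
    then show ?thesis by (simp add: S_iter[abs_def] P_iter[abs_def])
  qed
  have fin: "finite {js :: 'n list. length js \<le> N}"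
    using finite_lists_length_le[of "UNIV :: 'n set" N] by simp
  have w: "(\<lambda>x. \<psi> x * (inv_fourier \<theta> k * plane_wave (- k) x)) \<in> test_functions UNIV" for k
    by (rule test_functions_mult[OF \<psi> w_smooth])
  have fS: "f (\<lambda>x. \<psi> x * S X x) = (\<Sum>k\<in>X. inv_fourier \<theta> k * fourier (dist_mult \<psi> f) k)" for X
  proof -
    have "f (\<lambda>x. \<psi> x * S X x) = f (\<lambda>x. \<Sum>k\<in>X. \<psi> x * (inv_fourier \<theta> k * plane_wave (- k) x))"
      by (simp add: S_def sum_distrib_left)
    also have "\<dots> = (\<Sum>k\<in>X. f (\<lambda>x. \<psi> x * (inv_fourier \<theta> k * plane_wave (- k) x)))"
      by (rule distribution_sum[OF f w])
    also have "\<dots> = (\<Sum>k\<in>X. inv_fourier \<theta> k * fourier (dist_mult \<psi> f) k)"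
    proof (rule sum.cong[OF refl])
      fix k
      show "f (\<lambda>x. \<psi> x * (inv_fourier \<theta> k * plane_wave (- k) x)) = inv_fourier \<theta> k * fourier (dist_mult \<psi> f) k"
        using distribution_cmult[OF f test_functions_mult[OF \<psi> smooth_plane_wave], of "inv_fourier \<theta> k" "- k"]
        by (simp add: fourier_dist_mult mult_ac)
    qed
    finally show ?thesis .
  qed
  have fP: "f (\<lambda>x. \<psi> x * P x) = (\<Sum>n\<in>F. f (\<lambda>x. \<psi> x * \<theta> (x - n)))"
    unfolding P_def sum_distrib_left
    by (rule distribution_sum[OF f test_functions_mult[OF \<psi> smooth_translate[OF \<theta>s]]])
  have "((\<lambda>X. f (\<lambda>x. \<psi> x * S X x)) \<longlongrightarrow> f (\<lambda>x. \<psi> x * P x)) (finite_subsets_at_top int_lattice)"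
    unfolding tendsto_iff
  proof (intro allI impI)
    fix e :: real assume "e > 0"
    define e' where "e' = e / (C + 1)"
    have "e' > 0" using \<open>e > 0\<close> \<open>C \<ge> 0\<close> by (simp add: e'_def)
    have "\<forall>\<^sub>F X in finite_subsets_at_top int_lattice. \<forall>js\<in>{js. length js \<le> N}. \<forall>x\<in>supp \<psi>.
        dist (iter_partial js (S X) x) (iter_partial js P x) < e'"
      using uniform_limitD[OF unif \<open>e' > 0\<close>] by (intro eventually_ball_finite[OF fin]) auto
    then show "\<forall>\<^sub>F X in finite_subsets_at_top int_lattice. dist (f (\<lambda>x. \<psi> x * S X x)) (f (\<lambda>x. \<psi> x * P x)) < e"
    proof eventually_elim
      case (elim X)
      have "norm (f (\<lambda>x. \<psi> x * (S X x - P x))) \<le> C * e'"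
      proof (rule CN[OF smooth_diff[OF S_smooth P_smooth]])
        fix js :: "'n list" and x assume "length js \<le> N" "x \<in> supp \<psi>"
        then show "norm (iter_partial js (\<lambda>x. S X x - P x) x) \<le> e'"
          using elim by (auto simp: iter_partial_diff[OF S_smooth P_smooth] dist_norm intro: less_imp_le)
      qed (use \<open>e' > 0\<close> in auto)
      also have "f (\<lambda>x. \<psi> x * (S X x - P x)) = f (\<lambda>x. \<psi> x * S X x) - f (\<lambda>x. \<psi> x * P x)"
        using distribution_diff[OF f test_functions_mult[OF \<psi> S_smooth] test_functions_mult[OF \<psi> P_smooth]]
        by (simp add: right_diff_distrib)
      also have "C * e' < e" using \<open>e > 0\<close> \<open>C \<ge> 0\<close> by (simp add: e'_def field_simps)
      finally show ?case by (simp add: dist_norm)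
    qed
  qed
  then show ?thesis unfolding has_sum_def fS fP .
qed

text \<open>Poisson summation read from the side of the periodic extension: outside a finite set of
  translates the supports of \<open>\<psi>\<close> and of the translated \<open>\<theta>\<close> are
  disjoint, so the infinite sum is the finite one.\<close>

lemma has_fourier_series_periodic_ext:
  fixes f :: "(real^'n::finite \<Rightarrow> complex) \<Rightarrow> complex"
  assumes f: "distribution f" and \<psi>: "\<psi> \<in> test_functions UNIV"
  shows "has_fourier_series (periodic_ext (dist_mult \<psi> f)) (fourier (dist_mult \<psi> f))"
  unfolding has_fourier_series_def
proof
  fix \<theta> :: "real^'n \<Rightarrow> complex" assume \<theta>: "\<theta> \<in> test_functions UNIV"
  define F where "F = {n \<in> int_lattice. \<exists>y\<in>supp \<psi>. y - n \<in> supp \<theta>}"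
  have F: "finite F" "F \<subseteq> int_lattice" unfolding F_def
    using finite_translate_cover[OF compact_imp_bounded[OF test_functionsD(2)[OF \<psi>]]
        compact_imp_bounded[OF test_functionsD(2)[OF \<theta>]]] by auto
  have "f (\<lambda>x. \<psi> x * \<theta> (x - n)) = 0" if "n \<in> int_lattice - F" for n
  proof -
    have "\<psi> x * \<theta> (x - n) = 0" for x
      using that in_supp[of \<psi> x] in_supp[of \<theta> "x - n"] by (auto simp: F_def)
    then have "(\<lambda>x. \<psi> x * \<theta> (x - n)) = (\<lambda>x. 0)" by (rule ext)
    then show ?thesis using distribution_0[OF f] by simp
  qed
  then have "periodic_ext (dist_mult \<psi> f) \<theta> = (\<Sum>\<^sub>\<infinity>n\<in>F. f (\<lambda>x. \<psi> x * \<theta> (x - n)))"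
    unfolding periodic_ext_def dist_mult_def
    by (intro infsum_cong_neutral) (use F in auto)
  also have "\<dots> = (\<Sum>n\<in>F. f (\<lambda>x. \<psi> x * \<theta> (x - n)))"
    using F by simp
  finally have "periodic_ext (dist_mult \<psi> f) \<theta> = (\<Sum>n\<in>F. f (\<lambda>x. \<psi> x * \<theta> (x - n)))" .
  moreover have "((\<lambda>k. inv_fourier \<theta> k * fourier (dist_mult \<psi> f) k) has_sum
      (\<Sum>n\<in>F. f (\<lambda>x. \<psi> x * \<theta> (x - n)))) int_lattice"
    by (rule poisson_summation_distribution[OF f \<psi> \<theta> F]) (auto simp: F_def)
  ultimately show "((\<lambda>n. fourier (dist_mult \<psi> f) n * (LINT x|lborel. plane_wave n x * \<theta> x)) has_sum
      periodic_ext (dist_mult \<psi> f) \<theta>) int_lattice"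
    by (simp add: inv_fourier_def mult.commute[of "fourier _ _"])
qed

section \<open>Frequency shifts and the continuous convolution bound\<close>

lemma inv_fourier_mult_plane_wave:
  "inv_fourier (\<lambda>x. \<phi> x * plane_wave z x) y = inv_fourier \<phi> (y + z)"
  by (simp add: inv_fourier_def plane_wave_add mult_ac)

lemma fourier_dist_mult_plane_wave:
  "fourier (dist_mult (\<lambda>x. \<psi> x * plane_wave (- \<tau>) x) f) k = fourier (dist_mult \<psi> f) (\<tau> + k)"
proof -
  have "plane_wave (- (\<tau> + k)) x = plane_wave (- \<tau>) x * plane_wave (- k) x" for x
    using plane_wave_add[of "- \<tau>" "- k" x] by simp
  then show ?thesis by (simp add: fourier_dist_mult mult_ac)
qed

text \<open>This replaces the convolution formula for the Fourier transform of a product. Twisting the two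
  factors by plane waves of opposite frequency \<open>\<tau>\<close> turns the sum over translates in the Poisson
  summation formula into a trigonometric polynomial in \<open>\<tau>\<close>, whose mean over a unit cell is the
  untranslated term.\<close>

lemma fourier_dist_mult_convolution_bound:
  fixes f :: "(real^'n::finite \<Rightarrow> complex) \<Rightarrow> complex"
  assumes f: "distribution f" and \<psi>: "\<psi> \<in> test_functions UNIV" and \<phi>: "\<phi> \<in> test_functions UNIV"
  obtains C where "C \<ge> 0"
    "\<And>\<xi>. ennreal (norm (fourier (dist_mult (\<lambda>x. \<psi> x * \<phi> x) f) \<xi>)) \<le>
      (\<integral>\<^sup>+\<zeta>. ennreal (C * japanese (\<xi> - \<zeta>) powr (- A) * norm (fourier (dist_mult \<psi> f) \<zeta>)) \<partial>lborel)"
proof -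
  let ?u = "fourier (dist_mult \<psi> f)"
  obtain C where C: "C \<ge> 0" "\<And>y. norm (inv_fourier \<phi> y) \<le> C * japanese y powr (- A)"
    by (rule inv_fourier_rapid_decay[OF \<phi>, of A]) blast
  \<comment> \<open>The index 0 is inserted so that the term to be isolated is present even if the
    supports are disjoint.\<close>
  define F where "F = insert 0 {n \<in> int_lattice. \<exists>y\<in>supp \<psi>. y - n \<in> supp \<phi>}"
  have F: "finite F" "F \<subseteq> int_lattice" unfolding F_def
    using finite_translate_cover[OF compact_imp_bounded[OF test_functionsD(2)[OF \<psi>]]
        compact_imp_bounded[OF test_functionsD(2)[OF \<phi>]]] by (auto simp: int_lattice_closed)
  have "ennreal (norm (fourier (dist_mult (\<lambda>x. \<psi> x * \<phi> x) f) \<xi>)) \<le>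
      (\<integral>\<^sup>+\<zeta>. ennreal (C * japanese (\<xi> - \<zeta>) powr (- A) * norm (?u \<zeta>)) \<partial>lborel)" for \<xi>
  proof -
    \<comment> \<open>The part of the n-th translated term that does not depend on \<tau>; the
      dependence on \<tau> is the phase \<open>plane_wave (- n) \<tau>\<close>.\<close>
    define \<beta> where "\<beta> n = plane_wave (- \<xi>) (- n) * f (\<lambda>x. \<psi> x * \<phi> (x - n) * plane_wave (- \<xi>) x)" for n
    define S where "S \<tau> = (\<Sum>n\<in>F. \<beta> n * plane_wave (- n) \<tau>)" for \<tau>
    have \<beta>0: "\<beta> 0 = fourier (dist_mult (\<lambda>x. \<psi> x * \<phi> x) f) \<xi>"
      by (simp add: \<beta>_def fourier_dist_mult)
    define g where "g \<zeta> = ennreal (C * japanese (\<xi> - \<zeta>) powr (- A) * norm (?u \<zeta>))" for \<zeta>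
    have [measurable]: "?u \<in> borel_measurable borel"
      by (rule borel_measurable_continuous_onI[OF continuous_on_fourier[OF f \<psi>]])
    have g_meas [measurable]: "g \<in> borel_measurable borel" unfolding g_def by measurable
    have S_le: "ennreal (norm (S \<tau>)) \<le> (\<integral>\<^sup>+n. g (\<tau> - n) \<partial>count_space int_lattice)" for \<tau>
    proof -
      \<comment> \<open>The two frequencies add up to \<open>- \<xi>\<close>: in the untranslated
        product \<tau> cancels, and in a translated one it survives only as a constant
        phase.\<close>
      let ?\<psi> = "\<lambda>x. \<psi> x * plane_wave (- \<tau>) x" and ?\<phi> = "\<lambda>x. \<phi> x * plane_wave (\<tau> - \<xi>) x"
      have \<psi>': "?\<psi> \<in> test_functions UNIV" and \<phi>': "?\<phi> \<in> test_functions UNIV"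
        by (intro test_functions_mult smooth_plane_wave \<psi> \<phi>)+
      have "((\<lambda>k. inv_fourier ?\<phi> k * fourier (dist_mult ?\<psi> f) k) has_sum
          (\<Sum>n\<in>F. f (\<lambda>x. ?\<psi> x * ?\<phi> (x - n)))) int_lattice"
      proof (rule poisson_summation_distribution[OF f \<psi>' \<phi>' F])
        have "supp ?\<psi> \<subseteq> supp \<psi>" "supp ?\<phi> \<subseteq> supp \<phi>"
          by (rule supp_subsetI[OF closed_supp], simp add: in_supp)+
        then show "n \<in> F" if "n \<in> int_lattice" "y \<in> supp ?\<psi>" "y - n \<in> supp ?\<phi>" for n y
          using that by (auto simp: F_def)
      qed
      moreover have "f (\<lambda>x. ?\<psi> x * ?\<phi> (x - n)) = \<beta> n * plane_wave (- n) \<tau>" for n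
      proof -
        have "?\<psi> x * ?\<phi> (x - n) = (plane_wave (- \<xi>) (- n) * plane_wave (- n) \<tau>) * (\<psi> x * \<phi> (x - n) * plane_wave (- \<xi>) x)" for x
        proof -
          have "plane_wave (\<tau> - \<xi>) (x - n) = plane_wave \<tau> x * plane_wave (- \<xi>) x * (plane_wave \<tau> (- n) * plane_wave (- \<xi>) (- n))"
            using plane_wave_add_right[of "\<tau> - \<xi>" x "- n"] plane_wave_add[of \<tau> "- \<xi>"] by simp
          moreover have "plane_wave (- \<tau>) x * plane_wave \<tau> x = 1"
            using plane_wave_add[of "- \<tau>" \<tau> x] by simp
          ultimately show ?thesis
            by (simp add: plane_wave_commute[of "- n" \<tau>])
        qed
        then have "f (\<lambda>x. ?\<psi> x * ?\<phi> (x - n)) =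
            f (\<lambda>x. (plane_wave (- \<xi>) (- n) * plane_wave (- n) \<tau>) * (\<psi> x * \<phi> (x - n) * plane_wave (- \<xi>) x))"
          by presburger
        also have "\<dots> = (plane_wave (- \<xi>) (- n) * plane_wave (- n) \<tau>) * f (\<lambda>x. \<psi> x * \<phi> (x - n) * plane_wave (- \<xi>) x)"
          by (intro distribution_cmult[OF f] test_functions_mult \<psi> smooth_translate
              test_functionsD(1)[OF \<phi>] smooth_plane_wave)
        finally show ?thesis by (simp add: \<beta>_def mult_ac)
      qed
      ultimately have "((\<lambda>k. inv_fourier \<phi> (k + (\<tau> - \<xi>)) * ?u (\<tau> + k)) has_sum S \<tau>) int_lattice"
        by (simp add: S_def inv_fourier_mult_plane_wave fourier_dist_mult_plane_wave)
      then have "ennreal (norm (S \<tau>)) \<le>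
          (\<integral>\<^sup>+k. ennreal (norm (inv_fourier \<phi> (k + (\<tau> - \<xi>)) * ?u (\<tau> + k))) \<partial>count_space int_lattice)"
        by (rule norm_has_sum_le)
      also have "\<dots> \<le> (\<integral>\<^sup>+k. g (\<tau> + k) \<partial>count_space int_lattice)"
      proof (intro nn_integral_mono)
        fix k
        have "japanese (k + (\<tau> - \<xi>)) = japanese (\<xi> - (\<tau> + k))"
          using japanese_minus_commute[of \<xi> "\<tau> + k"] by (simp add: algebra_simps)
        then show "ennreal (norm (inv_fourier \<phi> (k + (\<tau> - \<xi>)) * ?u (\<tau> + k))) \<le> g (\<tau> + k)"
          unfolding g_def norm_mult using C(2)[of "k + (\<tau> - \<xi>)"]
          by (intro ennreal_leI mult_right_mono) auto
      qed
      also have "\<dots> = (\<integral>\<^sup>+n. g (\<tau> - n) \<partial>count_space int_lattice)"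
      proof -
        have "bij_betw uminus (int_lattice :: (real^'n) set) int_lattice"
          by (rule bij_betwI[where g=uminus]) (auto simp: int_lattice_closed)
        from nn_integral_bij_count_space[OF this, of "\<lambda>k. g (\<tau> + k)"] show ?thesis by simp
      qed
      finally show ?thesis .
    qed
    have S_int: "integrable lborel (\<lambda>\<tau>. indicator (unit_cell 0) \<tau> *\<^sub>R S \<tau>)"
      using set_integrable_unit_cell[of S 0] unfolding set_integrable_def S_def
      by (simp add: continuous_intros)
    have "(LINT \<tau>:unit_cell 0|lborel. S \<tau>) = (LINT \<tau>|lborel. (\<Sum>n\<in>F. \<beta> n * (indicator (unit_cell 0) \<tau> *\<^sub>R plane_wave (- n) \<tau>)))"
      unfolding set_lebesgue_integral_def S_def
      by (intro Bochner_Integration.integral_cong refl) (simp add: scaleR_sum_right)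
    also have "\<dots> = (\<Sum>n\<in>F. \<beta> n * (LINT \<tau>:unit_cell 0|lborel. plane_wave (- n) \<tau>))"
    proof -
      have "integrable lborel (\<lambda>\<tau>. indicator (unit_cell 0) \<tau> *\<^sub>R plane_wave (- n) \<tau>)" for n :: "real^'n"
        using set_integrable_unit_cell[of "plane_wave (- n)" 0]
        by (simp add: set_integrable_def continuous_intros)
      then show ?thesis unfolding set_lebesgue_integral_def
        by (subst Bochner_Integration.integral_sum) (simp_all del: mult_scaleR_right)
    qed
    also have "\<dots> = (\<Sum>n\<in>F. if n = 0 then \<beta> n else 0)"
    proof (rule sum.cong[OF refl])
      fix n assume "n \<in> F"
      then have "- n \<in> int_lattice" using F int_lattice_closed(2) by blast
      from integral_plane_wave_unit_cell[OF this, of 0]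
      show "\<beta> n * (LINT \<tau>:unit_cell 0|lborel. plane_wave (- n) \<tau>) = (if n = 0 then \<beta> n else 0)" by simp
    qed
    also have "\<dots> = \<beta> 0" using F by (simp add: F_def)
    finally have "ennreal (norm (\<beta> 0)) = ennreal (norm (LINT \<tau>:unit_cell 0|lborel. S \<tau>))" by simp
    also have "\<dots> \<le> (\<integral>\<^sup>+\<tau>. ennreal (norm (indicator (unit_cell 0) \<tau> *\<^sub>R S \<tau>)) \<partial>lborel)"
      unfolding set_lebesgue_integral_def by (rule integral_norm_bound_ennreal[OF S_int])
    \<comment> \<open>Averaging the lattice sums over the cell of shifts sweeps out the whole space,
      so tiling yields a Lebesgue integral.\<close>
    also have "\<dots> \<le> (\<integral>\<^sup>+\<tau>. indicator (unit_cell 0) \<tau> * (\<integral>\<^sup>+n. g (\<tau> - n) \<partial>count_space int_lattice) \<partial>lborel)"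
      using S_le by (intro nn_integral_mono) (auto simp: indicator_def)
    also have "\<dots> = (\<integral>\<^sup>+\<zeta>. g \<zeta> \<partial>lborel)"
      by (rule nn_integral_tiling[OF g_meas, symmetric])
    finally show ?thesis by (simp add: \<beta>0 g_def)
  qed
  with C(1) show thesis by (rule that)
qed

section \<open>Transfer of weighted square integrability between measures\<close>

lemma powr_squared: "(x powr s)\<^sup>2 = x powr (2 * s)" for x :: real
  by (simp add: power2_eq_square powr_add[symmetric])

text \<open>Cauchy-Schwarz for the splitting \<open>l * (l * g)\<close>, followed by an interchange
  of integrals. The kernel is written as a square so that its square root need not be taken.\<close>

lemma schur_test:
  fixes l :: "'a \<Rightarrow> 'b \<Rightarrow> ennreal"
  assumes "sigma_finite_measure M" "sigma_finite_measure N"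
    and l: "case_prod l \<in> borel_measurable (M \<Otimes>\<^sub>M N)" and g: "g \<in> borel_measurable N"
    and K1: "\<And>x. x \<in> space M \<Longrightarrow> (\<integral>\<^sup>+y. (l x y)\<^sup>2 \<partial>N) \<le> K1"
    and K2: "\<And>y. y \<in> space N \<Longrightarrow> (\<integral>\<^sup>+x. (l x y)\<^sup>2 \<partial>M) \<le> K2"
  shows "(\<integral>\<^sup>+x. (\<integral>\<^sup>+y. (l x y)\<^sup>2 * g y \<partial>N)\<^sup>2 \<partial>M) \<le> K1 * K2 * (\<integral>\<^sup>+y. (g y)\<^sup>2 \<partial>N)"
proof -
  interpret M: sigma_finite_measure M by fact
  interpret N: sigma_finite_measure N by fact
  interpret MN: pair_sigma_finite M N ..
  note [measurable] = l g
  have [measurable]: "l x \<in> borel_measurable N" if "x \<in> space M" for x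
    using measurable_Pair2[OF l that] by simp
  have [measurable]: "(\<lambda>x. l x y) \<in> borel_measurable M" if "y \<in> space N" for y
    using measurable_Pair1[OF l that] by simp
  have "(\<integral>\<^sup>+x. (\<integral>\<^sup>+y. (l x y)\<^sup>2 * g y \<partial>N)\<^sup>2 \<partial>M) \<le> (\<integral>\<^sup>+x. K1 * (\<integral>\<^sup>+y. (l x y)\<^sup>2 * (g y)\<^sup>2 \<partial>N) \<partial>M)"
  proof (rule nn_integral_mono)
    fix x assume x [measurable]: "x \<in> space M"
    have "(\<integral>\<^sup>+y. l x y * (l x y * g y) \<partial>N)\<^sup>2 \<le> (\<integral>\<^sup>+y. (l x y)\<^sup>2 \<partial>N) * (\<integral>\<^sup>+y. (l x y * g y)\<^sup>2 \<partial>N)"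
      using x by (intro Cauchy_Schwarz_nn_integral) measurable
    also have "\<dots> \<le> K1 * (\<integral>\<^sup>+y. (l x y * g y)\<^sup>2 \<partial>N)"
      by (rule mult_right_mono[OF K1[OF x]]) simp
    finally show "(\<integral>\<^sup>+y. (l x y)\<^sup>2 * g y \<partial>N)\<^sup>2 \<le> K1 * (\<integral>\<^sup>+y. (l x y)\<^sup>2 * (g y)\<^sup>2 \<partial>N)"
      by (simp add: power2_eq_square mult_ac)
  qed
  also have "\<dots> = K1 * (\<integral>\<^sup>+x. (\<integral>\<^sup>+y. (l x y)\<^sup>2 * (g y)\<^sup>2 \<partial>N) \<partial>M)"
    by (rule nn_integral_cmult) measurable
  also have "(\<integral>\<^sup>+x. (\<integral>\<^sup>+y. (l x y)\<^sup>2 * (g y)\<^sup>2 \<partial>N) \<partial>M) = (\<integral>\<^sup>+y. (\<integral>\<^sup>+x. (l x y)\<^sup>2 * (g y)\<^sup>2 \<partial>M) \<partial>N)"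
    by (rule MN.Fubini'[symmetric]) measurable
  also have "\<dots> \<le> (\<integral>\<^sup>+y. K2 * (g y)\<^sup>2 \<partial>N)"
  proof (rule nn_integral_mono)
    fix y assume y: "y \<in> space N"
    have "(\<integral>\<^sup>+x. (l x y)\<^sup>2 * (g y)\<^sup>2 \<partial>M) = (\<integral>\<^sup>+x. (l x y)\<^sup>2 \<partial>M) * (g y)\<^sup>2"
      using y by (intro nn_integral_multc) measurable
    also have "\<dots> \<le> K2 * (g y)\<^sup>2" by (rule mult_right_mono[OF K2[OF y]]) simp
    finally show "(\<integral>\<^sup>+x. (l x y)\<^sup>2 * (g y)\<^sup>2 \<partial>M) \<le> K2 * (g y)\<^sup>2" .
  qed
  also have "\<dots> = K2 * (\<integral>\<^sup>+y. (g y)\<^sup>2 \<partial>N)" by (rule nn_integral_cmult) measurable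
  finally show ?thesis by (simp add: mult.assoc mult_left_mono)
qed

text \<open>With \<open>e\<close> the unit vector along \<open>\<xi>\<^sub>0\<close>, a point of the
  smaller cone scaled to length 1 lies within r/2 of \<open>e\<close>, while any
  \<open>\<zeta>\<close> outside \<Gamma>, scaled by the same factor, is at distance at least r.
  Hence \<open>norm (\<xi> - \<zeta>)\<close> is at least r/2 times \<open>norm \<xi>\<close>, and
  the triangle inequality bounds \<open>norm \<zeta>\<close>.\<close>

lemma open_cone_shrink:
  fixes \<xi>\<^sub>0 :: "real^'n::finite"
  assumes \<Gamma>: "open_cone \<Gamma>" "\<xi>\<^sub>0 \<in> \<Gamma>" and "\<xi>\<^sub>0 \<noteq> 0"
  obtains \<Gamma>' \<kappa> where "open_cone \<Gamma>'" "\<xi>\<^sub>0 \<in> \<Gamma>'" "\<kappa> \<ge> 1"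
    "\<And>\<xi> \<zeta>. \<xi> \<in> \<Gamma>' \<Longrightarrow> \<zeta> \<notin> \<Gamma> \<Longrightarrow> norm \<zeta> \<le> \<kappa> * norm (\<xi> - \<zeta>)"
proof -
  define e where "e = inverse (norm \<xi>\<^sub>0) *\<^sub>R \<xi>\<^sub>0"
  have "e \<in> \<Gamma>" using assms by (simp add: e_def open_cone_def)
  then obtain r where "r > 0" and r: "ball e r \<subseteq> \<Gamma>"
    using \<Gamma>(1) unfolding open_cone_def by (meson openE)
  define \<epsilon> where "\<epsilon> = r / 2"
  have "\<epsilon> > 0" using \<open>r > 0\<close> by (simp add: \<epsilon>_def)
  \<comment> \<open>The strict inequality excludes 0, so that division by \<open>norm \<xi>\<close>
    is possible below.\<close>
  define \<Gamma>' where "\<Gamma>' = {\<xi>. norm (\<xi> - norm \<xi> *\<^sub>R e) < \<epsilon> * norm \<xi>}"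
  show thesis
  proof (rule that[of \<Gamma>' "1 / \<epsilon> + 1"])
    show "open_cone \<Gamma>'"
      unfolding open_cone_def
    proof (intro conjI ballI allI impI)
      show "open \<Gamma>'" unfolding \<Gamma>'_def by (intro open_Collect_less continuous_intros)
      fix \<xi> t assume "\<xi> \<in> \<Gamma>'" "(t :: real) > 0"
      moreover have "t *\<^sub>R \<xi> - norm (t *\<^sub>R \<xi>) *\<^sub>R e = t *\<^sub>R (\<xi> - norm \<xi> *\<^sub>R e)"
        using \<open>t > 0\<close> by (simp add: scaleR_diff_right)
      ultimately show "t *\<^sub>R \<xi> \<in> \<Gamma>'"
        by (simp add: \<Gamma>'_def mult.left_commute del: scaleR_scaleR)
    qed
    show "\<xi>\<^sub>0 \<in> \<Gamma>'" using \<open>\<xi>\<^sub>0 \<noteq> 0\<close> \<open>\<epsilon> > 0\<close> by (simp add: \<Gamma>'_def e_def)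
    show "1 / \<epsilon> + 1 \<ge> 1" using \<open>\<epsilon> > 0\<close> by simp
    fix \<xi> \<zeta> assume \<xi>: "\<xi> \<in> \<Gamma>'" and \<zeta>: "\<zeta> \<notin> \<Gamma>"
    have "norm \<xi> > 0"
      using \<xi> by (auto simp: \<Gamma>'_def)
    have "inverse (norm \<xi>) *\<^sub>R \<zeta> \<notin> \<Gamma>"
    proof
      assume "inverse (norm \<xi>) *\<^sub>R \<zeta> \<in> \<Gamma>"
      then have "norm \<xi> *\<^sub>R (inverse (norm \<xi>) *\<^sub>R \<zeta>) \<in> \<Gamma>"
        using \<Gamma>(1) \<open>norm \<xi> > 0\<close> unfolding open_cone_def by blast
      with \<zeta> \<open>norm \<xi> > 0\<close> show False by simp
    qed
    then have "inverse (norm \<xi>) *\<^sub>R \<zeta> \<notin> ball e r" using r by blast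
    then have "r \<le> norm (e - inverse (norm \<xi>) *\<^sub>R \<zeta>)" by (simp add: dist_norm)
    then have "norm \<xi> * r \<le> norm \<xi> * norm (e - inverse (norm \<xi>) *\<^sub>R \<zeta>)"
      using \<open>norm \<xi> > 0\<close> by simp
    also have "\<dots> = norm (norm \<xi> *\<^sub>R (e - inverse (norm \<xi>) *\<^sub>R \<zeta>))" by simp
    also have "norm \<xi> *\<^sub>R (e - inverse (norm \<xi>) *\<^sub>R \<zeta>) = (\<xi> - \<zeta>) - (\<xi> - norm \<xi> *\<^sub>R e)"
      using \<open>norm \<xi> > 0\<close> by (simp add: scaleR_diff_right)
    also have "norm \<dots> \<le> norm (\<xi> - \<zeta>) + norm (\<xi> - norm \<xi> *\<^sub>R e)" by (rule norm_triangle_ineq4)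
    also have "\<dots> \<le> norm (\<xi> - \<zeta>) + \<epsilon> * norm \<xi>" using \<xi> by (simp add: \<Gamma>'_def)
    finally have "\<epsilon> * norm \<xi> \<le> norm (\<xi> - \<zeta>)" by (simp add: \<epsilon>_def algebra_simps)
    then have "norm \<xi> \<le> norm (\<xi> - \<zeta>) / \<epsilon>" using \<open>\<epsilon> > 0\<close> by (simp add: field_simps)
    moreover have "norm \<zeta> \<le> norm \<xi> + norm (\<xi> - \<zeta>)"
      using norm_triangle_ineq4[of \<xi> "\<xi> - \<zeta>"] by simp
    ultimately show "norm \<zeta> \<le> (1 / \<epsilon> + 1) * norm (\<xi> - \<zeta>)" by (simp add: algebra_simps)
  qed
qed

text \<open>Both implications of the theorem are instances of the following lemma, with Lebesgue measure and
  the counting measure of the lattice in the two possible orders.\<close>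

lemma conic_l2_transfer:
  fixes M N :: "(real^'n::finite) measure" and F G :: "real^'n \<Rightarrow> real"
  defines "p \<equiv> real (CARD('n) + 2)"
  assumes sf: "sigma_finite_measure M" "sigma_finite_measure N"
    and sets [measurable_cong]: "sets M = sets borel" "sets N = sets borel"
    and K: "K < \<infinity>" "\<And>\<zeta>. (\<integral>\<^sup>+\<xi>. ennreal (japanese (\<xi> - \<zeta>) powr (- p)) \<partial>M) \<le> K"
      "\<And>\<xi>. (\<integral>\<^sup>+\<zeta>. ennreal (japanese (\<zeta> - \<xi>) powr (- p)) \<partial>N) \<le> K"
    and G [measurable]: "G \<in> borel_measurable borel" and G0: "\<And>\<zeta>. G \<zeta> \<ge> 0"
    and G_bound: "\<And>\<zeta>. G \<zeta> \<le> D * japanese \<zeta> ^ m" and F0: "\<And>\<xi>. F \<xi> \<ge> 0"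
    and F: "\<And>A. \<exists>C\<ge>0. \<forall>\<xi>. ennreal (F \<xi>) \<le> (\<integral>\<^sup>+\<zeta>. ennreal (C * japanese (\<xi> - \<zeta>) powr (- A) * G \<zeta>) \<partial>N)"
    and \<Gamma>: "open_cone \<Gamma>" "\<xi>\<^sub>0 \<in> \<Gamma>" "\<xi>\<^sub>0 \<noteq> 0"
    and fin: "(\<integral>\<^sup>+\<zeta>\<in>\<Gamma>. ennreal ((G \<zeta>)\<^sup>2 * japanese \<zeta> powr (2 * s)) \<partial>N) < \<infinity>"
  obtains \<Gamma>' where "open_cone \<Gamma>'" "\<xi>\<^sub>0 \<in> \<Gamma>'"
    "(\<integral>\<^sup>+\<xi>\<in>\<Gamma>'. ennreal ((F \<xi>)\<^sup>2 * japanese \<xi> powr (2 * s)) \<partial>M) < \<infinity>"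
proof -
  obtain \<Gamma>' \<kappa> where \<Gamma>': "open_cone \<Gamma>'" "\<xi>\<^sub>0 \<in> \<Gamma>'" "\<kappa> \<ge> 1"
    and \<kappa>: "\<And>\<xi> \<zeta>. \<xi> \<in> \<Gamma>' \<Longrightarrow> \<zeta> \<notin> \<Gamma> \<Longrightarrow> norm \<zeta> \<le> \<kappa> * norm (\<xi> - \<zeta>)"
    by (rule open_cone_shrink[OF \<Gamma>]) blast
  have [measurable]: "\<Gamma> \<in> sets borel" using \<Gamma>(1) by (simp add: open_cone_def)
  have "D \<ge> 0" using order_trans[OF G0 G_bound[of 0]] by (simp add: japanese_def)
  \<comment> \<open>Chosen so that \<open>- B + m + s \<le> - p\<close>: decay of order
    \<open>B\<close> beats the growth of \<open>G\<close> and the weight, leaving an integrable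
    power.\<close>
  define B where "B = p + m + \<bar>s\<bar>"
  have "B \<ge> 0" "p \<ge> 0" by (simp_all add: B_def p_def)
  \<comment> \<open>Of the exponent, \<open>p\<close> remains as the Schur kernel,
    \<open>\<bar>s\<bar>\<close> cancels the loss in Peetre's inequality, and \<open>B\<close>
    provides the decay off the cone.\<close>
  obtain C where "C \<ge> 0" and C: "\<And>\<xi>. ennreal (F \<xi>) \<le>
      (\<integral>\<^sup>+\<zeta>. ennreal (C * japanese (\<xi> - \<zeta>) powr (- (p + \<bar>s\<bar> + B)) * G \<zeta>) \<partial>N)"
    using F[of "p + \<bar>s\<bar> + B"] by blast
  define C' where "C' = C * 2 powr \<bar>s\<bar> * (1 + D * \<kappa> powr B)"
  have "C' \<ge> 0" using \<open>C \<ge> 0\<close> \<open>D \<ge> 0\<close> by (simp add: C'_def)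
  \<comment> \<open>One majorant for both regions: the weighted \<open>G\<close> on \<Gamma>, where
    the hypothesis \<open>fin\<close> applies, and an integrable power off \<Gamma>.\<close>
  define h where "h \<zeta> = indicator \<Gamma> \<zeta> * (G \<zeta> * japanese \<zeta> powr s) + japanese \<zeta> powr (- p)" for \<zeta>
  have h0: "h \<zeta> \<ge> 0" for \<zeta> using G0 by (simp add: h_def)
  have [measurable]: "h \<in> borel_measurable borel" unfolding h_def by measurable
  have key: "japanese \<xi> powr s * (C * japanese (\<xi> - \<zeta>) powr (- (p + \<bar>s\<bar> + B)) * G \<zeta>) \<le>
      japanese (\<xi> - \<zeta>) powr (- p) * (C' * h \<zeta>)" if \<xi>: "\<xi> \<in> \<Gamma>'" for \<xi> \<zeta>
  proof -
    let ?k = "japanese (\<xi> - \<zeta>)"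
    have k: "?k \<ge> 1" "?k > 0" using japanese_ge_1 japanese_pos by auto
    have split: "?k powr (- (p + \<bar>s\<bar> + B)) = ?k powr (- p) * ?k powr (- \<bar>s\<bar>) * ?k powr (- B)"
      by (simp add: powr_add[symmetric])
    have cancel: "?k powr \<bar>s\<bar> * ?k powr (- \<bar>s\<bar>) = 1"
      using k by (simp add: powr_add[symmetric])
    have "japanese \<xi> powr s * (C * ?k powr (- (p + \<bar>s\<bar> + B)) * G \<zeta>) \<le>
        (2 powr \<bar>s\<bar> * japanese \<zeta> powr s * ?k powr \<bar>s\<bar>) * (C * ?k powr (- (p + \<bar>s\<bar> + B)) * G \<zeta>)"
      using \<open>C \<ge> 0\<close> G0 by (intro mult_right_mono peetre_inequality) auto
    also have "\<dots> = (?k powr \<bar>s\<bar> * ?k powr (- \<bar>s\<bar>)) * (?k powr (- p) * ((C * 2 powr \<bar>s\<bar>) * (?k powr (- B) * (G \<zeta> * japanese \<zeta> powr s))))"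
      unfolding split by (simp only: mult_ac)
    also have "\<dots> = ?k powr (- p) * ((C * 2 powr \<bar>s\<bar>) * (?k powr (- B) * (G \<zeta> * japanese \<zeta> powr s)))"
      by (simp only: cancel mult_1_left)
    also have "\<dots> \<le> ?k powr (- p) * ((C * 2 powr \<bar>s\<bar>) * ((1 + D * \<kappa> powr B) * h \<zeta>))"
    proof (intro mult_left_mono)
      show "?k powr (- B) * (G \<zeta> * japanese \<zeta> powr s) \<le> (1 + D * \<kappa> powr B) * h \<zeta>"
      proof (cases "\<zeta> \<in> \<Gamma>")
        case True
        have "?k powr (- B) \<le> 1" using k \<open>B \<ge> 0\<close> powr_mono[of "- B" 0 ?k] by simp
        then have "?k powr (- B) * (G \<zeta> * japanese \<zeta> powr s) \<le> 1 * (G \<zeta> * japanese \<zeta> powr s)"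
          using G0 by (intro mult_right_mono) auto
        also have "\<dots> \<le> 1 * h \<zeta>" using True by (simp add: h_def)
        also have "\<dots> \<le> (1 + D * \<kappa> powr B) * h \<zeta>"
          using \<open>D \<ge> 0\<close> h0 by (intro mult_right_mono) auto
        finally show ?thesis .
      next
        case False
        have j: "japanese \<zeta> \<ge> 1" by (rule japanese_ge_1)
        have "norm \<zeta> \<le> \<kappa> * norm (\<xi> - \<zeta>)" by (rule \<kappa>[OF \<xi> False])
        then have "(norm \<zeta>)\<^sup>2 \<le> (\<kappa> * norm (\<xi> - \<zeta>))\<^sup>2" by (intro power_mono) auto
        moreover have "1 \<le> \<kappa>\<^sup>2" using \<Gamma>'(3) by (simp add: one_le_power)
        ultimately have "1 + (norm \<zeta>)\<^sup>2 \<le> \<kappa>\<^sup>2 * (1 + (norm (\<xi> - \<zeta>))\<^sup>2)"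
          by (simp add: power_mult_distrib distrib_left)
        then have "japanese \<zeta> \<le> sqrt (\<kappa>\<^sup>2 * (1 + (norm (\<xi> - \<zeta>))\<^sup>2))"
          unfolding japanese_def by (rule real_sqrt_le_mono)
        also have "\<dots> = \<kappa> * ?k" using \<Gamma>'(3) by (simp add: japanese_def real_sqrt_mult)
        finally have "japanese \<zeta> powr B \<le> (\<kappa> * ?k) powr B"
          using j \<open>B \<ge> 0\<close> by (intro powr_mono2) auto
        also have "\<dots> = \<kappa> powr B * ?k powr B" using \<Gamma>'(3) k by (simp add: powr_mult)
        finally have kB: "?k powr (- B) \<le> \<kappa> powr B * japanese \<zeta> powr (- B)"
          using k j by (simp add: powr_minus field_simps)
        have "?k powr (- B) * (G \<zeta> * japanese \<zeta> powr s) \<le>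
            (\<kappa> powr B * japanese \<zeta> powr (- B)) * ((D * japanese \<zeta> powr m) * japanese \<zeta> powr s)"
          using kB G_bound[of \<zeta>] G0[of \<zeta>] j \<open>D \<ge> 0\<close>
          by (intro mult_mono mult_right_mono) (auto simp: powr_realpow)
        also have "\<dots> = D * \<kappa> powr B * japanese \<zeta> powr (- B + m + s)"
          by (simp only: powr_add mult_ac)
        also have "\<dots> \<le> (D * \<kappa> powr B) * japanese \<zeta> powr (- p)"
          using \<open>D \<ge> 0\<close> j by (intro mult_left_mono powr_mono) (auto simp: B_def)
        also have "\<dots> \<le> (1 + D * \<kappa> powr B) * h \<zeta>"
          using \<open>D \<ge> 0\<close> False by (intro mult_mono) (auto simp: h_def)
        finally show ?thesis .
      qed
    qed (use \<open>C \<ge> 0\<close> in auto)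
    finally show ?thesis by (simp add: C'_def mult_ac)
  qed
  \<comment> \<open>The square root of the kernel, as \<open>schur_test\<close> expects.\<close>
  define l where "l \<xi> \<zeta> = ennreal (japanese (\<xi> - \<zeta>) powr (- p / 2))" for \<xi> \<zeta> :: "real^'n"
  have l2: "(l \<xi> \<zeta>)\<^sup>2 = ennreal (japanese (\<xi> - \<zeta>) powr (- p))" for \<xi> \<zeta>
    by (simp add: l_def power2_eq_square ennreal_mult[symmetric] powr_add[symmetric])
  define g where "g \<zeta> = ennreal (C' * h \<zeta>)" for \<zeta>
  have "ennreal ((F \<xi>)\<^sup>2 * japanese \<xi> powr (2 * s)) * indicator \<Gamma>' \<xi> \<le> (\<integral>\<^sup>+\<zeta>. (l \<xi> \<zeta>)\<^sup>2 * g \<zeta> \<partial>N)\<^sup>2" for \<xi>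
  proof (cases "\<xi> \<in> \<Gamma>'")
    case True
    have "ennreal (japanese \<xi> powr s) * ennreal (F \<xi>) \<le> ennreal (japanese \<xi> powr s) *
        (\<integral>\<^sup>+\<zeta>. ennreal (C * japanese (\<xi> - \<zeta>) powr (- (p + \<bar>s\<bar> + B)) * G \<zeta>) \<partial>N)"
      by (intro mult_left_mono C) auto
    also have "\<dots> = (\<integral>\<^sup>+\<zeta>. ennreal (japanese \<xi> powr s) *
        ennreal (C * japanese (\<xi> - \<zeta>) powr (- (p + \<bar>s\<bar> + B)) * G \<zeta>) \<partial>N)"
      by (rule nn_integral_cmult[symmetric]) measurable
    also have "\<dots> \<le> (\<integral>\<^sup>+\<zeta>. (l \<xi> \<zeta>)\<^sup>2 * g \<zeta> \<partial>N)"
    proof (rule nn_integral_mono)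
      fix \<zeta>
      show "ennreal (japanese \<xi> powr s) * ennreal (C * japanese (\<xi> - \<zeta>) powr (- (p + \<bar>s\<bar> + B)) * G \<zeta>) \<le> (l \<xi> \<zeta>)\<^sup>2 * g \<zeta>"
        using key[OF True, of \<zeta>] h0[of \<zeta>] G0[of \<zeta>] \<open>C \<ge> 0\<close> \<open>C' \<ge> 0\<close>
        by (simp add: l2 g_def ennreal_mult[symmetric] ennreal_leI)
    qed
    finally have "(ennreal (japanese \<xi> powr s * F \<xi>))\<^sup>2 \<le> (\<integral>\<^sup>+\<zeta>. (l \<xi> \<zeta>)\<^sup>2 * g \<zeta> \<partial>N)\<^sup>2"
      using F0[of \<xi>] by (intro power_mono) (simp_all add: ennreal_mult)
    moreover have "(ennreal (japanese \<xi> powr s * F \<xi>))\<^sup>2 = ennreal ((F \<xi>)\<^sup>2 * japanese \<xi> powr (2 * s))"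
      using F0[of \<xi>] by (simp add: ennreal_power power_mult_distrib powr_squared mult_ac)
    ultimately show ?thesis using True by simp
  qed simp
  then have "(\<integral>\<^sup>+\<xi>\<in>\<Gamma>'. ennreal ((F \<xi>)\<^sup>2 * japanese \<xi> powr (2 * s)) \<partial>M) \<le>
      (\<integral>\<^sup>+\<xi>. (\<integral>\<^sup>+\<zeta>. (l \<xi> \<zeta>)\<^sup>2 * g \<zeta> \<partial>N)\<^sup>2 \<partial>M)"
    by (intro nn_integral_mono)
  also have "\<dots> \<le> K * K * (\<integral>\<^sup>+\<zeta>. (g \<zeta>)\<^sup>2 \<partial>N)"
  proof (rule schur_test[OF sf])
    show "case_prod l \<in> borel_measurable (M \<Otimes>\<^sub>M N)" unfolding l_def by measurable
    show "g \<in> borel_measurable N" unfolding g_def by measurable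
    show "(\<integral>\<^sup>+\<zeta>. (l \<xi> \<zeta>)\<^sup>2 \<partial>N) \<le> K" for \<xi>
      using K(3)[of \<xi>] by (simp add: l2 japanese_minus_commute[of \<xi>])
    show "(\<integral>\<^sup>+\<xi>. (l \<xi> \<zeta>)\<^sup>2 \<partial>M) \<le> K" for \<zeta>
      using K(2)[of \<zeta>] by (simp add: l2)
  qed
  also have "\<dots> < \<infinity>"
  proof -
    have "(\<integral>\<^sup>+\<zeta>. (g \<zeta>)\<^sup>2 \<partial>N) \<le> (\<integral>\<^sup>+\<zeta>. ennreal (2 * C'\<^sup>2) *
        (ennreal ((G \<zeta>)\<^sup>2 * japanese \<zeta> powr (2 * s)) * indicator \<Gamma> \<zeta> + ennreal (japanese (\<zeta> - 0) powr (- p))) \<partial>N)"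
    proof (rule nn_integral_mono)
      fix \<zeta>
      let ?a = "indicator \<Gamma> \<zeta> * ((G \<zeta>)\<^sup>2 * japanese \<zeta> powr (2 * s)) :: real"
      have "(h \<zeta>)\<^sup>2 \<le> 2 * (indicator \<Gamma> \<zeta> * (G \<zeta> * japanese \<zeta> powr s))\<^sup>2 + 2 * (japanese \<zeta> powr (- p))\<^sup>2"
        unfolding h_def using sum_squares_bound[of "indicator \<Gamma> \<zeta> * (G \<zeta> * japanese \<zeta> powr s)" "japanese \<zeta> powr (- p)"]
        by (simp add: power2_sum)
      moreover have "(indicator \<Gamma> \<zeta> * (G \<zeta> * japanese \<zeta> powr s))\<^sup>2 = ?a"
        by (simp add: indicator_def power_mult_distrib powr_squared mult_ac)
      \<comment> \<open>Since the bracket is at least 1, its square-integrability reduces to the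
        kernel bound at the origin, which is why \<open>\<zeta> - 0\<close> is written
        below.\<close>
      moreover have "(japanese \<zeta> powr (- p))\<^sup>2 \<le> japanese \<zeta> powr (- p)"
        using japanese_ge_1[of \<zeta>] \<open>p \<ge> 0\<close> by (simp add: powr_squared) (rule powr_mono, auto)
      moreover have "x \<le> 2 * u + 2 * v \<Longrightarrow> u = a \<Longrightarrow> v \<le> w \<Longrightarrow> x \<le> 2 * (a + w)" for x u v a w :: real
        by simp
      ultimately have "(h \<zeta>)\<^sup>2 \<le> 2 * (?a + japanese \<zeta> powr (- p))" by blast
      then have "(C' * h \<zeta>)\<^sup>2 \<le> C'\<^sup>2 * (2 * (?a + japanese \<zeta> powr (- p)))"
        unfolding power_mult_distrib by (intro mult_left_mono) auto
      then have "(C' * h \<zeta>)\<^sup>2 \<le> 2 * C'\<^sup>2 * (?a + japanese \<zeta> powr (- p))" by (simp only: mult_ac)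
      moreover have "(g \<zeta>)\<^sup>2 = ennreal ((C' * h \<zeta>)\<^sup>2)"
        using \<open>C' \<ge> 0\<close> h0[of \<zeta>] by (simp add: g_def ennreal_power)
      ultimately have "(g \<zeta>)\<^sup>2 \<le> ennreal (2 * C'\<^sup>2 * (?a + japanese \<zeta> powr (- p)))"
        by (simp only: ennreal_leI)
      also have "\<dots> = ennreal (2 * C'\<^sup>2) * ennreal (?a + japanese \<zeta> powr (- p))"
        by (rule ennreal_mult) auto
      also have "ennreal (?a + japanese \<zeta> powr (- p)) = ennreal ?a + ennreal (japanese \<zeta> powr (- p))"
        by (rule ennreal_plus) auto
      also have "ennreal ?a = ennreal ((G \<zeta>)\<^sup>2 * japanese \<zeta> powr (2 * s)) * indicator \<Gamma> \<zeta>"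
        by (simp add: indicator_def)
      finally show "(g \<zeta>)\<^sup>2 \<le> ennreal (2 * C'\<^sup>2) * (ennreal ((G \<zeta>)\<^sup>2 * japanese \<zeta> powr (2 * s)) * indicator \<Gamma> \<zeta> +
          ennreal (japanese (\<zeta> - 0) powr (- p)))" by simp
    qed
    also have "\<dots> = ennreal (2 * C'\<^sup>2) * ((\<integral>\<^sup>+\<zeta>\<in>\<Gamma>. ennreal ((G \<zeta>)\<^sup>2 * japanese \<zeta> powr (2 * s)) \<partial>N) +
        (\<integral>\<^sup>+\<zeta>. ennreal (japanese (\<zeta> - 0) powr (- p)) \<partial>N))"
      by (subst nn_integral_cmult, measurable) (subst nn_integral_add, measurable)
    also have "\<dots> < \<infinity>"
      using fin le_less_trans[OF K(3)[of 0] K(1)] by (simp add: ennreal_mult_less_top)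
    finally show ?thesis using K(1) by (simp add: ennreal_mult_less_top)
  qed
  finally show thesis using that \<Gamma>' by blast
qed

section \<open>Equivalence of the two regularity conditions\<close>

lemma nn_integral_lattice_measure_finite_iff:
  fixes g :: "real^'n::finite \<Rightarrow> real"
  assumes [measurable]: "g \<in> borel_measurable borel" "\<Gamma> \<in> sets borel" and "\<And>x. g x \<ge> 0"
  shows "(\<integral>\<^sup>+x\<in>\<Gamma>. ennreal (g x) \<partial>lattice_measure) < \<infinity> \<longleftrightarrow> g summable_on (\<Gamma> \<inter> int_lattice)"
proof -
  have "(\<integral>\<^sup>+x\<in>\<Gamma>. ennreal (g x) \<partial>lattice_measure) = (\<integral>\<^sup>+x\<in>\<Gamma>. ennreal (g x) \<partial>count_space int_lattice)"
    by (rule nn_integral_lattice_measure) measurable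
  also have "\<dots> = (\<integral>\<^sup>+x. ennreal (g x) \<partial>count_space (\<Gamma> \<inter> int_lattice))"
    by (subst (1 2) nn_integral_count_space_indicator)
      (auto intro!: nn_integral_cong simp: indicator_def)
  finally show ?thesis using nonneg_summable_on_iff[of "\<Gamma> \<inter> int_lattice" g] assms(3) by simp
qed

text \<open>A common constant for both measures, as required for exchanging them in
  \<open>conic_l2_transfer\<close>.\<close>

lemma japanese_integrals_bounded:
  fixes p :: real
  defines "p \<equiv> real (CARD('n::finite) + 2)"
  obtains K where "K < \<infinity>"
    "\<And>\<zeta> :: real^'n. (\<integral>\<^sup>+\<xi>. ennreal (japanese (\<xi> - \<zeta>) powr (- p)) \<partial>lborel) \<le> K"
    "\<And>\<zeta> :: real^'n. (\<integral>\<^sup>+\<xi>. ennreal (japanese (\<xi> - \<zeta>) powr (- p)) \<partial>lattice_measure) \<le> K"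
proof -
  define K\<^sub>0 where "K\<^sub>0 = (\<integral>\<^sup>+x. ennreal (japanese (x :: real^'n) powr (- p)) \<partial>lborel)"
  define c where "c = ennreal ((2 * sqrt (1 + (real CARD('n))\<^sup>2)) powr p)"
  have "K\<^sub>0 < \<infinity>" unfolding K\<^sub>0_def p_def by (rule nn_integral_japanese_finite)
  show thesis
  proof (rule that[of "K\<^sub>0 + c * K\<^sub>0"])
    show "K\<^sub>0 + c * K\<^sub>0 < \<infinity>" using \<open>K\<^sub>0 < \<infinity>\<close> by (simp add: c_def ennreal_mult_less_top)
    show "(\<integral>\<^sup>+\<xi>. ennreal (japanese (\<xi> - \<zeta>) powr (- p)) \<partial>lborel) \<le> K\<^sub>0 + c * K\<^sub>0" for \<zeta> :: "real^'n"
      by (simp add: nn_integral_japanese_shift K\<^sub>0_def)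
    show "(\<integral>\<^sup>+\<xi>. ennreal (japanese (\<xi> - \<zeta>) powr (- p)) \<partial>lattice_measure) \<le> K\<^sub>0 + c * K\<^sub>0" for \<zeta> :: "real^'n"
      using lattice_sum_japanese_bound[of \<zeta>] unfolding K\<^sub>0_def c_def p_def
      by (rule order_trans) simp
  qed
qed

lemma open_cube: "open (cube \<eta> (x :: real^'n::finite))"
proof -
  have "cube \<eta> x = (\<Inter>j. {y. x $ j - \<eta> / 2 < y $ j} \<inter> {y. y $ j < x $ j + \<eta> / 2})"
    by (auto simp: cube_def)
  moreover have "open ({y. x $ j - \<eta> / 2 < y $ j} \<inter> {y :: real^'n. y $ j < x $ j + \<eta> / 2})" for j
    by (intro open_Int open_Collect_less continuous_intros)
  ultimately show ?thesis by (simp add: open_INT)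
qed

text \<open>The sequence \<open>a\<close> enters both as values of the transform and through its
  series: the implication from the lattice condition tests the series, and the converse has to
  produce it.\<close>

theorem theorem3p1:
  fixes f :: "(real^'n::finite \<Rightarrow> complex) \<Rightarrow> complex"
    and x\<^sub>0 \<xi>\<^sub>0 :: "real^'n" and s :: real
  assumes "distribution f" and "\<xi>\<^sub>0 \<noteq> 0"
  shows "(\<exists>\<Gamma> \<eta> \<phi> a. open_cone \<Gamma> \<and> \<xi>\<^sub>0 \<in> \<Gamma> \<and> 0 < \<eta> \<and> \<eta> < 1 \<and>
            \<phi> \<in> test_functions (cube \<eta> x\<^sub>0) \<and> (\<forall>\<^sub>F x in nhds x\<^sub>0. \<phi> x = 1) \<and>
            (\<forall>n\<in>int_lattice. a n = fourier (dist_mult \<phi> f) n) \<and>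
            has_fourier_series (periodic_ext (dist_mult \<phi> f)) a \<and>
            (\<lambda>n. (norm (a n))\<^sup>2 * japanese n powr (2 * s)) summable_on (\<Gamma> \<inter> int_lattice))
         \<longleftrightarrow> (x\<^sub>0, \<xi>\<^sub>0) \<notin> WF s f"
proof -
  note f = assms(1)
  obtain K where K: "K < \<infinity>"
    "\<And>\<zeta> :: real^'n. (\<integral>\<^sup>+\<xi>. ennreal (japanese (\<xi> - \<zeta>) powr (- real (CARD('n) + 2))) \<partial>lborel) \<le> K"
    "\<And>\<zeta> :: real^'n. (\<integral>\<^sup>+\<xi>. ennreal (japanese (\<xi> - \<zeta>) powr (- real (CARD('n) + 2))) \<partial>lattice_measure) \<le> K"
    by (rule japanese_integrals_bounded[where 'n='n]) blast
  have meas: "(\<lambda>\<xi>. norm (fourier (dist_mult \<psi> f) \<xi>)) \<in> borel_measurable borel"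
    "(\<lambda>\<xi>. (norm (fourier (dist_mult \<psi> f) \<xi>))\<^sup>2 * japanese \<xi> powr (2 * s)) \<in> borel_measurable borel"
    if "\<psi> \<in> test_functions UNIV" for \<psi>
  proof -
    have [measurable]: "fourier (dist_mult \<psi> f) \<in> borel_measurable borel"
      by (rule borel_measurable_continuous_onI[OF continuous_on_fourier[OF f that]])
    show "(\<lambda>\<xi>. norm (fourier (dist_mult \<psi> f) \<xi>)) \<in> borel_measurable borel"
      "(\<lambda>\<xi>. (norm (fourier (dist_mult \<psi> f) \<xi>))\<^sup>2 * japanese \<xi> powr (2 * s)) \<in> borel_measurable borel"
      by measurable
  qed
  have "(x\<^sub>0, \<xi>\<^sub>0) \<notin> WF s f \<longleftrightarrow> sobolev_regular_at s f x\<^sub>0 \<xi>\<^sub>0" using assms(2) by (simp add: WF_def)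
  moreover have "sobolev_regular_at s f x\<^sub>0 \<xi>\<^sub>0"
    if \<Gamma>: "open_cone \<Gamma>" "\<xi>\<^sub>0 \<in> \<Gamma>" and \<eta>: "0 < \<eta>" "\<eta> < 1"
      and \<phi>: "\<phi> \<in> test_functions (cube \<eta> x\<^sub>0)" and \<phi>1: "\<forall>\<^sub>F x in nhds x\<^sub>0. \<phi> x = 1"
      and a: "\<forall>n\<in>int_lattice. a n = fourier (dist_mult \<phi> f) n"
      and series: "has_fourier_series (periodic_ext (dist_mult \<phi> f)) a"
      and summ: "(\<lambda>n. (norm (a n))\<^sup>2 * japanese n powr (2 * s)) summable_on (\<Gamma> \<inter> int_lattice)"
    for \<Gamma> \<eta> \<phi> a
  proof -
    note \<phi>U = test_functions_UNIV[OF \<phi>]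
    let ?u = "fourier (dist_mult \<phi> f)"
    obtain V where V: "open V" "x\<^sub>0 \<in> V" "\<And>x. x \<in> V \<Longrightarrow> \<phi> x = 1"
      using \<phi>1 unfolding eventually_nhds by auto
    \<comment> \<open>Supported where \<open>\<phi> = 1\<close>, so that \<open>\<psi> f\<close> is
      a cutoff of \<open>\<phi> f\<close>.\<close>
    obtain \<psi> where \<psi>: "\<psi> \<in> test_functions V" "\<forall>\<^sub>F x in nhds x\<^sub>0. \<psi> x = 1"
      by (rule bump_function_exists[OF V(1,2)])
    note \<psi>U = test_functions_UNIV[OF \<psi>(1)]
    have \<psi>V: "x \<in> V" if "\<psi> x \<noteq> 0" for x
      using in_supp[of \<psi> x] test_functionsD(3)[OF \<psi>(1)] that by blast
    have \<phi>cube: "x \<in> cube \<eta> x\<^sub>0" if "\<phi> x \<noteq> 0" for x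
      using in_supp[of \<phi> x] test_functionsD(3)[OF \<phi>] that by blast
    \<comment> \<open>Two points of the cube differ by less than \<eta> < 1 in each coordinate, so
      no nonzero integer translate of \<open>\<psi>\<close> meets the support of
      \<open>\<phi>\<close>. The periodic extension therefore acts on \<open>\<psi>\<close> times a
      plane wave as \<open>\<phi> f\<close> does.\<close>
    have ext: "periodic_ext (dist_mult \<phi> f) (\<lambda>x. \<psi> x * plane_wave (- \<xi>) x) = fourier (dist_mult \<psi> f) \<xi>" for \<xi>
    proof -
      let ?\<theta> = "\<lambda>x. \<psi> x * plane_wave (- \<xi>) x"
      have "dist_mult \<phi> f (\<lambda>x. ?\<theta> (x - n)) = 0" if n: "n \<in> int_lattice" "n \<noteq> 0" for n
      proof -
        have "\<phi> x * ?\<theta> (x - n) = 0" for x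
        proof (rule ccontr)
          assume "\<phi> x * ?\<theta> (x - n) \<noteq> 0"
          then have "x \<in> cube \<eta> x\<^sub>0" "x - n \<in> cube \<eta> x\<^sub>0"
            using \<phi>cube[of x] \<phi>cube[of "x - n"] V(3)[OF \<psi>V[of "x - n"]] by auto
          have "n $ j = 0" for j
          proof -
            have "x\<^sub>0 $ j - \<eta> / 2 < x $ j" "x $ j < x\<^sub>0 $ j + \<eta> / 2"
              "x\<^sub>0 $ j - \<eta> / 2 < x $ j - n $ j" "x $ j - n $ j < x\<^sub>0 $ j + \<eta> / 2"
              using \<open>x \<in> cube \<eta> x\<^sub>0\<close> \<open>x - n \<in> cube \<eta> x\<^sub>0\<close> by (simp_all add: cube_def)
            then have "\<bar>n $ j\<bar> < 1" using \<eta> by linarith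
            moreover have "n $ j \<in> \<int>" using n by (simp add: int_lattice_def)
            ultimately show ?thesis by (auto elim!: Ints_cases)
          qed
          then show False using n by (simp add: vec_eq_iff)
        qed
        then have "(\<lambda>x. \<phi> x * ?\<theta> (x - n)) = (\<lambda>x. 0)" by (rule ext)
        then show ?thesis using distribution_0[OF f] by (simp add: dist_mult_def)
      qed
      then have "periodic_ext (dist_mult \<phi> f) ?\<theta> = (\<Sum>\<^sub>\<infinity>n\<in>{0}. dist_mult \<phi> f (\<lambda>x. ?\<theta> (x - n)))"
        unfolding periodic_ext_def by (intro infsum_cong_neutral) (auto simp: int_lattice_closed)
      also have "\<dots> = f (\<lambda>x. \<phi> x * ?\<theta> x)" by (simp add: dist_mult_def)
      also have "(\<lambda>x. \<phi> x * ?\<theta> x) = ?\<theta>"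
      proof
        show "\<phi> x * ?\<theta> x = ?\<theta> x" for x using \<psi>V[of x] V(3)[of x] by (cases "\<psi> x = 0") auto
      qed
      finally show ?thesis by (simp add: fourier_dist_mult)
    qed
    \<comment> \<open>Tested against \<open>\<psi>\<close> times
      \<open>plane_wave (- \<xi>)\<close>, the series has the terms
      \<open>a n * inv_fourier \<psi> (n - \<xi>)\<close>; rapid decay of the second factor is the
      kernel.\<close>
    have bound: "\<exists>C\<ge>0. \<forall>\<xi>. ennreal (norm (fourier (dist_mult \<psi> f) \<xi>)) \<le>
        (\<integral>\<^sup>+\<zeta>. ennreal (C * japanese (\<xi> - \<zeta>) powr (- A) * norm (?u \<zeta>)) \<partial>lattice_measure)" for A
    proof -
      obtain C where C: "C \<ge> 0" "\<And>y. norm (inv_fourier \<psi> y) \<le> C * japanese y powr (- A)"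
        by (rule inv_fourier_rapid_decay[OF \<psi>U, of A]) blast
      have "ennreal (norm (fourier (dist_mult \<psi> f) \<xi>)) \<le>
        (\<integral>\<^sup>+\<zeta>. ennreal (C * japanese (\<xi> - \<zeta>) powr (- A) * norm (?u \<zeta>)) \<partial>lattice_measure)" for \<xi>
      proof -
        let ?\<theta> = "\<lambda>x. \<psi> x * plane_wave (- \<xi>) x"
        have "((\<lambda>n. a n * inv_fourier ?\<theta> n) has_sum periodic_ext (dist_mult \<phi> f) ?\<theta>) int_lattice"
          unfolding inv_fourier_def
          by (rule bspec[OF series[unfolded has_fourier_series_def] test_functions_mult[OF \<psi>U smooth_plane_wave]])
        then have "ennreal (norm (fourier (dist_mult \<psi> f) \<xi>)) \<le>
            (\<integral>\<^sup>+n. ennreal (norm (a n * inv_fourier ?\<theta> n)) \<partial>count_space int_lattice)"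
          unfolding ext by (rule norm_has_sum_le)
        also have "\<dots> \<le> (\<integral>\<^sup>+\<zeta>. ennreal (C * japanese (\<xi> - \<zeta>) powr (- A) * norm (?u \<zeta>)) \<partial>count_space int_lattice)"
        proof (rule nn_integral_mono)
          fix n :: "real^'n" assume "n \<in> space (count_space int_lattice)"
          then have "norm (a n * inv_fourier ?\<theta> n) = norm (inv_fourier \<psi> (n - \<xi>)) * norm (?u n)"
            using a inv_fourier_mult_plane_wave[of \<psi> "- \<xi>" n] by (simp add: norm_mult)
          also have "\<dots> \<le> C * japanese (\<xi> - n) powr (- A) * norm (?u n)"
            using C(2)[of "n - \<xi>"] japanese_minus_commute[of n \<xi>] by (intro mult_right_mono) auto
          finally show "ennreal (norm (a n * inv_fourier ?\<theta> n)) \<le> ennreal (C * japanese (\<xi> - n) powr (- A) * norm (?u n))"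
            by (rule ennreal_leI)
        qed
        also have "\<dots> = (\<integral>\<^sup>+\<zeta>. ennreal (C * japanese (\<xi> - \<zeta>) powr (- A) * norm (?u \<zeta>)) \<partial>lattice_measure)"
        proof (rule nn_integral_lattice_measure[symmetric])
          have "(\<lambda>\<zeta>. C * japanese (\<xi> - \<zeta>) powr (- A) * norm (?u \<zeta>)) \<in> borel_measurable borel"
            by (intro borel_measurable_times meas(1)[OF \<phi>U]) measurable
          then show "(\<lambda>\<zeta>. ennreal (C * japanese (\<xi> - \<zeta>) powr (- A) * norm (?u \<zeta>))) \<in> borel_measurable borel"
            by simp
        qed
        finally show ?thesis .
      qed
      with C(1) show ?thesis by blast
    qed
    obtain D m where D: "\<And>\<zeta>. norm (?u \<zeta>) \<le> D * japanese \<zeta> ^ m"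
      by (rule fourier_polynomial_bound[OF f \<phi>U]) blast
    have "(\<lambda>n. (norm (?u n))\<^sup>2 * japanese n powr (2 * s)) summable_on (\<Gamma> \<inter> int_lattice)"
      using summ by (rule summable_on_cong[THEN iffD1, rotated]) (use a in auto)
    then have "(\<integral>\<^sup>+\<zeta>\<in>\<Gamma>. ennreal ((norm (?u \<zeta>))\<^sup>2 * japanese \<zeta> powr (2 * s)) \<partial>lattice_measure) < \<infinity>"
      using \<Gamma>(1) meas(2)[OF \<phi>U]
      by (subst nn_integral_lattice_measure_finite_iff) (auto simp: open_cone_def)
    \<comment> \<open>From sums to integrals: the lattice carries the given condition and Lebesgue
      measure the new one.\<close>
    then obtain \<Gamma>' where "open_cone \<Gamma>'" "\<xi>\<^sub>0 \<in> \<Gamma>'"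
      "(\<integral>\<^sup>+\<xi>\<in>\<Gamma>'. ennreal ((norm (fourier (dist_mult \<psi> f) \<xi>))\<^sup>2 * japanese \<xi> powr (2 * s)) \<partial>lborel) < \<infinity>"
      by (rule conic_l2_transfer[OF sigma_finite_lborel sigma_finite_lattice_measure sets_lborel
            sets_lattice_measure K meas(1)[OF \<phi>U] norm_ge_zero D norm_ge_zero bound \<Gamma> assms(2)])
    with \<psi>(2) \<psi>U show ?thesis unfolding sobolev_regular_at_def by blast
  qed
  moreover have "\<exists>\<Gamma> \<eta> \<phi> a. open_cone \<Gamma> \<and> \<xi>\<^sub>0 \<in> \<Gamma> \<and> 0 < \<eta> \<and> \<eta> < 1 \<and>
            \<phi> \<in> test_functions (cube \<eta> x\<^sub>0) \<and> (\<forall>\<^sub>F x in nhds x\<^sub>0. \<phi> x = 1) \<and>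
            (\<forall>n\<in>int_lattice. a n = fourier (dist_mult \<phi> f) n) \<and>
            has_fourier_series (periodic_ext (dist_mult \<phi> f)) a \<and>
            (\<lambda>n. (norm (a n))\<^sup>2 * japanese n powr (2 * s)) summable_on (\<Gamma> \<inter> int_lattice)"
    if "sobolev_regular_at s f x\<^sub>0 \<xi>\<^sub>0"
  proof -
    obtain \<Gamma> \<psi> where \<Gamma>: "open_cone \<Gamma>" "\<xi>\<^sub>0 \<in> \<Gamma>" and \<psi>: "\<psi> \<in> test_functions UNIV"
      and \<psi>1: "\<forall>\<^sub>F x in nhds x\<^sub>0. \<psi> x = 1"
      and fin: "(\<integral>\<^sup>+\<xi>\<in>\<Gamma>. ennreal ((norm (fourier (dist_mult \<psi> f) \<xi>))\<^sup>2 * japanese \<xi> powr (2 * s)) \<partial>lborel) < \<infinity>"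
      using \<open>sobolev_regular_at s f x\<^sub>0 \<xi>\<^sub>0\<close> unfolding sobolev_regular_at_def by blast
    obtain V where V: "open V" "x\<^sub>0 \<in> V" "\<And>x. x \<in> V \<Longrightarrow> \<psi> x = 1"
      using \<psi>1 unfolding eventually_nhds by auto
    have "open (V \<inter> cube (1 / 2) x\<^sub>0)" by (intro open_Int V(1) open_cube)
    moreover have "x\<^sub>0 \<in> V \<inter> cube (1 / 2) x\<^sub>0" using V(2) by (simp add: cube_def)
    \<comment> \<open>Any side length below 1 would serve. The cutoff must also stay where
      \<open>\<psi> = 1\<close>, so that the product of the two is \<open>\<phi>\<close>.\<close>
    ultimately obtain \<phi> where \<phi>: "\<phi> \<in> test_functions (V \<inter> cube (1 / 2) x\<^sub>0)" "\<forall>\<^sub>F x in nhds x\<^sub>0. \<phi> x = 1"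
      by (rule bump_function_exists)
    note \<phi>U = test_functions_UNIV[OF \<phi>(1)]
    have \<phi>cube: "\<phi> \<in> test_functions (cube (1 / 2) x\<^sub>0)"
      using \<phi>(1) by (auto simp: test_functions_def)
    have eq: "(\<lambda>x. \<psi> x * \<phi> x) = \<phi>"
    proof
      show "\<psi> x * \<phi> x = \<phi> x" for x
        using in_supp[of \<phi> x] test_functionsD(3)[OF \<phi>(1)] V(3)[of x] by (cases "\<phi> x = 0") auto
    qed
    have bound: "\<exists>C\<ge>0. \<forall>\<xi>. ennreal (norm (fourier (dist_mult \<phi> f) \<xi>)) \<le>
        (\<integral>\<^sup>+\<zeta>. ennreal (C * japanese (\<xi> - \<zeta>) powr (- A) * norm (fourier (dist_mult \<psi> f) \<zeta>)) \<partial>lborel)" for A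
      by (rule fourier_dist_mult_convolution_bound[OF f \<psi> \<phi>U, of A, unfolded eq]) blast
    obtain D m where D: "\<And>\<zeta>. norm (fourier (dist_mult \<psi> f) \<zeta>) \<le> D * japanese \<zeta> ^ m"
      by (rule fourier_polynomial_bound[OF f \<psi>]) blast
    \<comment> \<open>The measures are interchanged, and with them the two kernel bounds in
      \<open>K(1,3,2)\<close>.\<close>
    obtain \<Gamma>' where \<Gamma>': "open_cone \<Gamma>'" "\<xi>\<^sub>0 \<in> \<Gamma>'"
      "(\<integral>\<^sup>+\<xi>\<in>\<Gamma>'. ennreal ((norm (fourier (dist_mult \<phi> f) \<xi>))\<^sup>2 * japanese \<xi> powr (2 * s)) \<partial>lattice_measure) < \<infinity>"
      by (rule conic_l2_transfer[OF sigma_finite_lattice_measure sigma_finite_lborel sets_lattice_measure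
            sets_lborel K(1,3,2) meas(1)[OF \<psi>] norm_ge_zero D norm_ge_zero bound \<Gamma> assms(2) fin])
    from \<Gamma>'(3) have "(\<lambda>n. (norm (fourier (dist_mult \<phi> f) n))\<^sup>2 * japanese n powr (2 * s)) summable_on (\<Gamma>' \<inter> int_lattice)"
      using \<Gamma>'(1) meas(2)[OF \<phi>U]
      by (subst (asm) nn_integral_lattice_measure_finite_iff) (auto simp: open_cone_def)
    then show ?thesis
      using \<Gamma>' \<phi>(2) \<phi>cube has_fourier_series_periodic_ext[OF f \<phi>U]
      by (intro exI[of _ \<Gamma>'] exI[of _ "1 / 2"] exI[of _ \<phi>] exI[of _ "fourier (dist_mult \<phi> f)"]) auto
  qed
  ultimately show ?thesis by blast
qed

end
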